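(* Let $d\in\mathbb N$ and let $\{X(\boldsymbol s):\boldsymbol s\in\mathbb R^d\}$ be a real-valued strictly stationary regularly varying process with normalising sequence $(a_n)$, observed on the grid $\mathcal S_n=\{1,\dots,n\}^d$. Let $\mathcal H=\{\boldsymbol h_1,\dots,\boldsymbol h_p\}\subset\mathbb Z^d$ be a finite set of lags with $\mathcal H\subseteq B(\boldsymbol 0,\gamma)$ for some $\gamma>0$, and let $A,B$ be $\mu$-continuous Borel sets in $\overline{\mathbb R}\setminus\{0\}$ with $\mu(A)>0$. Suppose that (M1) $\{X(\boldsymbol s)\}$ is $\alpha$-mixing, and that there exist sequences $m_n\to\infty$ and $r_n\to\infty$ with $m_n/n\to0$ and $r_n/m_n\to0$ as $n\to\infty$ such that: (M2) $m_n^2r_n^2/n\to0$; (M3) for all $\epsilon>0$, $$\lim_{k\to\infty}\limsup_{n\to\infty}\sum_{\boldsymbol h\in\mathbb Z^d:\,k<\|\boldsymbol h\|\le r_n} m_n^d\,\mathbb P\Big(\max_{\boldsymbol s\in B(\boldsymbol 0,\gamma)}|X(\boldsymbol s)|>\epsilon a_{m_n},\ \max_{\boldsymbol s'\in B(\boldsymbol h,\gamma)}|X(\boldsymbol s')|>\epsilon a_{m_n}\Big)=0;$$ (M4) (i) $\lim_{n\to\infty}m_n^d\sum_{\boldsymbol h\in\mathbb Z^d:\,\|\boldsymbol h\|>r_n}\alpha_{1,1}(\|\boldsymbol h\|)=0$; (ii) $\sum_{\boldsymbol h\in\mathbb Z^d}\alpha_{k,\ell}(\|\boldsymbol h\|)<\infty$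 for all $k,\ell\in\mathbb N$ with $2\le k+\ell\le4$; (iii) $\lim_{n\to\infty}m_n^{d/2}n^{d/2}\alpha_{1,n^d}(r_n)=0$. Then $$\Big(\frac{n}{m_n}\Big)^{d/2}\big(\widehat\rho_{AB,m_n}(\boldsymbol h)-\rho_{AB,m_n}(\boldsymbol h)\big)_{\boldsymbol h\in\mathcal H}\xrightarrow{d}\mathcal N(\boldsymbol 0,\Pi),\qquad n\to\infty,$$ where $\Pi=\mu(A)^{-4}F\Sigma F^{\top}\in\mathbb R^{p\times p}$, the matrix $\Sigma\in\mathbb R^{(p+1)\times(p+1)}$ has entries, for $1\le i,j\le p+1$, $$\Sigma_{ii}=\mu_{B(\boldsymbol 0,\gamma)}(D_i)+\sum_{\boldsymbol h\in\mathbb Z^d\setminus\{\boldsymbol 0\}}\tau_{B(\boldsymbol 0,\gamma)\times B(\boldsymbol h,\gamma)}(D_i\times D_i),$$ $$\Sigma_{ij}=\mu_{B(\boldsymbol 0,\gamma)}(D_i\cap D_j)+\sum_{\boldsymbol h\in\mathbb Z^d\setminus\{\boldsymbol 0\}}\tau_{B(\boldsymbol 0,\gamma)\times B(\boldsymbol h,\gamma)}(D_i\times D_j),\quad i\ne j,$$ and $F=[F_1,F_2]\in\mathbb R^{p\times(p+1)}$ with $F_1=\mathrm{diag}(\mu(A),\dots,\mu(A))\in\mathbb R^{p\times p}$ and $F_2=(-\mu_{B(\boldsymbol 0,\gamma)}(D_1),\dots,-\mu_{B(\boldsymbol 0,\gamma)}(D_p))^{\top}$.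
   Context: Notation. $\overline{\mathbb R}=\mathbb R\cup\{-\infty,\infty\}$; $\|\cdot\|$ is a fixed arbitrary norm on $\mathbb R^d$; $f(n)\sim g(n)$ means $f(n)/g(n)\to1$; $m_n$ are positive integers. Regular variation. For finite $\mathcal I\subset\mathbb R^d$ put $X_{\mathcal I}=(X(\boldsymbol s):\boldsymbol s\in\mathcal I)^{\top}$. A strictly stationary process $\{X(\boldsymbol s):\boldsymbol s\in\mathbb R^d\}$ is regularly varying if there is a sequence $0<a_n\to\infty$ with $\mathbb P(|X(\boldsymbol 0)|>a_n)\sim n^{-d}$ such that for every finite $\mathcal I\subset\mathbb R^d$, $n^d\,\mathbb P(X_{\mathcal I}/a_n\in\cdot)$ converges vaguely to some non-null Radon measure $\mu_{\mathcal I}$ on the Borel sets of $\overline{\mathbb R}^{|\mathcal I|}\setminus\{\boldsymbol 0\}$; then for some $\beta>0$ (the index), $\mu_{\mathcal I}(xC)=x^{-\beta}\mu_{\mathcal I}(C)$ for $x>0$ and Borel $C$. Write $\mu=\mu_{\{\boldsymbol 0\}}$. A Borel set $C$ is $\mu_{\mathcal I}$-continuous if $\mu_{\mathcal I}(\partial C)=0$; such sets are always understood to be bounded away from the origin. Balls and vectorized process. $B(\boldsymbol s,\gamma)=\{\boldsymbol s'\in\mathbb Z^d:\|\boldsymbol s-\boldsymbol s'\|\le\gamma\}$ for $\boldsymbol s\in\mathbb Z^d$, and $\boldsymbol Y(\boldsymbol s)=X_{B(\boldsymbol s,\gamma)}$. For $\mu_{B(\boldsymbol 0,\gamma)}$-continuous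 $C$, $\mu_{B(\boldsymbol 0,\gamma)}(C)=\lim_n n^d\mathbb P(\boldsymbol Y(\boldsymbol 0)/a_n\in C)$, and, for continuity sets $C\times D$ of the limit measure, $\tau_{B(\boldsymbol 0,\gamma)\times B(\boldsymbol h,\gamma)}(C\times D)=\lim_n n^d\mathbb P(\boldsymbol Y(\boldsymbol 0)/a_n\in C,\ \boldsymbol Y(\boldsymbol h)/a_n\in D)$; the limits exist by regular variation. Sets $D_i$. $D_1,\dots,D_{p+1}\subset\overline{\mathbb R}^{|B(\boldsymbol 0,\gamma)|}\setminus\{\boldsymbol 0\}$ are the ($\mu_{B(\boldsymbol 0,\gamma)}$-continuous) Borel sets determined by $\{\boldsymbol Y(\boldsymbol s)\in D_i\}=\{X(\boldsymbol s)\in A,\ X(\boldsymbol s+\boldsymbol h_i)\in B\}$ for $i=1,\dots,p$ and $\{\boldsymbol Y(\boldsymbol s)\in D_{p+1}\}=\{X(\boldsymbol s)\in A\}$. Extremograms. With $\mathcal S_n(\boldsymbol h)=\{\boldsymbol s\in\mathcal S_n:\boldsymbol s+\boldsymbol h\in\mathcal S_n\}$, the empirical extremogram is $$\widehat\rho_{AB,m_n}(\boldsymbol h)=\frac{|\mathcal S_n(\boldsymbol h)|^{-1}\sum_{\boldsymbol s\in\mathcal S_n(\boldsymbol h)}\mathbf 1\{X(\boldsymbol s)/a_{m_n}\in A,\ X(\boldsymbol s+\boldsymbol h)/a_{m_n}\in B\}}{|\mathcal S_n|^{-1}\sum_{\boldsymbol s\in\mathcal S_n}\mathbf 1\{X(\boldsymbol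 s)/a_{m_n}\in A\}},$$ and the pre-asymptotic extremogram is $$\rho_{AB,m_n}(\boldsymbol h)=\frac{\mathbb P(X(\boldsymbol 0)/a_{m_n}\in A,\ X(\boldsymbol h)/a_{m_n}\in B)}{\mathbb P(X(\boldsymbol 0)/a_{m_n}\in A)}.$$ Mixing. For $\Lambda_1,\Lambda_2\subset\mathbb Z^d$ let $d(\Lambda_1,\Lambda_2)=\inf\{\|\boldsymbol s_1-\boldsymbol s_2\|:\boldsymbol s_i\in\Lambda_i\}$ and $\mathcal F_\Lambda=\sigma\{X(\boldsymbol s):\boldsymbol s\in\Lambda\}$. For $k,\ell\in\mathbb N\cup\{\infty\}$, $r\ge0$, let $\alpha^X_{k,\ell}(r)=\sup\{|\mathbb P(A_1\cap A_2)-\mathbb P(A_1)\mathbb P(A_2)|:A_i\in\mathcal F_{\Lambda_i},|\Lambda_1|\le k,|\Lambda_2|\le\ell,d(\Lambda_1,\Lambda_2)\ge r\}$. The field is $\alpha$-mixing if $\alpha^X_{k,\ell}(r)\to0$ as $r\to\infty$ for all $k,\ell\in\mathbb N$. The coefficients $\alpha_{k,\ell}$ used in (M4) are those of the vectorized process: $$\alpha_{k,\ell}(r)=\sup\{|\mathbb P(A_1\cap A_2)-\mathbb P(A_1)\mathbb P(A_2)|:A_i\in\mathcal F_{\Lambda_i},\ \Lambda_i=\textstyle\bigcup_{\boldsymbol s\in\Lambda_i'}B(\boldsymbol s,\gamma),\ |\Lambda_1'|\le k,\ |\Lambda_2'|\le\ell,\ d(\Lambda_1',\Lambda_2')\ge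 r\}.$$ *)

theory Defs
  imports "HOL-Probability.Probability" "HOL-Library.Landau_Symbols"
begin

definition is_norm :: "('v::real_vector \<Rightarrow> real) \<Rightarrow> bool" where
  "is_norm nrm \<longleftrightarrow>
     (\<forall>x. 0 \<le> nrm x) \<and> (\<forall>x. nrm x = 0 \<longleftrightarrow> x = 0) \<and>
     (\<forall>c x. nrm (c *\<^sub>R x) = \<bar>c\<bar> * nrm x) \<and> (\<forall>x y. nrm (x + y) \<le> nrm x + nrm y)"

text \<open>\<open>\<int>\<^sup>d\<close> is kept as a subset of \<open>\<real>\<^sup>d\<close>, so that no coercion of lattice sites is needed.\<close>

definition Zd :: "(real^'d) set" where
  "Zd = {s. \<forall>i. s $ i \<in> \<int>}"

definition zball :: "(real^'d \<Rightarrow> real) \<Rightarrow> real^'d \<Rightarrow> real \<Rightarrow> (real^'d) set" where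
  "zball nrm s \<gamma> = {s' \<in> Zd. nrm (s - s') \<le> \<gamma>}"

definition grid :: "nat \<Rightarrow> (real^'d) set" where
  "grid n = {s. \<forall>i. s $ i \<in> real ` {1..n}}"

definition grid_lag :: "nat \<Rightarrow> real^'d \<Rightarrow> (real^'d) set" where
  "grid_lag n h = {s \<in> grid n. s + h \<in> grid n}"

text \<open>On a locally compact, second countable Hausdorff space (the only case used below) a Borel
  measure which is finite on compact sets is automatically regular.\<close>

definition radon_measure_on :: "'a topology \<Rightarrow> 'a measure \<Rightarrow> bool" where
  "radon_measure_on T \<nu> \<longleftrightarrow>
     space \<nu> = topspace T \<and> sets \<nu> = sigma_sets (topspace T) {U. openin T U} \<and>
     (\<forall>K. compactin T K \<longrightarrow> emeasure \<nu> K < \<infinity>)"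

definition vaguely_converges :: "'a topology \<Rightarrow> (nat \<Rightarrow> 'a measure) \<Rightarrow> 'a measure \<Rightarrow> bool" where
  "vaguely_converges T N \<nu> \<longleftrightarrow>
     (\<forall>f. continuous_map T euclideanreal f \<and>
          (\<exists>K. compactin T K \<and> (\<forall>x \<in> topspace T - K. f x = 0)) \<longrightarrow>
          (\<lambda>n. \<integral>x. f x \<partial>N n) \<longlonglongrightarrow> (\<integral>x. f x \<partial>\<nu>))"

text \<open>The product of copies of the extended real line indexed by \<open>I\<close>, without the origin. Points are
  functions that are \<open>undefined\<close> outside \<open>I\<close>.\<close>

definition punctured :: "'s set \<Rightarrow> ('s \<Rightarrow> ereal) topology" where
  "punctured I = subtopology (product_topology (\<lambda>_. euclidean) I) (- {\<lambda>s\<in>I. 0})"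

definition strictly_stationary :: "'w measure \<Rightarrow> ('s::ab_group_add \<Rightarrow> 'w \<Rightarrow> real) \<Rightarrow> bool" where
  "strictly_stationary M X \<longleftrightarrow>
     (\<forall>I u. finite I \<longrightarrow>
        distr M (Pi\<^sub>M I (\<lambda>_. borel)) (\<lambda>\<omega>. \<lambda>s\<in>I. X (s + u) \<omega>) =
        distr M (Pi\<^sub>M I (\<lambda>_. borel)) (\<lambda>\<omega>. \<lambda>s\<in>I. X s \<omega>))"

text \<open>The measure \<open>n\<^sup>d P(X\<^sub>I / a\<^sub>n \<in> \<cdot>)\<close> on the punctured space.\<close>

definition scaled_law ::
  "'w measure \<Rightarrow> (real^'d \<Rightarrow> 'w \<Rightarrow> real) \<Rightarrow> (nat \<Rightarrow> real) \<Rightarrow> (real^'d) set \<Rightarrow> nat \<Rightarrow> (real^'d \<Rightarrow> ereal) measure"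
where
  "scaled_law M X a I n =
     scale_measure (ennreal (real n ^ CARD('d)))
       (restrict_space
          (distr M (Pi\<^sub>M I (\<lambda>_. borel)) (\<lambda>\<omega>. \<lambda>s\<in>I. ereal (X s \<omega> / a n)))
          (topspace (punctured I)))"

text \<open>The predicate records the normalising sequence \<open>a\<close> and the (uniquely determined) limit
  measures \<open>\<mu> I\<close>. The empty index set is excluded: its punctured space is empty, hence carries no
  non-null measure.\<close>

definition regularly_varying ::
  "'w measure \<Rightarrow> (real^'d \<Rightarrow> 'w \<Rightarrow> real) \<Rightarrow> (nat \<Rightarrow> real) \<Rightarrow>
   ((real^'d) set \<Rightarrow> (real^'d \<Rightarrow> ereal) measure) \<Rightarrow> bool"
where
  "regularly_varying M X a \<mu> \<longleftrightarrow>
     (\<forall>n\<ge>1. 0 < a n) \<and> filterlim a at_top sequentially \<and>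
     (\<lambda>n. \<P>(\<omega> in M. \<bar>X 0 \<omega>\<bar> > a n)) \<sim>[sequentially] (\<lambda>n. 1 / real n ^ CARD('d)) \<and>
     (\<forall>I. finite I \<and> I \<noteq> {} \<longrightarrow>
        radon_measure_on (punctured I) (\<mu> I) \<and> emeasure (\<mu> I) (space (\<mu> I)) \<noteq> 0 \<and>
        vaguely_converges (punctured I) (scaled_law M X a I) (\<mu> I))"

text \<open>The limit measure for \<open>I = {0}\<close>, transported to the extended real line (where it gives no
  mass to the origin).\<close>

definition mu0 :: "((real^'d) set \<Rightarrow> (real^'d \<Rightarrow> ereal) measure) \<Rightarrow> ereal measure" where
  "mu0 \<mu> = distr (\<mu> {0}) borel (\<lambda>y. y 0)"

definition continuity_set :: "ereal measure \<Rightarrow> ereal set \<Rightarrow> bool" where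
  "continuity_set \<nu> C \<longleftrightarrow>
     C \<in> sets borel \<and> (\<exists>\<epsilon>>0. \<forall>x\<in>C. ereal \<epsilon> \<le> \<bar>x\<bar>) \<and> emeasure \<nu> (frontier C) = 0"

definition gen_sigma :: "'w measure \<Rightarrow> ('s \<Rightarrow> 'w \<Rightarrow> real) \<Rightarrow> 's set \<Rightarrow> 'w set set" where
  "gen_sigma M X \<Lambda> = sigma_sets (space M) {X s -` E \<inter> space M | s E. s \<in> \<Lambda> \<and> E \<in> sets borel}"

definition site_dist :: "('v::real_vector \<Rightarrow> real) \<Rightarrow> 'v set \<Rightarrow> 'v set \<Rightarrow> ereal" where
  "site_dist nrm \<Lambda>1 \<Lambda>2 = (INF (s1, s2) \<in> \<Lambda>1 \<times> \<Lambda>2. ereal (nrm (s1 - s2)))"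

text \<open>The empty set is at distance \<open>\<infinity>\<close> from every set, so the suprema below are taken over nonempty
  sets of reals; these are bounded by \<open>1\<close>.\<close>

definition alpha_X ::
  "'w measure \<Rightarrow> (real^'d \<Rightarrow> 'w \<Rightarrow> real) \<Rightarrow> (real^'d \<Rightarrow> real) \<Rightarrow> nat \<Rightarrow> nat \<Rightarrow> real \<Rightarrow> real"
where
  "alpha_X M X nrm k l r =
     Sup {\<bar>measure M (A1 \<inter> A2) - measure M A1 * measure M A2\<bar> | A1 A2 \<Lambda>1 \<Lambda>2.
            \<Lambda>1 \<subseteq> Zd \<and> finite \<Lambda>1 \<and> card \<Lambda>1 \<le> k \<and> \<Lambda>2 \<subseteq> Zd \<and> finite \<Lambda>2 \<and> card \<Lambda>2 \<le> l \<and>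
            ereal r \<le> site_dist nrm \<Lambda>1 \<Lambda>2 \<and>
            A1 \<in> gen_sigma M X \<Lambda>1 \<and> A2 \<in> gen_sigma M X \<Lambda>2}"

definition alpha_mixing ::
  "'w measure \<Rightarrow> (real^'d \<Rightarrow> 'w \<Rightarrow> real) \<Rightarrow> (real^'d \<Rightarrow> real) \<Rightarrow> bool"
where
  "alpha_mixing M X nrm \<longleftrightarrow> (\<forall>k l. (alpha_X M X nrm k l \<longlongrightarrow> 0) at_top)"

text \<open>Coefficients of the vectorized process: sizes and distances refer to the centres.\<close>

definition alpha_Y ::
  "'w measure \<Rightarrow> (real^'d \<Rightarrow> 'w \<Rightarrow> real) \<Rightarrow> (real^'d \<Rightarrow> real) \<Rightarrow> real \<Rightarrow> nat \<Rightarrow> nat \<Rightarrow> real \<Rightarrow> real"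
where
  "alpha_Y M X nrm \<gamma> k l r =
     Sup {\<bar>measure M (A1 \<inter> A2) - measure M A1 * measure M A2\<bar> | A1 A2 \<Lambda>1 \<Lambda>2.
            \<Lambda>1 \<subseteq> Zd \<and> finite \<Lambda>1 \<and> card \<Lambda>1 \<le> k \<and> \<Lambda>2 \<subseteq> Zd \<and> finite \<Lambda>2 \<and> card \<Lambda>2 \<le> l \<and>
            ereal r \<le> site_dist nrm \<Lambda>1 \<Lambda>2 \<and>
            A1 \<in> gen_sigma M X (\<Union>s\<in>\<Lambda>1. zball nrm s \<gamma>) \<and>
            A2 \<in> gen_sigma M X (\<Union>s\<in>\<Lambda>2. zball nrm s \<gamma>)}"

text \<open>Where a denominator vanishes, the ratios below are \<open>0\<close>. For the empirical extremogram this
  happens on an event whose probability tends to \<open>0\<close>, for the pre-asymptotic one only for finitely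
  many \<open>n\<close>, under the assumptions of the limit theorem.\<close>

definition emp_extremogram ::
  "(real^'d \<Rightarrow> 'w \<Rightarrow> real) \<Rightarrow> (nat \<Rightarrow> real) \<Rightarrow> ereal set \<Rightarrow> ereal set \<Rightarrow> (nat \<Rightarrow> nat) \<Rightarrow>
   nat \<Rightarrow> real^'d \<Rightarrow> 'w \<Rightarrow> real"
where
  "emp_extremogram X a A B m n h \<omega> =
     ((\<Sum>s\<in>grid_lag n h. of_bool (ereal (X s \<omega> / a (m n)) \<in> A \<and> ereal (X (s + h) \<omega> / a (m n)) \<in> B))
        / real (card (grid_lag n h)))
     / ((\<Sum>s\<in>(grid n :: (real^'d) set). of_bool (ereal (X s \<omega> / a (m n)) \<in> A))
        / real (card (grid n :: (real^'d) set)))"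

definition pre_extremogram ::
  "'w measure \<Rightarrow> (real^'d \<Rightarrow> 'w \<Rightarrow> real) \<Rightarrow> (nat \<Rightarrow> real) \<Rightarrow> ereal set \<Rightarrow> ereal set \<Rightarrow> (nat \<Rightarrow> nat) \<Rightarrow>
   nat \<Rightarrow> real^'d \<Rightarrow> real"
where
  "pre_extremogram M X a A B m n h =
     \<P>(\<omega> in M. ereal (X 0 \<omega> / a (m n)) \<in> A \<and> ereal (X h \<omega> / a (m n)) \<in> B)
     / \<P>(\<omega> in M. ereal (X 0 \<omega> / a (m n)) \<in> A)"

text \<open>\<open>Y(s) / c\<close>, where the coordinate \<open>X(s + u)\<close> carries the index \<open>u \<in> B(0,\<gamma>)\<close> for every \<open>s\<close>, so
  that one and the same set \<open>D\<close> can be tested at all sites.\<close>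

definition vec_scaled ::
  "(real^'d \<Rightarrow> 'w \<Rightarrow> real) \<Rightarrow> (real^'d \<Rightarrow> real) \<Rightarrow> real \<Rightarrow> real \<Rightarrow> real^'d \<Rightarrow> 'w \<Rightarrow> (real^'d \<Rightarrow> ereal)"
where
  "vec_scaled X nrm \<gamma> c s \<omega> = (\<lambda>u\<in>zball nrm 0 \<gamma>. ereal (X (s + u) \<omega> / c))"

text \<open>The limit exists, by regular variation on the union of the balls around \<open>0\<close> and \<open>h\<close>, whenever
  \<open>C \<times> D\<close> is a continuity set; otherwise the value is not meaningful.\<close>

definition tau ::
  "'w measure \<Rightarrow> (real^'d \<Rightarrow> 'w \<Rightarrow> real) \<Rightarrow> (nat \<Rightarrow> real) \<Rightarrow> (real^'d \<Rightarrow> real) \<Rightarrow> real \<Rightarrow> real^'d \<Rightarrow>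
   (real^'d \<Rightarrow> ereal) set \<Rightarrow> (real^'d \<Rightarrow> ereal) set \<Rightarrow> real"
where
  "tau M X a nrm \<gamma> h C D =
     lim (\<lambda>n. real n ^ CARD('d) *
              \<P>(\<omega> in M. vec_scaled X nrm \<gamma> (a n) 0 \<omega> \<in> C \<and> vec_scaled X nrm \<gamma> (a n) h \<omega> \<in> D))"

text \<open>The index type \<open>'p\<close> enumerates the \<open>p\<close> lags; in \<open>'p option\<close> the element \<open>None\<close> plays the role
  of the index \<open>p + 1\<close>.\<close>

definition Dset ::
  "(real^'d \<Rightarrow> real) \<Rightarrow> real \<Rightarrow> ereal set \<Rightarrow> ereal set \<Rightarrow> ('p \<Rightarrow> real^'d) \<Rightarrow> 'p option \<Rightarrow> (real^'d \<Rightarrow> ereal) set"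
where
  "Dset nrm \<gamma> A B h i =
     (case i of
        Some j \<Rightarrow> {y \<in> topspace (punctured (zball nrm 0 \<gamma>)). y 0 \<in> A \<and> y (h j) \<in> B}
      | None \<Rightarrow> {y \<in> topspace (punctured (zball nrm 0 \<gamma>)). y 0 \<in> A})"

text \<open>The diagonal needs no separate clause since \<open>D\<^sub>i \<inter> D\<^sub>i = D\<^sub>i\<close>.\<close>

definition Sigma_mat ::
  "'w measure \<Rightarrow> (real^'d \<Rightarrow> 'w \<Rightarrow> real) \<Rightarrow> (nat \<Rightarrow> real) \<Rightarrow>
   ((real^'d) set \<Rightarrow> (real^'d \<Rightarrow> ereal) measure) \<Rightarrow> (real^'d \<Rightarrow> real) \<Rightarrow> real \<Rightarrow>
   ereal set \<Rightarrow> ereal set \<Rightarrow> ('p \<Rightarrow> real^'d) \<Rightarrow> real^('p::finite option)^('p option)"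
where
  "Sigma_mat M X a \<mu> nrm \<gamma> A B h =
     (\<chi> i j. measure (\<mu> (zball nrm 0 \<gamma>)) (Dset nrm \<gamma> A B h i \<inter> Dset nrm \<gamma> A B h j)
       + (\<Sum>\<^sub>\<infinity>u\<in>Zd - {0}. tau M X a nrm \<gamma> u (Dset nrm \<gamma> A B h i) (Dset nrm \<gamma> A B h j)))"

definition F_mat ::
  "((real^'d) set \<Rightarrow> (real^'d \<Rightarrow> ereal) measure) \<Rightarrow> (real^'d \<Rightarrow> real) \<Rightarrow> real \<Rightarrow>
   ereal set \<Rightarrow> ereal set \<Rightarrow> ('p \<Rightarrow> real^'d) \<Rightarrow> real^('p::finite option)^'p"
where
  "F_mat \<mu> nrm \<gamma> A B h =
     (\<chi> i j. case j of
        Some k \<Rightarrow> (if i = k then measure (mu0 \<mu>) A else 0)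
      | None \<Rightarrow> - measure (\<mu> (zball nrm 0 \<gamma>)) (Dset nrm \<gamma> A B h (Some i)))"

definition Pi_mat ::
  "'w measure \<Rightarrow> (real^'d \<Rightarrow> 'w \<Rightarrow> real) \<Rightarrow> (nat \<Rightarrow> real) \<Rightarrow>
   ((real^'d) set \<Rightarrow> (real^'d \<Rightarrow> ereal) measure) \<Rightarrow> (real^'d \<Rightarrow> real) \<Rightarrow> real \<Rightarrow>
   ereal set \<Rightarrow> ereal set \<Rightarrow> ('p \<Rightarrow> real^'d) \<Rightarrow> real^'p::finite^'p"
where
  "Pi_mat M X a \<mu> nrm \<gamma> A B h =
     inverse (measure (mu0 \<mu>) A ^ 4) *\<^sub>R
       (F_mat \<mu> nrm \<gamma> A B h ** Sigma_mat M X a \<mu> nrm \<gamma> A B h ** transpose (F_mat \<mu> nrm \<gamma> A B h))"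

text \<open>Characteristic functions are used so that singular covariance matrices are included.\<close>

definition mv_normal :: "(real^'p) measure \<Rightarrow> real^'p \<Rightarrow> real^'p^'p \<Rightarrow> bool" where
  "mv_normal N b V \<longleftrightarrow>
     prob_space N \<and> sets N = sets borel \<and> transpose V = V \<and>
     (\<forall>t. (CLINT x|N. iexp (t \<bullet> x)) =
            iexp (t \<bullet> b) * complex_of_real (exp (- (t \<bullet> (V *v t)) / 2)))"

definition converges_in_dist ::
  "'w measure \<Rightarrow> (nat \<Rightarrow> 'w \<Rightarrow> 'a::topological_space) \<Rightarrow> 'a measure \<Rightarrow> bool"
where
  "converges_in_dist M Z N \<longleftrightarrow>
     (\<forall>n. Z n \<in> borel_measurable M) \<and>
     (\<forall>f :: 'a \<Rightarrow> real. continuous_on UNIV f \<and> bounded (range f) \<longrightarrow>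
        (\<lambda>n. \<integral>\<omega>. f (Z n \<omega>) \<partial>M) \<longlonglongrightarrow> (\<integral>x. f x \<partial>N))"

end

(* After multiplication by (n/m_n)^(d/2), the error of the empirical extremogram is, up to terms that
   vanish in probability, a linear combination of the centred exceedance counts
   sum_s (1{Y(s)/a_m in D_i} - p_i), divided by the rescaled count of X(s)/a_m in A, which converges
   in probability to mu(A). For the counts, regular variation gives the limit of every single rescaled
   covariance, (M3) and (M4)(i) dominate the covariances at large lags, so that the variance converges
   to the quadratic form of Sigma. Normality follows by Bolthausen's variant of Stein's method: with
   S_s the part of the sum S within distance r_n of s, the characteristic function phi of b S satisfies
   phi'(l) = - l sigma^2 phi(l) up to errors controlled by the fluctuation of b^2 sum_s xi_s S_s
   (summability of alpha_{2,2} and (M2)), by b^3 sum_s E S_s^2 ((M2)), and by the dependence between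
   xi_s and S - S_s ((M4)(iii)). Multiplying by exp(l^2 sigma^2/2) and integrating over [0,1] also
   covers the degenerate case sigma = 0. *)

theory Submission
  imports Defs
begin

text \<open>Vague convergence only tests continuous functions with compact support in the punctured
  compactified space, whereas the events at hand constrain several coordinates by continuity sets of
  the one-dimensional limit measure. Products of one-dimensional sandwiching functions bridge this
  gap: the error of a product is at most the sum of the errors of its factors, and by stationarity
  all coordinates share one marginal. In the step to normality, mixing is needed only for one site
  against the rest of the grid and for pairs of sites against pairs, which (M4) controls. Neither
  the non-negativity of Pi nor the existence of a normal law with this possibly singular covariance
  is available beforehand. The first is read off from the convergence itself, since a limit of
  characteristic functions has modulus at most 1; the second needs a construction. Tightness comes
  from second moments, so the multivariate continuity theorem reduces to approximation by
  trigonometric polynomials on a ball.\<close>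

section \<open>Covariance inequalities for mixing sigma-algebras\<close>

text \<open>With Y the conditional expectation of V given F, the covariance equals E[U (Y - E V)]
  and is at most K E|Y - E V|. The modulus is produced by the sign of Y - E V, an F-measurable
  function, so Y can be turned back into V.\<close>

lemma (in prob_space) cov_le_sign:
  fixes U V :: "'a \<Rightarrow> real"
  assumes F: "subalgebra M F" and U[measurable]: "U \<in> borel_measurable F"
    and V[measurable]: "V \<in> borel_measurable M"
    and K: "\<And>x. \<bar>U x\<bar> \<le> K" and L: "\<And>x. \<bar>V x\<bar> \<le> L"
  obtains P where "P \<in> sets F"
    "\<bar>expectation (\<lambda>x. U x * V x) - expectation U * expectation V\<bar>
      \<le> K * (expectation (\<lambda>x. (2 * indicator P x - 1) * V x) - expectation (\<lambda>x. 2 * indicator P x - 1) * expectation V)"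
proof -
  interpret finite_measure_subalgebra M F by unfold_locales (rule F)
  have UM[measurable]: "U \<in> borel_measurable M" by (rule measurable_from_subalg[OF F U])
  have K0: "0 \<le> K" using K[of undefined] by linarith
  define Y where "Y = real_cond_exp M F V"
  have YF[measurable]: "Y \<in> borel_measurable F" unfolding Y_def by simp
  have YM[measurable]: "Y \<in> borel_measurable M" by (rule measurable_from_subalg[OF F YF])
  have iV: "integrable M V" by (rule integrable_const_bound[of _ L]) (use L in auto)
  have iY: "integrable M Y" unfolding Y_def by (rule real_cond_exp_int(1)[OF iV])
  have iU: "integrable M U" by (rule integrable_const_bound[of _ K]) (use K in auto)
  have *: "integrable M (\<lambda>x. W x * Y x)" "expectation (\<lambda>x. W x * Y x) = expectation (\<lambda>x. W x * V x)"
    if [measurable]: "W \<in> borel_measurable F" and W: "\<And>x. \<bar>W x\<bar> \<le> C" for W and C :: real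
  proof -
    have "integrable M (\<lambda>x. W x * V x)"
    proof (rule integrable_const_bound[of _ "C * L"])
      show "AE x in M. norm (W x * V x) \<le> C * L"
        using W L by (auto intro!: mult_mono simp: abs_mult intro: order_trans[OF abs_ge_zero])
      have [measurable]: "W \<in> borel_measurable M" by (rule measurable_from_subalg[OF F]) fact
      show "(\<lambda>x. W x * V x) \<in> borel_measurable M" by simp
    qed
    then show "integrable M (\<lambda>x. W x * Y x)" "expectation (\<lambda>x. W x * Y x) = expectation (\<lambda>x. W x * V x)"
      unfolding Y_def by (auto intro!: real_cond_exp_intg)
  qed
  define P where "P = {x \<in> space F. expectation V \<le> Y x}"
  have P: "P \<in> sets F" unfolding P_def by measurable
  have PM[measurable]: "P \<in> sets M" using P F by (auto simp: subalgebra_def)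
  have sp: "space F = space M" using F by (simp add: subalgebra_def)
  define \<eta> where "\<eta> = (\<lambda>x. 2 * indicator P x - 1 :: real)"
  have eF[measurable]: "\<eta> \<in> borel_measurable F" unfolding \<eta>_def using P by measurable
  have eM[measurable]: "\<eta> \<in> borel_measurable M" by (rule measurable_from_subalg[OF F eF])
  have e1: "\<bar>\<eta> x\<bar> \<le> 1" for x by (auto simp: \<eta>_def indicator_def)
  have ie: "integrable M \<eta>" by (rule integrable_const_bound[of _ 1]) (use e1 in auto)
  have "expectation (\<lambda>x. U x * V x) - expectation U * expectation V = expectation (\<lambda>x. U x * (Y x - expectation V))"
    using *[OF U K] iU by (simp add: right_diff_distrib)
  also have "\<bar>\<dots>\<bar> \<le> expectation (\<lambda>x. \<bar>U x * (Y x - expectation V)\<bar>)"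
    by (rule integral_abs_bound)
  also have "\<dots> \<le> expectation (\<lambda>x. K * (\<eta> x * (Y x - expectation V)))"
  proof (rule integral_mono)
    show "integrable M (\<lambda>x. \<bar>U x * (Y x - expectation V)\<bar>)"
      using *[OF U K] iU by (simp add: right_diff_distrib)
    show "integrable M (\<lambda>x. K * (\<eta> x * (Y x - expectation V)))"
      using *[OF eF e1] ie by (simp add: right_diff_distrib)
    fix x assume x: "x \<in> space M"
    have "\<bar>Y x - expectation V\<bar> = \<eta> x * (Y x - expectation V)"
      using x by (cases "expectation V \<le> Y x") (auto simp: \<eta>_def P_def sp)
    then show "\<bar>U x * (Y x - expectation V)\<bar> \<le> K * (\<eta> x * (Y x - expectation V))"
      using K[of x] by (metis abs_ge_zero abs_mult mult_right_mono)
  qed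
  also have "\<dots> = K * (expectation (\<lambda>x. \<eta> x * V x) - expectation \<eta> * expectation V)"
    using *[OF eF e1] ie by (simp add: right_diff_distrib)
  finally show ?thesis using that[OF P] unfolding \<eta>_def by simp
qed

text \<open>The sign reduction, applied first to U and then to V, leaves two variables with values
  -1 and 1. Their covariance is 4 times that of the underlying events, which is the origin of the
  constant.\<close>

lemma (in prob_space) covariance_inequality:
  fixes U V :: "'a \<Rightarrow> real"
  assumes F: "subalgebra M F" and G: "subalgebra M G"
    and \<alpha>: "\<And>P Q. P \<in> sets F \<Longrightarrow> Q \<in> sets G \<Longrightarrow> \<bar>prob (P \<inter> Q) - prob P * prob Q\<bar> \<le> \<alpha>"
    and U: "U \<in> borel_measurable F" and V: "V \<in> borel_measurable G"
    and K: "\<And>x. \<bar>U x\<bar> \<le> K" and L: "\<And>x. \<bar>V x\<bar> \<le> L"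
  shows "\<bar>expectation (\<lambda>x. U x * V x) - expectation U * expectation V\<bar> \<le> 4 * K * L * \<alpha>"
proof -
  have K0: "0 \<le> K" using K[of undefined] by linarith
  have L0: "0 \<le> L" using L[of undefined] by linarith
  let ?s = "\<lambda>P x. 2 * indicator P x - 1 :: real"
  obtain P where P: "P \<in> sets F" and 1: "\<bar>expectation (\<lambda>x. U x * V x) - expectation U * expectation V\<bar>
      \<le> K * (expectation (\<lambda>x. ?s P x * V x) - expectation (?s P) * expectation V)"
    using cov_le_sign[OF F U measurable_from_subalg[OF G V] K L] by auto
  have PM[measurable]: "P \<in> sets M" using P F by (auto simp: subalgebra_def)
  obtain Q where Q: "Q \<in> sets G" and 2: "\<bar>expectation (\<lambda>x. V x * ?s P x) - expectation V * expectation (?s P)\<bar>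
      \<le> L * (expectation (\<lambda>x. ?s Q x * ?s P x) - expectation (?s Q) * expectation (?s P))"
  proof (rule cov_le_sign[OF G V _ L, of "?s P" 1])
    show "\<bar>?s P x\<bar> \<le> 1" for x by (simp add: indicator_def)
  qed auto
  have QM[measurable]: "Q \<in> sets M" using Q G by (auto simp: subalgebra_def)
  have "expectation (\<lambda>x. ?s Q x * ?s P x) = expectation (\<lambda>x. 4 * indicator (P \<inter> Q) x - 2 * indicator P x - 2 * indicator Q x + 1)"
    by (rule Bochner_Integration.integral_cong) (auto simp: indicator_def)
  also have "\<dots> = 4 * prob (P \<inter> Q) - 2 * prob P - 2 * prob Q + 1"
    by (simp add: emeasure_eq_measure prob_space)
  finally have "expectation (\<lambda>x. ?s Q x * ?s P x) - expectation (?s Q) * expectation (?s P)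
      = 4 * (prob (P \<inter> Q) - prob P * prob Q)"
    by (simp add: emeasure_eq_measure prob_space algebra_simps)
  also have "\<dots> \<le> 4 * \<alpha>" using abs_le_D1[OF \<alpha>[OF P Q]] by simp
  finally have "L * (expectation (\<lambda>x. ?s Q x * ?s P x) - expectation (?s Q) * expectation (?s P)) \<le> L * (4 * \<alpha>)"
    using L0 by (rule mult_left_mono)
  with 2 have "expectation (\<lambda>x. ?s P x * V x) - expectation (?s P) * expectation V \<le> L * (4 * \<alpha>)"
    by (simp add: mult.commute)
  from mult_left_mono[OF this K0] 1 show ?thesis by (simp add: mult_ac)
qed

text \<open>Real and imaginary part of V cost 4 K \<alpha> each. Since U has mean zero, the product
  of the expectations drops out.\<close>

lemma (in prob_space) complex_covariance_inequality:
  fixes U :: "'a \<Rightarrow> real" and V :: "'a \<Rightarrow> complex"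
  assumes F: "subalgebra M F" and G: "subalgebra M G"
    and \<alpha>: "\<And>P Q. P \<in> sets F \<Longrightarrow> Q \<in> sets G \<Longrightarrow> \<bar>prob (P \<inter> Q) - prob P * prob Q\<bar> \<le> \<alpha>"
    and U: "U \<in> borel_measurable F" and V[measurable]: "V \<in> borel_measurable G"
    and K: "\<And>x. \<bar>U x\<bar> \<le> K" and L: "\<And>x. cmod (V x) \<le> 1" and U0: "expectation U = 0"
  shows "cmod (CLINT x|M. of_real (U x) * V x) \<le> 8 * K * \<alpha>"
proof -
  have [measurable]: "V \<in> borel_measurable M" "U \<in> borel_measurable M"
    using measurable_from_subalg[OF G V] measurable_from_subalg[OF F U] by auto
  have K0: "0 \<le> K" using K[of undefined] by linarith
  have i: "complex_integrable M (\<lambda>x. of_real (U x) * V x)"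
  proof (rule integrable_const_bound[of _ "K * 1"])
    show "AE x in M. cmod (of_real (U x) * V x) \<le> K * 1"
      using mult_mono[OF K L K0 norm_ge_zero] by (simp add: norm_mult)
  qed simp
  have "\<bar>expectation (\<lambda>x. U x * Re (V x))\<bar> \<le> 4 * K * 1 * \<alpha>"
  proof -
    have "\<bar>expectation (\<lambda>x. U x * Re (V x)) - expectation U * expectation (\<lambda>x. Re (V x))\<bar> \<le> 4 * K * 1 * \<alpha>"
    proof (rule covariance_inequality[OF F G _ U])
      show "\<bar>Re (V x)\<bar> \<le> 1" for x using abs_Re_le_cmod[of "V x"] L[of x] by linarith
    qed (use \<alpha> K in auto)
    then show ?thesis by (simp add: U0)
  qed
  moreover have "\<bar>expectation (\<lambda>x. U x * Im (V x))\<bar> \<le> 4 * K * 1 * \<alpha>"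
  proof -
    have "\<bar>expectation (\<lambda>x. U x * Im (V x)) - expectation U * expectation (\<lambda>x. Im (V x))\<bar> \<le> 4 * K * 1 * \<alpha>"
    proof (rule covariance_inequality[OF F G _ U])
      show "\<bar>Im (V x)\<bar> \<le> 1" for x using abs_Im_le_cmod[of "V x"] L[of x] by linarith
    qed (use \<alpha> K in auto)
    then show ?thesis by (simp add: U0)
  qed
  moreover have "Re (CLINT x|M. of_real (U x) * V x) = expectation (\<lambda>x. U x * Re (V x))"
    "Im (CLINT x|M. of_real (U x) * V x) = expectation (\<lambda>x. U x * Im (V x))"
    using integral_Re[OF i] integral_Im[OF i] by simp_all
  ultimately show ?thesis
    using cmod_le[of "CLINT x|M. of_real (U x) * V x"] by linarith
qed

section \<open>Bolthausen's estimate\<close>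

lemma integral_norm_le:
  fixes f :: "'a \<Rightarrow> 'b::{banach, second_countable_topology}"
  assumes f: "integrable M f" and g: "integrable M g" and fg: "\<And>x. x \<in> space M \<Longrightarrow> norm (f x) \<le> g x"
  shows "norm (integral\<^sup>L M f) \<le> integral\<^sup>L M g"
  by (rule order_trans[OF integral_norm_bound integral_mono[OF integrable_norm[OF f] g fg]])

text \<open>Serves twice: for differentiating a characteristic function and for the Taylor remainder
  in the neighbourhood sums.\<close>

lemma cmod_iexp_1: "cmod (1 + \<i> * of_real x - iexp x) \<le> x\<^sup>2 / 2"
  using iexp_approx1[of x 1] by (simp add: norm_minus_commute numeral_2_eq_2 fact_Suc)

text \<open>Boundedness of S gives the explicit error |y - l| C^2 / 2 for the difference quotient,
  so the derivative is taken under the expectation without a convergence theorem.\<close>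

lemma (in prob_space) char_has_vector_derivative:
  assumes [measurable]: "S \<in> borel_measurable M" and C: "\<And>x. \<bar>S x\<bar> \<le> C"
  shows "((\<lambda>l. CLINT x|M. iexp (l * S x)) has_vector_derivative (CLINT x|M. \<i> * of_real (S x) * iexp (l * S x))) (at l)"
  unfolding has_vector_derivative_def
proof (rule has_derivativeI_sandwich[where e = 1])
  let ?\<phi> = "\<lambda>l. CLINT x|M. iexp (l * S x)" and ?D = "CLINT x|M. \<i> * of_real (S x) * iexp (l * S x)"
  have C0: "0 \<le> C" using C[of undefined] by linarith
  show "bounded_linear (\<lambda>h. h *\<^sub>R ?D)" by (rule bounded_linear_scaleR_left)
  show "((\<lambda>y. \<bar>y - l\<bar> * C\<^sup>2 / 2) \<longlongrightarrow> 0) (at l)"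
    by (rule tendsto_eq_intros refl | simp)+
  have i1: "complex_integrable M (\<lambda>x. iexp (l * S x))" for l
    by (rule integrable_const_bound[of _ 1]) auto
  have i2: "complex_integrable M (\<lambda>x. \<i> * of_real (S x) * iexp (l * S x))"
    by (rule integrable_const_bound[of _ C]) (use C in \<open>auto simp: norm_mult\<close>)
  fix y :: real assume y: "y \<noteq> l"
  have "?\<phi> y - ?\<phi> l - (y - l) *\<^sub>R ?D
      = (CLINT x|M. iexp (y * S x) - iexp (l * S x) - of_real (y - l) * (\<i> * of_real (S x) * iexp (l * S x)))"
    using i1 i2 by (simp add: scaleR_conv_of_real)
  also have "cmod \<dots> \<le> (LINT x|M. (y - l)\<^sup>2 * C\<^sup>2 / 2)"
  proof (rule integral_norm_le)
    show "complex_integrable M (\<lambda>x. iexp (y * S x) - iexp (l * S x) - of_real (y - l) * (\<i> * of_real (S x) * iexp (l * S x)))"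
      using i1 i2 by (intro Bochner_Integration.integrable_diff integrable_mult_right) auto
    fix x assume "x \<in> space M"
    have "iexp (y * S x) = iexp (l * S x) * iexp ((y - l) * S x)"
      by (simp add: exp_add[symmetric] algebra_simps)
    then have "iexp (y * S x) - iexp (l * S x) - of_real (y - l) * (\<i> * of_real (S x) * iexp (l * S x))
        = - iexp (l * S x) * (1 + \<i> * of_real ((y - l) * S x) - iexp ((y - l) * S x))"
      by (simp add: algebra_simps)
    then have "cmod (iexp (y * S x) - iexp (l * S x) - of_real (y - l) * (\<i> * of_real (S x) * iexp (l * S x)))
        = cmod (1 + \<i> * of_real ((y - l) * S x) - iexp ((y - l) * S x))"
      by (simp add: norm_mult)
    also have "\<dots> \<le> ((y - l) * S x)\<^sup>2 / 2" by (rule cmod_iexp_1)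
    also have "\<dots> \<le> (y - l)\<^sup>2 * C\<^sup>2 / 2"
      using power_mono[OF C[of x], of 2] by (simp add: power_mult_distrib mult_left_mono)
    finally show "cmod (iexp (y * S x) - iexp (l * S x) - of_real (y - l) * (\<i> * of_real (S x) * iexp (l * S x)))
        \<le> (y - l)\<^sup>2 * C\<^sup>2 / 2" .
  qed simp
  finally have "cmod (?\<phi> y - ?\<phi> l - (y - l) *\<^sub>R ?D) \<le> (y - l)\<^sup>2 * C\<^sup>2 / 2" by (simp add: prob_space)
  then have "cmod (?\<phi> y - ?\<phi> l - (y - l) *\<^sub>R ?D) / norm (y - l) \<le> ((y - l)\<^sup>2 * C\<^sup>2 / 2) / norm (y - l)"
    by (rule divide_right_mono) simp
  also have "(y - l)\<^sup>2 = \<bar>y - l\<bar> * \<bar>y - l\<bar>" by (simp add: power2_eq_square)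
  also have "(\<bar>y - l\<bar> * \<bar>y - l\<bar> * C\<^sup>2 / 2) / norm (y - l) = \<bar>y - l\<bar> * C\<^sup>2 / 2"
  proof -
    have "z * z * c / 2 / z = z * c / 2" if "z \<noteq> 0" for z c :: real using that by simp
    from this[of "\<bar>y - l\<bar>" "C\<^sup>2"] show ?thesis using y by simp
  qed
  finally show "cmod (?\<phi> y - ?\<phi> l - (y - l) *\<^sub>R ?D) / norm (y - l) \<le> \<bar>y - l\<bar> * C\<^sup>2 / 2" .
qed simp

text \<open>\<open>R s\<close> is the neighbourhood of s. No sign is imposed on
  \<open>\<sigma>2\<close>, because non-negativity of the limit variance will itself be deduced from
  this estimate. The exponential constant is the maximum of the integrating factor on [0,1], times
  its inverse at 1.\<close>

lemma (in prob_space) bolthausen_estimate: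
  fixes \<xi> :: "'s \<Rightarrow> 'a \<Rightarrow> real"
  assumes fin: "finite G" and R: "\<And>s. s \<in> G \<Longrightarrow> R s \<subseteq> G"
    and [measurable]: "\<And>s. \<xi> s \<in> borel_measurable M" and K: "\<And>s x. \<bar>\<xi> s x\<bar> \<le> K" and b: "0 \<le> b"
    and far: "\<And>l. l \<in> {0..1} \<Longrightarrow>
      b * (\<Sum>s\<in>G. cmod (CLINT x|M. of_real (\<xi> s x) * iexp (l * (b * (\<Sum>s'\<in>G - R s. \<xi> s' x))))) \<le> e"
    and V: "(LINT x|M. \<bar>b\<^sup>2 * (\<Sum>s\<in>G. \<Sum>s'\<in>R s. \<xi> s x * \<xi> s' x) - \<sigma>2\<bar>) \<le> v"
    and W: "b ^ 3 * (\<Sum>s\<in>G. LINT x|M. (\<Sum>s'\<in>R s. \<xi> s' x)\<^sup>2) \<le> w"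
  shows "cmod ((CLINT x|M. iexp (b * (\<Sum>s\<in>G. \<xi> s x))) - of_real (exp (- \<sigma>2 / 2)))
    \<le> exp (\<bar>\<sigma>2\<bar> / 2 - \<sigma>2 / 2) * (v + K * w + e)"
proof -
  define S where "S x = b * (\<Sum>s\<in>G. \<xi> s x)" for x
  define T where "T s x = b * (\<Sum>s'\<in>R s. \<xi> s' x)" for s x
  define Vn where "Vn x = b\<^sup>2 * (\<Sum>s\<in>G. \<Sum>s'\<in>R s. \<xi> s x * \<xi> s' x)" for x
  define \<phi> where "\<phi> l = (CLINT x|M. iexp (l * S x))" for l
  define D where "D l = (CLINT x|M. \<i> * of_real (S x) * iexp (l * S x))" for l
  have K0: "0 \<le> K" using K[of undefined undefined] by linarith
  have [measurable]: "S \<in> borel_measurable M" "T s \<in> borel_measurable M" "Vn \<in> borel_measurable M" for s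
    unfolding S_def T_def Vn_def by measurable
  have bd: "\<bar>\<Sum>s\<in>F. \<xi> s x\<bar> \<le> card F * K" for F :: "'s set" and x
    by (rule order_trans[OF sum_abs sum_bounded_above]) (rule K)
  have Sb: "\<bar>S x\<bar> \<le> b * (card G * K)" for x
    unfolding S_def using bd[of x G] b by (simp add: abs_mult mult_left_mono)
  have Tb: "\<bar>T s x\<bar> \<le> b * (card (R s) * K)" for s x
    unfolding T_def using bd[of x "R s"] b by (simp add: abs_mult mult_left_mono)
  have VnT: "Vn x = b * (\<Sum>s\<in>G. \<xi> s x * T s x)" for x
    unfolding Vn_def T_def by (simp add: sum_distrib_left power2_eq_square mult_ac)
  have "\<bar>Vn x\<bar> \<le> b * (\<Sum>s\<in>G. K * (b * (card (R s) * K)))" for x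
  proof -
    have "\<bar>\<Sum>s\<in>G. \<xi> s x * T s x\<bar> \<le> (\<Sum>s\<in>G. K * (b * (card (R s) * K)))"
      by (rule order_trans[OF sum_abs sum_mono]) (simp only: abs_mult, intro mult_mono K Tb K0 abs_ge_zero)
    then show ?thesis unfolding VnT using b by (simp add: abs_mult mult_left_mono)
  qed
  note Vb = this
  have ST: "S x - T s x = b * (\<Sum>s'\<in>G - R s. \<xi> s' x)" if "s \<in> G" for s x
    unfolding S_def T_def using sum.subset_diff[OF R[OF that] fin, of "\<lambda>s. \<xi> s x"] by (simp add: algebra_simps)
  have der: "(\<phi> has_vector_derivative D l) (at l)" for l
    unfolding \<phi>_def D_def by (rule char_has_vector_derivative) (use Sb in auto)
  have main: "cmod (D l + of_real (l * \<sigma>2) * \<phi> l) \<le> v + K * w + e" if l: "l \<in> {0..1}" for l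
  proof -
    have l0: "0 \<le> l" "l \<le> 1" using l by auto
    \<comment> \<open>A1 is the cost of replacing the random \<open>Vn\<close> by
      \<open>\<sigma>2\<close>, A2 that of a Taylor expansion in T s, and A3 the correlation of
      \<xi> s with the part of S away from s.\<close>
    define A1 where "A1 = (CLINT x|M. of_real (l * (\<sigma>2 - Vn x)) * iexp (l * S x))"
    define A2 where "A2 s = (CLINT x|M. of_real (\<xi> s x) * iexp (l * S x)
        * (1 + \<i> * of_real (- (l * T s x)) - iexp (- (l * T s x))))" for s
    define A3 where "A3 s = (CLINT x|M. of_real (\<xi> s x) * iexp (l * (S x - T s x)))" for s
    have iv: "integrable M (\<lambda>x. \<bar>Vn x - \<sigma>2\<bar>)"
    proof (rule integrable_const_bound[of _ "b * (\<Sum>s\<in>G. K * (b * (card (R s) * K))) + \<bar>\<sigma>2\<bar>"])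
      show "AE x in M. norm \<bar>Vn x - \<sigma>2\<bar> \<le> b * (\<Sum>s\<in>G. K * (b * (card (R s) * K))) + \<bar>\<sigma>2\<bar>"
      proof (rule AE_I2)
        fix x show "norm \<bar>Vn x - \<sigma>2\<bar> \<le> b * (\<Sum>s\<in>G. K * (b * (card (R s) * K))) + \<bar>\<sigma>2\<bar>"
          using Vb[of x] unfolding real_norm_def by linarith
      qed
    qed simp
    have nA: "cmod (of_real (l * (\<sigma>2 - Vn x)) * iexp (l * S x)) \<le> \<bar>Vn x - \<sigma>2\<bar>" for x
      using mult_right_mono[OF l0(2), of "\<bar>Vn x - \<sigma>2\<bar>"] l0(1)
      by (simp add: norm_mult abs_mult abs_minus_commute del: of_real_mult of_real_diff)
    have i1: "complex_integrable M (\<lambda>x. of_real (l * (\<sigma>2 - Vn x)) * iexp (l * S x))"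
    proof (rule Bochner_Integration.integrable_bound[OF iv])
      show "AE x in M. cmod (of_real (l * (\<sigma>2 - Vn x)) * iexp (l * S x)) \<le> norm \<bar>Vn x - \<sigma>2\<bar>"
        using nA by simp
    qed simp
    have it: "integrable M (\<lambda>x. (\<Sum>s'\<in>R s. \<xi> s' x)\<^sup>2)" for s
    proof (rule integrable_const_bound[of _ "(card (R s) * K)\<^sup>2"])
      show "AE x in M. norm ((\<Sum>s'\<in>R s. \<xi> s' x)\<^sup>2) \<le> (card (R s) * K)\<^sup>2"
        using power_mono[OF bd[of _ "R s"] abs_ge_zero, where n = 2] by simp
    qed simp
    have p2: "cmod (of_real (\<xi> s x) * iexp (l * S x)
        * (1 + \<i> * of_real (- (l * T s x)) - iexp (- (l * T s x)))) \<le> K * (b\<^sup>2 * (\<Sum>s'\<in>R s. \<xi> s' x)\<^sup>2)" for s x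
    proof -
      have "cmod (1 + \<i> * of_real (- (l * T s x)) - iexp (- (l * T s x))) \<le> (- (l * T s x))\<^sup>2 / 2"
        by (rule cmod_iexp_1)
      also have "\<dots> \<le> (T s x)\<^sup>2"
      proof -
        have "l\<^sup>2 * (T s x)\<^sup>2 \<le> 1 * (T s x)\<^sup>2" using l0 by (intro mult_right_mono) (auto simp: power_le_one)
        moreover have "(- (l * T s x))\<^sup>2 = l\<^sup>2 * (T s x)\<^sup>2" by (simp add: power_mult_distrib)
        ultimately show ?thesis using zero_le_power2[of "T s x"] by linarith
      qed
      also have "\<dots> = b\<^sup>2 * (\<Sum>s'\<in>R s. \<xi> s' x)\<^sup>2" by (simp add: T_def power_mult_distrib)
      finally show ?thesis
        using mult_mono[OF K[of s x], of "cmod (1 + \<i> * of_real (- (l * T s x)) - iexp (- (l * T s x)))"] K0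
        by (simp add: norm_mult del: of_real_mult of_real_minus)
    qed
    have i2: "complex_integrable M (\<lambda>x. of_real (\<xi> s x) * iexp (l * S x)
        * (1 + \<i> * of_real (- (l * T s x)) - iexp (- (l * T s x))))" for s
      by (rule Bochner_Integration.integrable_bound[where f = "\<lambda>x. K * (b\<^sup>2 * (\<Sum>s'\<in>R s. \<xi> s' x)\<^sup>2)"])
        (use p2 it K0 b in \<open>auto intro!: AE_I2 simp: abs_mult simp del: of_real_mult of_real_minus\<close>)
    have i3: "complex_integrable M (\<lambda>x. of_real (\<xi> s x) * iexp (l * (S x - T s x)))" for s
      by (rule integrable_const_bound[of _ K]) (use K in \<open>auto simp: norm_mult simp del: of_real_mult of_real_diff\<close>)
    have iS: "complex_integrable M (\<lambda>x. iexp (l * S x))" by (rule integrable_const_bound[of _ 1]) auto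
    have iS2: "complex_integrable M (\<lambda>x. \<i> * of_real (S x) * iexp (l * S x))"
      by (rule integrable_const_bound[of _ "b * (card G * K)"]) (use Sb in \<open>auto simp: norm_mult\<close>)
    \<comment> \<open>S - T s splits off a factor exp(- i l T s), which is expanded to first order.
      Summed over s, the linear terms add up to the multiple of \<open>Vn\<close> that \<sigma>2 is
      compared with.\<close>
    have pt: "of_real (\<xi> s x) * iexp (l * S x)
        * (1 + \<i> * of_real (- (l * T s x)) - iexp (- (l * T s x))) + of_real (\<xi> s x) * iexp (l * (S x - T s x))
       = of_real (\<xi> s x) * iexp (l * S x) - \<i> * of_real (l * (\<xi> s x * T s x)) * iexp (l * S x)" for s x
    proof -
      have "iexp (l * (S x - T s x)) = iexp (l * S x) * iexp (- (l * T s x))"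
        by (simp add: exp_add[symmetric] algebra_simps)
      then show ?thesis by (simp add: algebra_simps)
    qed
    have "D l + of_real (l * \<sigma>2) * \<phi> l
        = (CLINT x|M. \<i> * of_real (S x) * iexp (l * S x) + of_real (l * \<sigma>2) * iexp (l * S x))"
      unfolding D_def \<phi>_def using iS iS2 by (subst Bochner_Integration.integral_add) auto
    also have "\<dots> = (CLINT x|M. of_real (l * (\<sigma>2 - Vn x)) * iexp (l * S x) + \<i> * of_real b * (\<Sum>s\<in>G.
       of_real (\<xi> s x) * iexp (l * S x) * (1 + \<i> * of_real (- (l * T s x)) - iexp (- (l * T s x)))
       + of_real (\<xi> s x) * iexp (l * (S x - T s x))))"
      unfolding pt
      by (rule Bochner_Integration.integral_cong)
        (simp_all add: S_def VnT sum_subtractf sum_negf algebra_simps sum_distrib_left sum_distrib_right)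
    also have "\<dots> = A1 + \<i> * of_real b * (\<Sum>s\<in>G. A2 s + A3 s)"
      unfolding A1_def A2_def A3_def using i1 i2 i3 by simp
    also have "cmod \<dots> \<le> cmod A1 + b * (\<Sum>s\<in>G. cmod (A2 s) + cmod (A3 s))"
    proof -
      have "cmod (\<Sum>s\<in>G. A2 s + A3 s) \<le> (\<Sum>s\<in>G. cmod (A2 s) + cmod (A3 s))"
        by (rule order_trans[OF norm_sum sum_mono[OF norm_triangle_ineq]])
      then have "cmod (\<i> * of_real b * (\<Sum>s\<in>G. A2 s + A3 s)) \<le> b * (\<Sum>s\<in>G. cmod (A2 s) + cmod (A3 s))"
        using b by (simp add: norm_mult mult_left_mono)
      then show ?thesis by (rule norm_triangle_mono[OF order_refl])
    qed
    also have "cmod A1 \<le> (LINT x|M. \<bar>Vn x - \<sigma>2\<bar>)"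
      unfolding A1_def
    proof (rule integral_norm_le[OF i1 iv])
      fix x show "cmod (of_real (l * (\<sigma>2 - Vn x)) * iexp (l * S x)) \<le> \<bar>Vn x - \<sigma>2\<bar>"
        by (rule nA)
    qed
    also have "\<dots> \<le> v" using V by (simp add: Vn_def)
    also have "b * (\<Sum>s\<in>G. cmod (A2 s) + cmod (A3 s)) \<le> K * w + e"
    proof -
      have "b * (\<Sum>s\<in>G. cmod (A3 s)) = b * (\<Sum>s\<in>G. cmod (CLINT x|M. of_real (\<xi> s x) * iexp (l * (b * (\<Sum>s'\<in>G - R s. \<xi> s' x)))))"
        unfolding A3_def by (intro arg_cong[where f = "(*) b"] sum.cong refl) (simp add: ST)
      then have 3: "b * (\<Sum>s\<in>G. cmod (A3 s)) \<le> e" using far[OF l] by linarith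
      have "cmod (A2 s) \<le> (LINT x|M. K * (b\<^sup>2 * (\<Sum>s'\<in>R s. \<xi> s' x)\<^sup>2))" for s
        unfolding A2_def by (rule integral_norm_le[OF i2]) (use it p2 in auto)
      then have "b * (\<Sum>s\<in>G. cmod (A2 s)) \<le> b * (\<Sum>s\<in>G. K * (b\<^sup>2 * (LINT x|M. (\<Sum>s'\<in>R s. \<xi> s' x)\<^sup>2)))"
        using b by (intro mult_left_mono sum_mono) auto
      \<comment> \<open>One factor b stands in front of the sum over the sites, two come from the
        square of T s.\<close>
      also have "\<dots> = K * (b ^ 3 * (\<Sum>s\<in>G. LINT x|M. (\<Sum>s'\<in>R s. \<xi> s' x)\<^sup>2))"
        by (simp add: sum_distrib_left power2_eq_square power3_eq_cube mult_ac)
      also have "\<dots> \<le> K * w" using W K0 by (rule mult_left_mono)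
      finally show ?thesis using 3 by (simp add: sum.distrib distrib_left)
    qed
    finally show ?thesis by simp
  qed
  \<comment> \<open>The quotient of \<phi> and the normal characteristic function. Its value at 0 is
    1, so a bound for its derivative controls its distance from 1 at l = 1.\<close>
  define \<psi> where "\<psi> l = of_real (exp (\<sigma>2 * l\<^sup>2 / 2)) * \<phi> l" for l :: real
  have dpsi: "(\<psi> has_vector_derivative of_real (exp (\<sigma>2 * l\<^sup>2 / 2)) * (D l + of_real (l * \<sigma>2) * \<phi> l)) (at l)" for l
  proof -
    have "((\<lambda>l. exp (\<sigma>2 * l\<^sup>2 / 2)) has_real_derivative exp (\<sigma>2 * l\<^sup>2 / 2) * (\<sigma>2 * l)) (at l)"
      by (auto intro!: derivative_eq_intros)
    then have "((\<lambda>l. complex_of_real (exp (\<sigma>2 * l\<^sup>2 / 2))) has_vector_derivative of_real (exp (\<sigma>2 * l\<^sup>2 / 2) * (\<sigma>2 * l))) (at l)"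
      by (intro has_vector_derivative_of_real) (simp add: has_real_derivative_iff_has_vector_derivative)
    from has_vector_derivative_mult[OF this der] show ?thesis
      unfolding \<psi>_def by (simp add: algebra_simps)
  qed
  have vwe: "0 \<le> v + K * w + e" using main[of 0] by (auto intro: order_trans[OF norm_ge_zero])
  have "norm (\<psi> 1 - \<psi> 0) \<le> (exp (\<bar>\<sigma>2\<bar> / 2) * (v + K * w + e)) * norm (1 - 0 :: real)"
  proof (rule differentiable_bound[where S = "{0..1}" and f = \<psi> and f' = "\<lambda>l h. h *\<^sub>R (of_real (exp (\<sigma>2 * l\<^sup>2 / 2)) * (D l + of_real (l * \<sigma>2) * \<phi> l))"])
    fix l :: real assume l: "l \<in> {0..1}"
    show "(\<psi> has_derivative (\<lambda>h. h *\<^sub>R (of_real (exp (\<sigma>2 * l\<^sup>2 / 2)) * (D l + of_real (l * \<sigma>2) * \<phi> l)))) (at l within {0..1})"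
      using dpsi[of l] unfolding has_vector_derivative_def by (rule has_derivative_at_withinI)
    show "onorm (\<lambda>h. h *\<^sub>R (of_real (exp (\<sigma>2 * l\<^sup>2 / 2)) * (D l + of_real (l * \<sigma>2) * \<phi> l))) \<le> exp (\<bar>\<sigma>2\<bar> / 2) * (v + K * w + e)"
    proof (rule onorm_le)
      fix h :: real
      have "\<sigma>2 * l\<^sup>2 \<le> \<bar>\<sigma>2\<bar> * 1" using l by (intro mult_mono) (auto simp: power_le_one)
      then have "exp (\<sigma>2 * l\<^sup>2 / 2) \<le> exp (\<bar>\<sigma>2\<bar> / 2)" by simp
      then have "exp (\<sigma>2 * l\<^sup>2 / 2) * cmod (D l + of_real (l * \<sigma>2) * \<phi> l) \<le> exp (\<bar>\<sigma>2\<bar> / 2) * (v + K * w + e)"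
        using main[OF l] by (intro mult_mono) auto
      from mult_left_mono[OF this abs_ge_zero[of h]]
      show "norm (h *\<^sub>R (of_real (exp (\<sigma>2 * l\<^sup>2 / 2)) * (D l + of_real (l * \<sigma>2) * \<phi> l))) \<le> exp (\<bar>\<sigma>2\<bar> / 2) * (v + K * w + e) * norm h"
        by (simp add: norm_mult mult_ac del: of_real_mult)
    qed
  qed auto
  moreover have "\<psi> 0 = 1" "\<psi> 1 = of_real (exp (\<sigma>2 / 2)) * \<phi> 1" by (simp_all add: \<psi>_def \<phi>_def prob_space)
  ultimately have "cmod (of_real (exp (\<sigma>2 / 2)) * \<phi> 1 - 1) \<le> exp (\<bar>\<sigma>2\<bar> / 2) * (v + K * w + e)" by simp
  from mult_left_mono[OF this, of "exp (- \<sigma>2 / 2)"]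
  have "cmod (of_real (exp (- \<sigma>2 / 2)) * (of_real (exp (\<sigma>2 / 2)) * \<phi> 1 - 1)) \<le> exp (- \<sigma>2 / 2) * (exp (\<bar>\<sigma>2\<bar> / 2) * (v + K * w + e))"
    by (simp add: norm_mult)
  moreover have "of_real (exp (- \<sigma>2 / 2)) * (of_real (exp (\<sigma>2 / 2)) * \<phi> 1 - 1) = \<phi> 1 - complex_of_real (exp (- \<sigma>2 / 2))"
    by (simp add: right_diff_distrib mult.assoc[symmetric] flip: of_real_mult exp_add)
  moreover have "exp (- \<sigma>2 / 2) * (exp (\<bar>\<sigma>2\<bar> / 2) * (v + K * w + e)) = exp (\<bar>\<sigma>2\<bar> / 2 - \<sigma>2 / 2) * (v + K * w + e)"
    by (simp add: mult.assoc[symmetric] flip: exp_add)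
  ultimately have "cmod (\<phi> 1 - of_real (exp (- \<sigma>2 / 2))) \<le> exp (\<bar>\<sigma>2\<bar> / 2 - \<sigma>2 / 2) * (v + K * w + e)"
    by (simp only:)
  moreover have "\<phi> 1 = (CLINT x|M. iexp (b * (\<Sum>s\<in>G. \<xi> s x)))" by (simp add: \<phi>_def S_def)
  ultimately show ?thesis by (simp only:)
qed

section \<open>Multivariate continuity theorem\<close>

text \<open>The span of the real and imaginary parts of the characters. Only linear operations occur
  in the rules, so that convergence of characteristic functions passes to every member by
  induction.\<close>

inductive_set trig_polys :: "('v::euclidean_space \<Rightarrow> real) set" where
  cos: "(\<lambda>x. cos (t \<bullet> x)) \<in> trig_polys"
| sin: "(\<lambda>x. sin (t \<bullet> x)) \<in> trig_polys"
| scale: "f \<in> trig_polys \<Longrightarrow> (\<lambda>x. c * f x) \<in> trig_polys"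
| add: "f \<in> trig_polys \<Longrightarrow> g \<in> trig_polys \<Longrightarrow> (\<lambda>x. f x + g x) \<in> trig_polys"

lemma trig_polys_const: "(\<lambda>x. c) \<in> trig_polys"
  using trig_polys.scale[OF trig_polys.cos[of 0], of c] by simp

text \<open>The product-to-sum formulas make the linear span an algebra, as Stone-Weierstrass
  requires.\<close>

lemma trig_polys_mult:
  assumes "f \<in> trig_polys" "g \<in> trig_polys"
  shows "(\<lambda>x. f x * g x) \<in> trig_polys"
  using assms
proof (induction f)
  case (cos t)
  from cos show ?case
  proof (induction g)
    case (cos u)
    have "(\<lambda>x. cos (t \<bullet> x) * cos (u \<bullet> x)) = (\<lambda>x. (1/2) * (cos ((t - u) \<bullet> x) + cos ((t + u) \<bullet> x)))"
      by (auto simp: cos_times_cos inner_diff_left inner_add_left)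
    then show ?case by (simp only:) (intro trig_polys.scale trig_polys.add trig_polys.sin trig_polys.cos)
  next
    case (sin u)
    have "(\<lambda>x. cos (t \<bullet> x) * sin (u \<bullet> x)) = (\<lambda>x. (1/2) * (sin ((t + u) \<bullet> x) + (-1) * sin ((t - u) \<bullet> x)))"
      by (auto simp: cos_times_sin inner_diff_left inner_add_left)
    then show ?case by (simp only:) (intro trig_polys.scale trig_polys.add trig_polys.sin trig_polys.cos)
  next
    case (scale f c)
    from trig_polys.scale[OF scale.IH, of c] show ?case by (simp add: mult_ac)
  next
    case (add f g)
    from trig_polys.add[OF add.IH] show ?case by (simp add: distrib_left)
  qed
next
  case (sin t)
  from sin show ?case
  proof (induction g)
    case (cos u)
    have "(\<lambda>x. sin (t \<bullet> x) * cos (u \<bullet> x)) = (\<lambda>x. (1/2) * (sin ((t + u) \<bullet> x) + sin ((t - u) \<bullet> x)))"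
      by (auto simp: sin_times_cos inner_diff_left inner_add_left)
    then show ?case by (simp only:) (intro trig_polys.scale trig_polys.add trig_polys.sin trig_polys.cos)
  next
    case (sin u)
    have "(\<lambda>x. sin (t \<bullet> x) * sin (u \<bullet> x)) = (\<lambda>x. (1/2) * (cos ((t - u) \<bullet> x) + (-1) * cos ((t + u) \<bullet> x)))"
      by (auto simp: sin_times_sin inner_diff_left inner_add_left)
    then show ?case by (simp only:) (intro trig_polys.scale trig_polys.add trig_polys.sin trig_polys.cos)
  next
    case (scale f c)
    from trig_polys.scale[OF scale.IH, of c] show ?case by (simp add: mult_ac)
  next
    case (add f g)
    from trig_polys.add[OF add.IH] show ?case by (simp add: distrib_left)
  qed
next
  case (scale f c)
  from trig_polys.scale[OF scale.IH[OF scale.prems], of c] show ?case by (simp add: mult_ac)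
next
  case (add f1 f2)
  from trig_polys.add[OF add.IH(1)[OF add.prems] add.IH(2)[OF add.prems]] show ?case
    by (simp add: distrib_right)
qed

lemma trig_polys_continuous: "f \<in> trig_polys \<Longrightarrow> continuous_on UNIV f"
  by (induction rule: trig_polys.induct) (auto intro!: continuous_intros)

lemma trig_polys_bounded: "f \<in> trig_polys \<Longrightarrow> \<exists>C. \<forall>x. \<bar>f x\<bar> \<le> C"
proof (induction rule: trig_polys.induct)
  case (scale f c)
  then obtain C where "\<forall>x. \<bar>f x\<bar> \<le> C" by blast
  then show ?case by (intro exI[of _ "\<bar>c\<bar> * C"]) (auto simp: abs_mult mult_left_mono)
next
  case (add f g)
  then obtain C D where CD: "\<And>x. \<bar>f x\<bar> \<le> C" "\<And>x. \<bar>g x\<bar> \<le> D" by blast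
  have "\<bar>f x + g x\<bar> \<le> C + D" for x using CD(1)[of x] CD(2)[of x] by linarith
  then show ?case by blast
qed (auto intro: exI[of _ 1])

lemma trig_polys_compose:
  fixes q :: "real \<Rightarrow> real"
  assumes "real_polynomial_function q" "g \<in> trig_polys"
  shows "(\<lambda>x. q (g x)) \<in> trig_polys"
  using assms(1)
proof (induction q)
  case (linear f)
  then interpret bounded_linear f .
  have "f y = f 1 * y" for y using scaleR[of y 1] by simp
  then have "(\<lambda>x. f (g x)) = (\<lambda>x. f 1 * g x)" by (intro ext) 
  then show ?case using trig_polys.scale[OF assms(2), of "f 1"] by simp
qed (auto intro: trig_polys.add trig_polys_mult trig_polys_const)

text \<open>Composing a Stone--Weierstrass approximant with a polynomial close to the clipping function
  keeps it a trigonometric polynomial and bounds it globally by a constant that does not depend on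
  the radius of the ball.\<close>

lemma trig_polys_approx:
  fixes f :: "'v::euclidean_space \<Rightarrow> real"
  assumes f: "continuous_on UNIV f" and C: "\<And>x. \<bar>f x\<bar> \<le> C" and \<epsilon>: "0 < \<epsilon>" "\<epsilon> < 1"
  obtains g where "g \<in> trig_polys" "\<And>x. norm x \<le> K \<Longrightarrow> \<bar>f x - g x\<bar> \<le> 2 * \<epsilon>" "\<And>x. \<bar>g x\<bar> \<le> C + 2"
proof -
  interpret function_ring_on "trig_polys :: ('v \<Rightarrow> real) set" "cball 0 K"
  proof
    show "\<exists>f\<in>trig_polys. f x \<noteq> f y" if "x \<noteq> y" for x y :: 'v
    proof -
      \<comment> \<open>The sine below vanishes at y, and this choice of t puts its argument at x
        strictly between 0 and pi, so it separates the two points.\<close>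
      obtain t where t: "0 < t" "t * (norm (x - y))\<^sup>2 < pi"
      proof
        have "0 < (norm (x - y))\<^sup>2" using \<open>x \<noteq> y\<close> by simp
        then show "0 < pi / 2 / (norm (x - y))\<^sup>2" "pi / 2 / (norm (x - y))\<^sup>2 * (norm (x - y))\<^sup>2 < pi"
          by (auto simp: pi_gt_zero)
      qed
      let ?u = "t *\<^sub>R (x - y)"
      let ?f = "\<lambda>z. sin (?u \<bullet> z + (- ?u \<bullet> y))"
      have *: "?f = (\<lambda>z. cos (- ?u \<bullet> y) * sin (?u \<bullet> z) + sin (- ?u \<bullet> y) * cos (?u \<bullet> z))"
        unfolding sin_add by (simp add: mult.commute add.commute)
      have f: "?f \<in> trig_polys" unfolding * by (intro trig_polys.scale trig_polys.add trig_polys.sin trig_polys.cos)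
      have "?u \<bullet> x + (- ?u \<bullet> y) = t * (norm (x - y))\<^sup>2"
        by (simp add: power2_norm_eq_inner algebra_simps inner_diff_left inner_diff_right)
      then have "?f x > 0" using t that by (auto intro!: sin_gt_zero)
      then have "?f x \<noteq> ?f y" by simp
      then show ?thesis using f by (rule bexI)
    qed
  qed (auto intro: trig_polys.add trig_polys_mult trig_polys_const continuous_on_subset[OF trig_polys_continuous])
  have "continuous_on (cball 0 K) f" by (rule continuous_on_subset[OF f]) simp
  from Stone_Weierstrass_basic[OF this \<epsilon>(1)] obtain g where g: "g \<in> trig_polys" "\<And>x. norm x \<le> K \<Longrightarrow> \<bar>f x - g x\<bar> < \<epsilon>"
    by auto
  from trig_polys_bounded[OF g(1)] obtain G where G: "\<And>x. \<bar>g x\<bar> \<le> G" by auto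
  \<comment> \<open>The clipping level exceeds C by 1, hence by more than \<epsilon>. On the ball
    the approximant g stays below it and is left unchanged.\<close>
  define c where "c y = max (- C - 1) (min (C + 1) y)" for y :: real
  have "continuous_on {- G..G} c" unfolding c_def by (intro continuous_intros)
  from Stone_Weierstrass_real_polynomial_function[OF _ this \<epsilon>(1)] obtain q where
    q: "real_polynomial_function q" "\<And>y. y \<in> {- G..G} \<Longrightarrow> \<bar>c y - q y\<bar> < \<epsilon>"
    by (metis compact_Icc)
  have cq: "\<bar>c (g x) - q (g x)\<bar> < \<epsilon>" for x using q(2)[of "g x"] G[of x] by (auto simp: abs_le_iff)
  have C0: "0 \<le> C" using C[of undefined] by linarith
  show ?thesis
  proof
    show "(\<lambda>x. q (g x)) \<in> trig_polys" by (rule trig_polys_compose[OF q(1) g(1)])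
    show "\<bar>f x - q (g x)\<bar> \<le> 2 * \<epsilon>" if "norm x \<le> K" for x
    proof -
      have "c (g x) = g x" using g(2)[OF that] C[of x] \<epsilon> unfolding c_def by linarith
      then show ?thesis using cq[of x] g(2)[OF that] by linarith
    qed
    show "\<bar>q (g x)\<bar> \<le> C + 2" for x
    proof -
      have "\<bar>c (g x)\<bar> \<le> C + 1" unfolding c_def using C0 by linarith
      then show ?thesis using cq[of x] \<epsilon> by linarith
    qed
  qed
qed

lemma (in prob_space) expectation_diff_off_ball:
  fixes f g :: "'v::euclidean_space \<Rightarrow> real"
  assumes [measurable]: "Z \<in> borel_measurable M" "f \<in> borel_measurable borel" "g \<in> borel_measurable borel"
    and f: "\<And>x. \<bar>f x\<bar> \<le> C" and g: "\<And>x. \<bar>g x\<bar> \<le> D" and fg: "\<And>x. norm x \<le> K \<Longrightarrow> \<bar>f x - g x\<bar> \<le> \<delta>"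
    and \<delta>: "0 \<le> \<delta>"
  shows "\<bar>expectation (\<lambda>\<omega>. f (Z \<omega>)) - expectation (\<lambda>\<omega>. g (Z \<omega>))\<bar>
    \<le> \<delta> + (C + D) * \<P>(\<omega> in M. norm (Z \<omega>) > K)"
proof -
  have i: "integrable M (\<lambda>\<omega>. f (Z \<omega>))" "integrable M (\<lambda>\<omega>. g (Z \<omega>))"
    using f g by (auto intro: integrable_const_bound[of _ C] integrable_const_bound[of _ D])
  have "expectation (\<lambda>\<omega>. f (Z \<omega>)) - expectation (\<lambda>\<omega>. g (Z \<omega>)) = expectation (\<lambda>\<omega>. f (Z \<omega>) - g (Z \<omega>))"
    using i by simp
  also have "\<bar>\<dots>\<bar> \<le> expectation (\<lambda>\<omega>. \<bar>f (Z \<omega>) - g (Z \<omega>)\<bar>)" by (rule integral_abs_bound)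
  also have "\<dots> \<le> expectation (\<lambda>\<omega>. \<delta> + (C + D) * indicator {\<omega>\<in>space M. norm (Z \<omega>) > K} \<omega>)"
  proof (rule integral_mono)
    show "integrable M (\<lambda>\<omega>. \<bar>f (Z \<omega>) - g (Z \<omega>)\<bar>)" using i by simp
    show "integrable M (\<lambda>\<omega>. \<delta> + (C + D) * indicator {\<omega>\<in>space M. norm (Z \<omega>) > K} \<omega>)"
      by (intro Bochner_Integration.integrable_add integrable_mult_right integrable_real_indicator)
        (auto simp: emeasure_eq_measure)
    fix \<omega> assume w: "\<omega> \<in> space M"
    have "\<bar>f (Z \<omega>) - g (Z \<omega>)\<bar> \<le> C + D" using f[of "Z \<omega>"] g[of "Z \<omega>"] by linarith
    then show "\<bar>f (Z \<omega>) - g (Z \<omega>)\<bar> \<le> \<delta> + (C + D) * indicator {\<omega>\<in>space M. norm (Z \<omega>) > K} \<omega>"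
      using fg[of "Z \<omega>"] w \<delta> by (cases "norm (Z \<omega>) \<le> K") (auto simp: indicator_def)
  qed
  also have "\<dots> = \<delta> + (C + D) * \<P>(\<omega> in M. norm (Z \<omega>) > K)"
    by (subst Bochner_Integration.integral_add) (auto simp: emeasure_eq_measure prob_space)
  finally show ?thesis .
qed

lemma (in prob_space) norm_tail_small:
  fixes Z :: "'a \<Rightarrow> 'v::euclidean_space"
  assumes [measurable]: "Z \<in> borel_measurable M" and \<epsilon>: "0 < \<epsilon>"
  obtains K :: real where "\<P>(\<omega> in M. norm (Z \<omega>) > K) < \<epsilon>"
proof -
  have "(\<lambda>n. prob {\<omega>\<in>space M. norm (Z \<omega>) > real n}) \<longlonglongrightarrow> prob (\<Inter>n. {\<omega>\<in>space M. norm (Z \<omega>) > real n})"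
    by (rule finite_Lim_measure_decseq) (auto simp: decseq_def)
  moreover have "(\<Inter>n. {\<omega>\<in>space M. norm (Z \<omega>) > real n}) = {}"
    by (auto simp: not_less) (metis linorder_not_less real_arch_simple)
  ultimately have "(\<lambda>n. prob {\<omega>\<in>space M. norm (Z \<omega>) > real n}) \<longlonglongrightarrow> 0" by simp
  from order_tendstoD(2)[OF this \<epsilon>] obtain n where "prob {\<omega>\<in>space M. norm (Z \<omega>) > real n} < \<epsilon>"
    by (auto simp: eventually_sequentially)
  then show ?thesis by (rule that)
qed

text \<open>Taking tightness as a hypothesis avoids any selection of subsequences: a bounded
  continuous function is close to a trigonometric polynomial on a large ball, and outside it both
  are bounded by constants that do not depend on the radius.\<close>

lemma (in prob_space) multivariate_levy:
  fixes Z :: "nat \<Rightarrow> 'a \<Rightarrow> 'v::euclidean_space"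
  assumes Z[measurable]: "\<And>n. Z n \<in> borel_measurable M"
    and N: "prob_space N" "sets N = sets borel"
    and cf: "\<And>t. (\<lambda>n. CLINT \<omega>|M. iexp (t \<bullet> Z n \<omega>)) \<longlonglongrightarrow> (CLINT x|N. iexp (t \<bullet> x))"
    and tight: "\<And>\<epsilon>. 0 < \<epsilon> \<Longrightarrow> \<exists>K. \<forall>\<^sub>F n in sequentially. \<P>(\<omega> in M. norm (Z n \<omega>) > K) < \<epsilon>"
  shows "converges_in_dist M Z N"
proof -
  interpret N: prob_space N by (rule N)
  note [measurable_cong] = N(2)
  have trig: "(\<lambda>n. LINT \<omega>|M. g (Z n \<omega>)) \<longlonglongrightarrow> (LINT x|N. g x)" if "g \<in> trig_polys" for g
    using that
  proof induction
    case (cos t)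
    have "(LINT \<omega>|M. cos (t \<bullet> Z n \<omega>)) = Re (CLINT \<omega>|M. iexp (t \<bullet> Z n \<omega>))" for n
      by (subst integral_Re[symmetric]) (auto intro!: integrable_const_bound[of _ 1] simp: Re_exp)
    moreover have "(LINT x|N. cos (t \<bullet> x)) = Re (CLINT x|N. iexp (t \<bullet> x))"
      by (subst integral_Re[symmetric]) (auto intro!: N.integrable_const_bound[of _ 1] simp: Re_exp)
    ultimately show ?case using tendsto_Re[OF cf[of t]] by simp
  next
    case (sin t)
    have "(LINT \<omega>|M. sin (t \<bullet> Z n \<omega>)) = Im (CLINT \<omega>|M. iexp (t \<bullet> Z n \<omega>))" for n
      by (subst integral_Im[symmetric]) (auto intro!: integrable_const_bound[of _ 1] simp: Im_exp)
    moreover have "(LINT x|N. sin (t \<bullet> x)) = Im (CLINT x|N. iexp (t \<bullet> x))"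
      by (subst integral_Im[symmetric]) (auto intro!: N.integrable_const_bound[of _ 1] simp: Im_exp)
    ultimately show ?case using tendsto_Im[OF cf[of t]] by simp
  next
    case (scale f c)
    then show ?case by (auto intro!: tendsto_intros)
  next
    case (add f g)
    have i: "integrable M (\<lambda>\<omega>. f (Z n \<omega>))" "integrable N f" if "f \<in> trig_polys" for n f
    proof -
      have [measurable]: "f \<in> borel_measurable borel"
        by (rule borel_measurable_continuous_onI[OF trig_polys_continuous[OF that]])
      obtain C where "\<forall>x. \<bar>f x\<bar> \<le> C" using trig_polys_bounded[OF \<open>f \<in> trig_polys\<close>] by auto
      then show "integrable M (\<lambda>\<omega>. f (Z n \<omega>))" "integrable N f"
        by (auto intro: integrable_const_bound[of _ C] N.integrable_const_bound[of _ C])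
    qed
    show ?case using add i by (auto intro!: tendsto_add)
  qed
  show ?thesis unfolding converges_in_dist_def
  proof (intro conjI allI impI)
    fix f :: "'v \<Rightarrow> real" assume f: "continuous_on UNIV f \<and> bounded (range f)"
    have [measurable]: "f \<in> borel_measurable borel"
      by (rule borel_measurable_continuous_onI) (use f in blast)
    obtain C where C: "\<And>x. \<bar>f x\<bar> \<le> C" using f by (auto simp: bounded_iff)
    have C0: "0 \<le> C" using C[of undefined] by linarith
    have D0: "0 < 4 * C + 10" using C0 by simp
    show "(\<lambda>n. LINT \<omega>|M. f (Z n \<omega>)) \<longlonglongrightarrow> (LINT x|N. f x)"
    proof (rule LIMSEQ_I)
      fix r :: real assume r: "0 < r"
      \<comment> \<open>Passing from f to g costs (2 C + 4) \<epsilon> under M and again under N,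
        and the convergence for g costs less than \<epsilon>; the total stays below (4 C + 10)
        \<epsilon>.\<close>
      define \<epsilon> where "\<epsilon> = min (1/2) (r / (4 * C + 10))"
      have \<epsilon>1: "0 < \<epsilon>" "\<epsilon> < 1" "\<epsilon> \<le> r / (4 * C + 10)" using r D0 by (auto simp: \<epsilon>_def)
      have "\<epsilon> * (4 * C + 10) \<le> r" using \<epsilon>1(3) by (simp add: pos_le_divide_eq[OF D0])
      note \<epsilon> = \<epsilon>1(1,2) this
      obtain K1 where K1: "\<forall>\<^sub>F n in sequentially. \<P>(\<omega> in M. norm (Z n \<omega>) > K1) < \<epsilon>" using tight[OF \<epsilon>(1)] by blast
      have "(\<lambda>x. x) \<in> borel_measurable N" by measurable
      from N.norm_tail_small[OF this \<epsilon>(1)] obtain K2 where K2: "\<P>(x in N. norm x > K2) < \<epsilon>" by blast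
      define K where "K = max K1 K2"
      obtain g where g: "g \<in> trig_polys" "\<And>x. norm x \<le> K \<Longrightarrow> \<bar>f x - g x\<bar> \<le> 2 * \<epsilon>" "\<And>x. \<bar>g x\<bar> \<le> C + 2"
        using trig_polys_approx[of f C \<epsilon> K] f C \<epsilon> by metis
      have [measurable]: "g \<in> borel_measurable borel"
        by (rule borel_measurable_continuous_onI[OF trig_polys_continuous[OF g(1)]])
      have "\<P>(x in N. norm x > K) \<le> \<P>(x in N. norm x > K2)"
        by (rule N.finite_measure_mono) (auto simp: K_def)
      then have "(C + (C + 2)) * \<P>(x in N. norm x > K) \<le> (C + (C + 2)) * \<epsilon>"
        using K2 C0 by (intro mult_left_mono) auto
      with N.expectation_diff_off_ball[of "\<lambda>x. x" f g C "C + 2" K "2 * \<epsilon>"] C g \<epsilon>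
      have fN: "\<bar>(LINT x|N. f x) - (LINT x|N. g x)\<bar> \<le> 2 * \<epsilon> + (C + (C + 2)) * \<epsilon>" by simp
      have "\<forall>\<^sub>F n in sequentially. \<bar>(LINT \<omega>|M. g (Z n \<omega>)) - (LINT x|N. g x)\<bar> < \<epsilon>"
        using tendstoD[OF trig[OF g(1)] \<epsilon>(1)] by (simp add: dist_real_def)
      with K1 show "\<exists>no. \<forall>n\<ge>no. norm ((LINT \<omega>|M. f (Z n \<omega>)) - (LINT x|N. f x)) < r"
        unfolding eventually_sequentially[symmetric] real_norm_def
      proof eventually_elim
        case (elim n)
        have "\<P>(\<omega> in M. norm (Z n \<omega>) > K) \<le> \<P>(\<omega> in M. norm (Z n \<omega>) > K1)"
          by (rule finite_measure_mono) (auto simp: K_def)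
        then have "(C + (C + 2)) * \<P>(\<omega> in M. norm (Z n \<omega>) > K) \<le> (C + (C + 2)) * \<epsilon>"
          using elim C0 by (intro mult_left_mono) auto
        with expectation_diff_off_ball[of "Z n" f g C "C + 2" K "2 * \<epsilon>"] C g \<epsilon>
        have "\<bar>(LINT \<omega>|M. f (Z n \<omega>)) - (LINT \<omega>|M. g (Z n \<omega>))\<bar> \<le> 2 * \<epsilon> + (C + (C + 2)) * \<epsilon>" by simp
        with fN elim(2) have "\<bar>(LINT \<omega>|M. f (Z n \<omega>)) - (LINT x|N. f x)\<bar> < \<epsilon> * (4 * C + 10)"
          using \<epsilon> by (simp add: algebra_simps)
        then show ?case using \<epsilon>(3) by simp
      qed
    qed
  qed (rule Z)
qed

section \<open>Convergence to zero in probability, tightness and a Slutsky argument\<close>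

context prob_space
begin

definition prob_null :: "(nat \<Rightarrow> 'a \<Rightarrow> real) \<Rightarrow> bool" where
  "prob_null Y \<longleftrightarrow> (\<forall>\<epsilon>>0. (\<lambda>n. \<P>(\<omega> in M. \<epsilon> < \<bar>Y n \<omega>\<bar>)) \<longlonglongrightarrow> 0)"

lemma prob_nullD: "prob_null Y \<Longrightarrow> 0 < \<epsilon> \<Longrightarrow> (\<lambda>n. \<P>(\<omega> in M. \<epsilon> < \<bar>Y n \<omega>\<bar>)) \<longlonglongrightarrow> 0"
  by (simp add: prob_null_def)

lemma prob_null_eventually:
  "prob_null Y \<Longrightarrow> 0 < \<epsilon> \<Longrightarrow> 0 < \<theta> \<Longrightarrow> \<forall>\<^sub>F n in sequentially. \<P>(\<omega> in M. \<epsilon> < \<bar>Y n \<omega>\<bar>) < \<theta>"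
  by (rule order_tendstoD(2)[OF prob_nullD])

lemma prob_null_L2:
  assumes [measurable]: "\<And>n. Y n \<in> borel_measurable M" and i: "\<And>n. integrable M (\<lambda>\<omega>. (Y n \<omega>)\<^sup>2)"
    and lim: "(\<lambda>n. expectation (\<lambda>\<omega>. (Y n \<omega>)\<^sup>2)) \<longlonglongrightarrow> 0"
  shows "prob_null Y"
  unfolding prob_null_def
proof (intro allI impI)
  fix \<epsilon> :: real assume \<epsilon>: "0 < \<epsilon>"
  have "(\<lambda>n. expectation (\<lambda>\<omega>. (Y n \<omega>)\<^sup>2) / \<epsilon>\<^sup>2) \<longlonglongrightarrow> 0 / \<epsilon>\<^sup>2" by (intro tendsto_intros lim) (use \<epsilon> in simp)
  then have l: "(\<lambda>n. expectation (\<lambda>\<omega>. (Y n \<omega>)\<^sup>2) / \<epsilon>\<^sup>2) \<longlonglongrightarrow> 0" by simp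
  have "\<P>(\<omega> in M. \<epsilon> < \<bar>Y n \<omega>\<bar>) \<le> expectation (\<lambda>\<omega>. (Y n \<omega>)\<^sup>2) / \<epsilon>\<^sup>2" for n
  proof -
    have "\<P>(\<omega> in M. \<epsilon> < \<bar>Y n \<omega>\<bar>) \<le> \<P>(\<omega> in M. \<epsilon> \<le> \<bar>Y n \<omega>\<bar>)" by (rule finite_measure_mono) auto
    also have "\<dots> \<le> expectation (\<lambda>\<omega>. (Y n \<omega>)\<^sup>2) / \<epsilon>\<^sup>2" by (rule second_moment_method[OF _ i \<epsilon>]) simp
    finally show ?thesis .
  qed
  then show "(\<lambda>n. \<P>(\<omega> in M. \<epsilon> < \<bar>Y n \<omega>\<bar>)) \<longlonglongrightarrow> 0"
    by (intro tendsto_sandwich[OF always_eventually always_eventually tendsto_const l]) auto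
qed

lemma prob_null_add:
  assumes [measurable]: "\<And>n. Y n \<in> borel_measurable M" "\<And>n. Z n \<in> borel_measurable M"
    and Y: "prob_null Y" and Z: "prob_null Z"
  shows "prob_null (\<lambda>n \<omega>. Y n \<omega> + Z n \<omega>)"
  unfolding prob_null_def
proof (intro allI impI)
  fix \<epsilon> :: real assume "0 < \<epsilon>"
  then have \<epsilon>: "0 < \<epsilon> / 2" by simp
  have "(\<lambda>n. \<P>(\<omega> in M. \<epsilon> / 2 < \<bar>Y n \<omega>\<bar>) + \<P>(\<omega> in M. \<epsilon> / 2 < \<bar>Z n \<omega>\<bar>)) \<longlonglongrightarrow> 0 + 0"
    by (rule tendsto_add[OF prob_nullD[OF Y \<epsilon>] prob_nullD[OF Z \<epsilon>]])
  then have l: "(\<lambda>n. \<P>(\<omega> in M. \<epsilon> / 2 < \<bar>Y n \<omega>\<bar>) + \<P>(\<omega> in M. \<epsilon> / 2 < \<bar>Z n \<omega>\<bar>)) \<longlonglongrightarrow> 0" by simp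
  have "\<P>(\<omega> in M. \<epsilon> < \<bar>Y n \<omega> + Z n \<omega>\<bar>) \<le> \<P>(\<omega> in M. \<epsilon> / 2 < \<bar>Y n \<omega>\<bar>) + \<P>(\<omega> in M. \<epsilon> / 2 < \<bar>Z n \<omega>\<bar>)" for n
  proof -
    have "\<P>(\<omega> in M. \<epsilon> < \<bar>Y n \<omega> + Z n \<omega>\<bar>) \<le> prob ({\<omega> \<in> space M. \<epsilon> / 2 < \<bar>Y n \<omega>\<bar>} \<union> {\<omega> \<in> space M. \<epsilon> / 2 < \<bar>Z n \<omega>\<bar>})"
    proof (rule finite_measure_mono)
      show "{\<omega> \<in> space M. \<epsilon> < \<bar>Y n \<omega> + Z n \<omega>\<bar>} \<subseteq> {\<omega> \<in> space M. \<epsilon> / 2 < \<bar>Y n \<omega>\<bar>} \<union> {\<omega> \<in> space M. \<epsilon> / 2 < \<bar>Z n \<omega>\<bar>}"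
      proof
        fix \<omega> assume w: "\<omega> \<in> {\<omega> \<in> space M. \<epsilon> < \<bar>Y n \<omega> + Z n \<omega>\<bar>}"
        then have "\<epsilon> / 2 < \<bar>Y n \<omega>\<bar> \<or> \<epsilon> / 2 < \<bar>Z n \<omega>\<bar>" using abs_triangle_ineq[of "Y n \<omega>" "Z n \<omega>"] by fastforce
        then show "\<omega> \<in> {\<omega> \<in> space M. \<epsilon> / 2 < \<bar>Y n \<omega>\<bar>} \<union> {\<omega> \<in> space M. \<epsilon> / 2 < \<bar>Z n \<omega>\<bar>}" using w by simp
      qed
    qed measurable
    also have "\<dots> \<le> \<P>(\<omega> in M. \<epsilon> / 2 < \<bar>Y n \<omega>\<bar>) + \<P>(\<omega> in M. \<epsilon> / 2 < \<bar>Z n \<omega>\<bar>)"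
      by (rule measure_Un_le) measurable
    finally show ?thesis .
  qed
  then show "(\<lambda>n. \<P>(\<omega> in M. \<epsilon> < \<bar>Y n \<omega> + Z n \<omega>\<bar>)) \<longlonglongrightarrow> 0"
    by (intro tendsto_sandwich[OF always_eventually always_eventually tendsto_const l]) auto
qed

definition prob_tight :: "(nat \<Rightarrow> 'a \<Rightarrow> real) \<Rightarrow> bool" where
  "prob_tight Y \<longleftrightarrow> (\<forall>\<epsilon>>0. \<exists>K. \<forall>\<^sub>F n in sequentially. \<P>(\<omega> in M. K < \<bar>Y n \<omega>\<bar>) < \<epsilon>)"

lemma prob_tight_L2:
  assumes [measurable]: "\<And>n. Y n \<in> borel_measurable M" and i: "\<And>n. integrable M (\<lambda>\<omega>. (Y n \<omega>)\<^sup>2)"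
    and C: "\<forall>\<^sub>F n in sequentially. expectation (\<lambda>\<omega>. (Y n \<omega>)\<^sup>2) \<le> C"
  shows "prob_tight Y"
  unfolding prob_tight_def
proof (intro allI impI)
  fix \<epsilon> :: real assume \<epsilon>: "0 < \<epsilon>"
  \<comment> \<open>The added 1 makes Chebyshev's bound C / K^2 strictly smaller than \<epsilon> and
    keeps K positive.\<close>
  define K where "K = sqrt ((\<bar>C\<bar> + 1) / \<epsilon>)"
  have K: "0 < K" using \<epsilon> by (simp add: K_def)
  have K2: "K\<^sup>2 = (\<bar>C\<bar> + 1) / \<epsilon>" using \<epsilon> by (simp add: K_def)
  from C have "\<forall>\<^sub>F n in sequentially. \<P>(\<omega> in M. K < \<bar>Y n \<omega>\<bar>) < \<epsilon>"
  proof eventually_elim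
    case (elim n)
    have "\<P>(\<omega> in M. K < \<bar>Y n \<omega>\<bar>) \<le> \<P>(\<omega> in M. K \<le> \<bar>Y n \<omega>\<bar>)" by (rule finite_measure_mono) auto
    also have "\<dots> \<le> expectation (\<lambda>\<omega>. (Y n \<omega>)\<^sup>2) / K\<^sup>2" by (rule second_moment_method[OF _ i K]) simp
    also have "\<dots> \<le> C / K\<^sup>2" using elim by (intro divide_right_mono) auto
    also have "\<dots> < \<epsilon>"
    proof -
      have "C < \<epsilon> * K\<^sup>2" unfolding K2 using \<epsilon> by simp
      then show ?thesis using K by (simp add: pos_divide_less_eq)
    qed
    finally show ?case .
  qed
  then show "\<exists>K. \<forall>\<^sub>F n in sequentially. \<P>(\<omega> in M. K < \<bar>Y n \<omega>\<bar>) < \<epsilon>" by blast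
qed

text \<open>A Slutsky theorem in multiplied-out form, based on (Z - L) W = (q - W) L + \<delta>. The
  identity for Z is demanded only where W is positive, because Z will be a ratio with a default
  value elsewhere.\<close>

lemma prob_null_ratio:
  assumes [measurable]: "\<And>n. L n \<in> borel_measurable M" "\<And>n. \<delta> n \<in> borel_measurable M"
      "\<And>n. W n \<in> borel_measurable M" "\<And>n. Z n \<in> borel_measurable M"
    and q: "0 < q" and L: "prob_tight L" and \<delta>: "prob_null \<delta>" and W: "prob_null (\<lambda>n \<omega>. W n \<omega> - q)"
    and Z: "\<forall>\<^sub>F n in sequentially. \<forall>\<omega>\<in>space M. 0 < W n \<omega> \<longrightarrow> Z n \<omega> * W n \<omega> = q * L n \<omega> + \<delta> n \<omega>"
  shows "prob_null (\<lambda>n \<omega>. Z n \<omega> - L n \<omega>)"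
  unfolding prob_null_def
proof (intro allI impI)
  fix \<epsilon> :: real assume \<epsilon>: "0 < \<epsilon>"
  show "(\<lambda>n. \<P>(\<omega> in M. \<epsilon> < \<bar>Z n \<omega> - L n \<omega>\<bar>)) \<longlonglongrightarrow> 0"
  proof (rule LIMSEQ_I)
    fix \<theta> :: real assume \<theta>: "0 < \<theta>"
    then have t3: "0 < \<theta> / 3" by simp
    obtain K0 where K0: "\<forall>\<^sub>F n in sequentially. \<P>(\<omega> in M. K0 < \<bar>L n \<omega>\<bar>) < \<theta> / 3" using L t3 unfolding prob_tight_def by blast
    define K where "K = \<bar>K0\<bar>"
    \<comment> \<open>The first term keeps W above q / 2; the second makes the error \<eta> (K + 1)
      at most \<epsilon> q / 2, so that division by W leaves \<epsilon>.\<close>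
    define \<eta> where "\<eta> = min (q / 2) (\<epsilon> * (q / 2) / (K + 1))"
    have K: "0 \<le> K" by (simp add: K_def)
    have \<eta>: "0 < \<eta>" using q \<epsilon> K by (simp add: \<eta>_def)
    have \<eta>1: "\<eta> \<le> q / 2" unfolding \<eta>_def by (rule min.cobounded1)
    have "\<eta> \<le> \<epsilon> * (q / 2) / (K + 1)" unfolding \<eta>_def by (rule min.cobounded2)
    then have \<eta>2: "\<eta> * (K + 1) \<le> \<epsilon> * (q / 2)" using K by (simp add: pos_le_divide_eq algebra_simps)
    have "\<forall>\<^sub>F n in sequentially. \<P>(\<omega> in M. \<eta> < \<bar>\<delta> n \<omega>\<bar>) < \<theta> / 3"
      by (rule prob_null_eventually[OF \<delta> \<eta> t3])
    moreover have "\<forall>\<^sub>F n in sequentially. \<P>(\<omega> in M. \<eta> < \<bar>W n \<omega> - q\<bar>) < \<theta> / 3"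
      by (rule prob_null_eventually[OF W \<eta> t3])
    ultimately have "\<forall>\<^sub>F n in sequentially. norm (\<P>(\<omega> in M. \<epsilon> < \<bar>Z n \<omega> - L n \<omega>\<bar>) - 0) < \<theta>"
      using K0 Z
    proof eventually_elim
      case (elim n)
      let ?A = "{\<omega> \<in> space M. \<eta> < \<bar>\<delta> n \<omega>\<bar>}" and ?B = "{\<omega> \<in> space M. \<eta> < \<bar>W n \<omega> - q\<bar>}" and ?C = "{\<omega> \<in> space M. K0 < \<bar>L n \<omega>\<bar>}"
      have "\<P>(\<omega> in M. \<epsilon> < \<bar>Z n \<omega> - L n \<omega>\<bar>) \<le> prob (?A \<union> (?B \<union> ?C))"
      proof (rule finite_measure_mono)
        show "{\<omega> \<in> space M. \<epsilon> < \<bar>Z n \<omega> - L n \<omega>\<bar>} \<subseteq> ?A \<union> (?B \<union> ?C)"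
        proof
          fix \<omega> assume w: "\<omega> \<in> {\<omega> \<in> space M. \<epsilon> < \<bar>Z n \<omega> - L n \<omega>\<bar>}"
          show "\<omega> \<in> ?A \<union> (?B \<union> ?C)"
          proof (rule ccontr)
            assume "\<omega> \<notin> ?A \<union> (?B \<union> ?C)"
            then have n: "\<bar>\<delta> n \<omega>\<bar> \<le> \<eta>" "\<bar>W n \<omega> - q\<bar> \<le> \<eta>" "\<bar>L n \<omega>\<bar> \<le> K" using w by (auto simp: K_def)
            have Wq: "q / 2 \<le> W n \<omega>" using n(2) \<eta>1 by linarith
            then have "Z n \<omega> * W n \<omega> = q * L n \<omega> + \<delta> n \<omega>" using elim(4) w q by auto
            then have "(Z n \<omega> - L n \<omega>) * W n \<omega> = (q - W n \<omega>) * L n \<omega> + \<delta> n \<omega>" by (simp add: algebra_simps)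
            then have "\<bar>Z n \<omega> - L n \<omega>\<bar> * \<bar>W n \<omega>\<bar> = \<bar>(q - W n \<omega>) * L n \<omega> + \<delta> n \<omega>\<bar>" by (simp add: abs_mult[symmetric])
            also have "\<dots> \<le> \<bar>q - W n \<omega>\<bar> * \<bar>L n \<omega>\<bar> + \<bar>\<delta> n \<omega>\<bar>" using abs_triangle_ineq by (simp add: abs_mult[symmetric])
            also have "\<dots> \<le> \<eta> * K + \<eta>" using n \<eta> by (intro add_mono mult_mono) (auto simp: abs_minus_commute)
            also have "\<dots> \<le> \<epsilon> * (q / 2)" using \<eta>2 by (simp add: algebra_simps)
            also have "\<dots> \<le> \<epsilon> * \<bar>W n \<omega>\<bar>" using Wq \<epsilon> by (intro mult_left_mono) auto
            finally have "\<bar>Z n \<omega> - L n \<omega>\<bar> \<le> \<epsilon>" using Wq q by (simp add: mult_le_cancel_right)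
            then show False using w by simp
          qed
        qed
      qed measurable
      also have "\<dots> \<le> prob ?A + prob (?B \<union> ?C)" by (rule measure_Un_le) measurable
      also have "prob (?B \<union> ?C) \<le> prob ?B + prob ?C" by (rule measure_Un_le) measurable
      finally show ?case using elim(1-3) by simp
    qed
    then show "\<exists>no. \<forall>n\<ge>no. norm (\<P>(\<omega> in M. \<epsilon> < \<bar>Z n \<omega> - L n \<omega>\<bar>) - 0) < \<theta>"
      by (simp add: eventually_sequentially)
  qed
qed

lemma vec_borel_measurable:
  fixes f :: "'a \<Rightarrow> real^'p::finite"
  assumes "\<And>i. (\<lambda>\<omega>. f \<omega> $ i) \<in> borel_measurable M"
  shows "f \<in> borel_measurable M"
proof (rule borel_measurable_euclidean_space[THEN iffD2], rule ballI)
  fix e :: "real^'p" assume "e \<in> Basis"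
  then obtain i where "e = axis i 1" by (auto simp: Basis_vec_def)
  then show "(\<lambda>\<omega>. f \<omega> \<bullet> e) \<in> borel_measurable M" using assms[of i] by (simp add: inner_axis)
qed

lemma vec_norm_prob:
  fixes f :: "'a \<Rightarrow> real^'p::finite" and K :: real
  assumes [measurable]: "\<And>i. (\<lambda>\<omega>. f \<omega> $ i) \<in> borel_measurable M"
  shows "\<P>(\<omega> in M. real CARD('p) * K < norm (f \<omega>)) \<le> (\<Sum>i\<in>UNIV. \<P>(\<omega> in M. K < \<bar>f \<omega> $ i\<bar>))"
proof -
  have "\<P>(\<omega> in M. real CARD('p) * K < norm (f \<omega>)) \<le> prob (\<Union>i\<in>UNIV. {\<omega> \<in> space M. K < \<bar>f \<omega> $ i\<bar>})"
  proof (rule finite_measure_mono)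
    show "{\<omega> \<in> space M. real CARD('p) * K < norm (f \<omega>)} \<subseteq> (\<Union>i\<in>UNIV. {\<omega> \<in> space M. K < \<bar>f \<omega> $ i\<bar>})"
    proof
      fix \<omega> assume w: "\<omega> \<in> {\<omega> \<in> space M. real CARD('p) * K < norm (f \<omega>)}"
      have "\<exists>i. K < \<bar>f \<omega> $ i\<bar>"
      proof (rule ccontr)
        assume "\<not> (\<exists>i. K < \<bar>f \<omega> $ i\<bar>)"
        then have "(\<Sum>i\<in>UNIV. \<bar>f \<omega> $ i\<bar>) \<le> of_nat (card (UNIV :: 'p set)) * K" by (intro sum_bounded_above) (auto simp: not_less)
        then show False using norm_le_l1_cart[of "f \<omega>"] w by simp
      qed
      then show "\<omega> \<in> (\<Union>i\<in>UNIV. {\<omega> \<in> space M. K < \<bar>f \<omega> $ i\<bar>})" using w by auto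
    qed
  qed measurable
  also have "\<dots> \<le> (\<Sum>i\<in>UNIV. \<P>(\<omega> in M. K < \<bar>f \<omega> $ i\<bar>))"
    by (rule finite_measure_subadditive_finite) auto
  finally show ?thesis .
qed

text \<open>The function \<open>iexp\<close> is 1-Lipschitz and bounded: the difference is at most
  \<epsilon>/2 where Z and Y are close, and at most 2 on an event of probability below
  \<epsilon>/4.\<close>

lemma char_diff_limit:
  assumes [measurable]: "\<And>n. Y n \<in> borel_measurable M" "\<And>n. Z n \<in> borel_measurable M"
    and null: "prob_null (\<lambda>n \<omega>. Z n \<omega> - Y n \<omega>)" and Y: "(\<lambda>n. CLINT \<omega>|M. iexp (Y n \<omega>)) \<longlonglongrightarrow> z"
  shows "(\<lambda>n. CLINT \<omega>|M. iexp (Z n \<omega>)) \<longlonglongrightarrow> z"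
proof -
  have "(\<lambda>n. (CLINT \<omega>|M. iexp (Z n \<omega>)) - (CLINT \<omega>|M. iexp (Y n \<omega>))) \<longlonglongrightarrow> 0"
  proof (rule LIMSEQ_I)
    fix \<epsilon> :: real assume \<epsilon>: "0 < \<epsilon>"
    then have "\<forall>\<^sub>F n in sequentially. \<P>(\<omega> in M. \<epsilon> / 2 < \<bar>Z n \<omega> - Y n \<omega>\<bar>) < \<epsilon> / 4"
      by (intro prob_null_eventually[OF null]) auto
    then have "\<forall>\<^sub>F n in sequentially. norm ((CLINT \<omega>|M. iexp (Z n \<omega>)) - (CLINT \<omega>|M. iexp (Y n \<omega>)) - 0) < \<epsilon>"
    proof eventually_elim
      case (elim n)
      let ?B = "{\<omega> \<in> space M. \<epsilon> / 2 < \<bar>Z n \<omega> - Y n \<omega>\<bar>}"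
      have i: "complex_integrable M (\<lambda>\<omega>. iexp (Z n \<omega>))" "complex_integrable M (\<lambda>\<omega>. iexp (Y n \<omega>))"
        by (rule integrable_const_bound[of _ 1]; simp)+
      have iB: "integrable M (indicator ?B :: _ \<Rightarrow> real)"
        by (rule integrable_real_indicator) (auto simp: emeasure_eq_measure)
      have "cmod ((CLINT \<omega>|M. iexp (Z n \<omega>)) - (CLINT \<omega>|M. iexp (Y n \<omega>)))
          = cmod (CLINT \<omega>|M. iexp (Z n \<omega>) - iexp (Y n \<omega>))" using i by simp
      also have "\<dots> \<le> expectation (\<lambda>\<omega>. \<epsilon> / 2 + 2 * indicator ?B \<omega>)"
      proof (rule order_trans[OF integral_norm_bound integral_mono])
        show "integrable M (\<lambda>\<omega>. cmod (iexp (Z n \<omega>) - iexp (Y n \<omega>)))" using i by simp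
        show "integrable M (\<lambda>\<omega>. \<epsilon> / 2 + 2 * indicator ?B \<omega>)" using iB by simp
        fix \<omega> assume w: "\<omega> \<in> space M"
        show "cmod (iexp (Z n \<omega>) - iexp (Y n \<omega>)) \<le> \<epsilon> / 2 + 2 * indicator ?B \<omega>"
        proof (cases "\<omega> \<in> ?B")
          case True
          have "cmod (iexp (Z n \<omega>) - iexp (Y n \<omega>)) \<le> cmod (iexp (Z n \<omega>)) + cmod (iexp (Y n \<omega>))" by (rule norm_triangle_ineq4)
          then show ?thesis using True \<epsilon> by simp
        next
          case False
          have "iexp (Z n \<omega>) - iexp (Y n \<omega>) = iexp (Y n \<omega>) * (iexp (Z n \<omega> - Y n \<omega>) - 1)"
            by (simp add: algebra_simps exp_diff)
          then have "cmod (iexp (Z n \<omega>) - iexp (Y n \<omega>)) = cmod (iexp (Z n \<omega> - Y n \<omega>) - 1)" by (simp add: norm_mult)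
          also have "\<dots> \<le> \<bar>Z n \<omega> - Y n \<omega>\<bar>" using iexp_approx1[of "Z n \<omega> - Y n \<omega>" 0] by simp
          finally show ?thesis using False w by simp
        qed
      qed
      also have "\<dots> = \<epsilon> / 2 + 2 * prob ?B" using iB by (simp add: prob_space)
      finally show ?case using elim by simp
    qed
    then show "\<exists>no. \<forall>n\<ge>no. norm ((CLINT \<omega>|M. iexp (Z n \<omega>)) - (CLINT \<omega>|M. iexp (Y n \<omega>)) - 0) < \<epsilon>"
      by (simp add: eventually_sequentially)
  qed
  from tendsto_add[OF this Y] show ?thesis by simp
qed

end

section \<open>Gaussian measures with singular covariance\<close>

lemma quadratic_form: "t \<bullet> (V *v t) = (\<Sum>i\<in>UNIV. \<Sum>j\<in>UNIV. t $ i * V $ i $ j * t $ j)"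
  for V :: "real^'p^'p"
  by (simp add: inner_vec_def matrix_vector_mult_def sum_distrib_left mult.assoc)

text \<open>The form restricted to a line in direction i is a quadratic polynomial in s. Its leading
  coefficient and its minimum are what the next two lemmas exploit.\<close>

lemma quadratic_axis:
  fixes V :: "real^'p^'p"
  assumes sym: "transpose V = V"
  shows "(t - s *\<^sub>R axis i 1) \<bullet> (V *v (t - s *\<^sub>R axis i 1)) = t \<bullet> (V *v t) - 2 * s * (V $ i \<bullet> t) + s\<^sup>2 * V $ i $ i"
proof -
  have 1: "V *v axis i 1 = V $ i"
    using sym by (metis column_def matrix_vector_mul_component matrix_vector_mult_basis row_def row_transpose vec_lambda_eta)
  have 2: "axis i 1 \<bullet> (V *v t) = V $ i \<bullet> t"
    by (simp add: inner_axis' matrix_vector_mul_component)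
  have 3: "axis i 1 \<bullet> (V $ i) = V $ i $ i" by (simp add: inner_axis')
  show ?thesis
    by (simp add: matrix_vector_mult_diff_distrib matrix_vector_mult_scaleR inner_diff_left inner_diff_right 1 2 3 power2_eq_square algebra_simps)
      (simp add: inner_commute)
qed

text \<open>With a vanishing diagonal entry the form is affine in s along direction i; an affine
  function bounded below has slope zero.\<close>

lemma nonneg_quadratic_row_zero:
  fixes V :: "real^'p^'p"
  assumes sym: "transpose V = V" and psd: "\<And>t. 0 \<le> t \<bullet> (V *v t)" and i: "V $ i $ i = 0"
  shows "V $ i $ j = 0"
proof (rule ccontr)
  assume n: "V $ i $ j \<noteq> 0"
  let ?c = "axis j 1 \<bullet> (V *v axis j 1)"
  have "0 \<le> ?c - 2 * s * (V $ i $ j)" for s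
    using psd[of "axis j 1 - s *\<^sub>R axis i 1"] unfolding quadratic_axis[OF sym] i
    by (simp add: inner_axis)
  \<comment> \<open>This s turns the affine expression into ?c - (?c + 1) = -1.\<close>
  from this[of "(?c + 1) / (2 * V $ i $ j)"] n show False by simp
qed

text \<open>Each step splits off a matrix \<open>w w\<^sup>T\<close>, which annihilates one row of \<open>V\<close>, and adds an
  independent Gaussian multiple of \<open>w\<close>.\<close>

lemma gaussian_exists:
  fixes V :: "real^'p^'p"
  assumes sym: "transpose V = V" and psd: "\<And>t. 0 \<le> t \<bullet> (V *v t)"
  shows "\<exists>N. mv_normal N 0 V"
  using assms
proof (induction "card {i. V $ i $ i \<noteq> 0}" arbitrary: V rule: less_induct)
  case less
  note sym = less.prems(1) and psd = less.prems(2)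
  show ?case
  proof (cases "\<exists>i. V $ i $ i \<noteq> 0")
    case False
    then have "V $ i $ j = 0" for i j using nonneg_quadratic_row_zero[OF sym psd] by blast
    then have V: "V = 0" by (simp add: vec_eq_iff)
    have "mv_normal (return borel (0 :: real^'p)) 0 V"
      unfolding mv_normal_def V
      by (auto simp: prob_space_return integral_return transpose_def vec_eq_iff)
    then show ?thesis by blast
  next
    case True
    then obtain i where i: "V $ i $ i \<noteq> 0" by blast
    have "0 \<le> V $ i $ i" using psd[of "axis i 1"] 
      by (simp add: inner_axis' matrix_vector_mult_basis column_def)
    with i have pos: "0 < V $ i $ i" by simp
    \<comment> \<open>Normalised so that w_i w_k = V_ik for all k; thus V' is the Schur complement
      of the entry (i,i).\<close>
    define w where "w = (1 / sqrt (V $ i $ i)) *\<^sub>R V $ i"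
    define V' where "V' = (\<chi> j k. V $ j $ k - w $ j * w $ k)"
    have q: "t \<bullet> (V' *v t) = t \<bullet> (V *v t) - (t \<bullet> w)\<^sup>2" for t
    proof -
      have "(t \<bullet> w)\<^sup>2 = (\<Sum>j\<in>UNIV. \<Sum>k\<in>UNIV. t $ j * (w $ j * w $ k) * t $ k)"
        by (simp add: inner_vec_def power2_eq_square sum_product mult_ac)
      then show ?thesis
        by (simp add: quadratic_form V'_def sum_subtractf algebra_simps)
    qed
    have w2: "(t \<bullet> w)\<^sup>2 = (V $ i \<bullet> t)\<^sup>2 / V $ i $ i" for t
      using pos by (simp add: w_def power_divide inner_commute)
    have symV: "V $ j $ k = V $ k $ j" for j k using sym by (metis transpose_def vec_lambda_beta)
    have sym': "transpose V' = V'"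
      by (simp add: transpose_def V'_def vec_eq_iff symV mult.commute)
    have psd': "0 \<le> t \<bullet> (V' *v t)" for t
    proof -
      \<comment> \<open>The form of V' at t is the minimum of the form of V over the line through t
        in direction i, attained at this point.\<close>
      have "t \<bullet> (V' *v t) = (t - ((V $ i \<bullet> t) / V $ i $ i) *\<^sub>R axis i 1) \<bullet> (V *v (t - ((V $ i \<bullet> t) / V $ i $ i) *\<^sub>R axis i 1))"
        unfolding quadratic_axis[OF sym] q w2 using pos by (simp add: power2_eq_square field_simps)
      then show ?thesis using psd by metis
    qed
    \<comment> \<open>The induction measure drops: row i is cleared, and where V has a zero on the
      diagonal the whole row vanishes, so w has no entry there.\<close>
    have "{j. V' $ j $ j \<noteq> 0} \<subset> {j. V $ j $ j \<noteq> 0}"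
    proof
      show "{j. V' $ j $ j \<noteq> 0} \<subseteq> {j. V $ j $ j \<noteq> 0}"
        using nonneg_quadratic_row_zero[OF sym psd] symV by (auto simp: V'_def w_def)
      have "V' $ i $ i = 0" using pos by (simp add: V'_def w_def)
      then show "{j. V' $ j $ j \<noteq> 0} \<noteq> {j. V $ j $ j \<noteq> 0}" using i by blast
    qed
    then have "card {j. V' $ j $ j \<noteq> 0} < card {j. V $ j $ j \<noteq> 0}" by (simp add: psubset_card_mono)
    from less.hyps[OF this sym' psd'] obtain N' where N': "mv_normal N' 0 V'" by blast
    then interpret N': prob_space N' by (simp add: mv_normal_def)
    have [measurable_cong]: "sets N' = sets borel" using N' by (simp add: mv_normal_def)
    interpret G: prob_space std_normal_distribution by (rule prob_space_normal_density) simp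
    interpret P: pair_prob_space N' std_normal_distribution ..
    let ?P = "N' \<Otimes>\<^sub>M std_normal_distribution"
    let ?f = "\<lambda>(x, g). x + g *\<^sub>R w"
    have f[measurable]: "?f \<in> borel_measurable ?P" by measurable
    have "mv_normal (distr ?P borel ?f) 0 V"
      unfolding mv_normal_def
    proof (intro conjI allI)
      show "prob_space (distr ?P borel ?f)" by (rule P.prob_space_distr) measurable
      show "sets (distr ?P borel ?f) = sets borel" by simp
      show "transpose V = V" by (rule sym)
      fix t :: "real^'p"
      have "(CLINT x|distr ?P borel ?f. iexp (t \<bullet> x)) = (CLINT p|?P. iexp (t \<bullet> fst p) * iexp ((t \<bullet> w) * snd p))"
        by (subst integral_distr) (auto simp: split_beta inner_add_right exp_add algebra_simps intro!: Bochner_Integration.integral_cong)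
      also have "\<dots> = (CLINT x|N'. CLINT g|std_normal_distribution. iexp (t \<bullet> x) * iexp ((t \<bullet> w) * g))"
      proof -
        have "complex_integrable ?P (\<lambda>p. iexp (t \<bullet> fst p) * iexp ((t \<bullet> w) * snd p))"
          by (rule P.integrable_const_bound[of _ 1]) (auto simp: norm_mult simp del: of_real_mult)
        from P.integral_fst'[OF this] show ?thesis by simp
      qed
      also have "\<dots> = (CLINT x|N'. iexp (t \<bullet> x)) * char std_normal_distribution (t \<bullet> w)"
        by (simp add: char_def)
      also have "\<dots> = of_real (exp (- (t \<bullet> (V' *v t)) / 2)) * of_real (exp (- ((t \<bullet> w)\<^sup>2) / 2))"
        using N' by (simp add: mv_normal_def char_std_normal_distribution)
      also have "\<dots> = of_real (exp (- (t \<bullet> (V *v t)) / 2))"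
        by (simp add: q exp_add[symmetric] diff_divide_distrib flip: of_real_mult)
      finally show "(CLINT x|distr ?P borel ?f. iexp (t \<bullet> x)) = iexp (t \<bullet> 0) * of_real (exp (- (t \<bullet> (V *v t)) / 2))"
        by simp
    qed
    then show ?thesis by blast
  qed
qed

section \<open>Regular variation\<close>

text \<open>On the compact extended line such a map is a homeomorphism onto its image, so distances
  to closed sets can be measured in the reals. It is arctan, extended by its limits.\<close>

lemma ereal_embedding:
  obtains \<phi> :: "ereal \<Rightarrow> real" where "continuous_on UNIV \<phi>" "inj \<phi>"
proof
  define \<phi> where "\<phi> x = (if x = \<infinity> then pi / 2 else if x = -\<infinity> then - (pi / 2) else arctan (real_of_ereal x))" for x
  have r: "(\<lambda>r. \<phi> (ereal r)) = arctan" and p: "\<phi> \<infinity> = pi / 2" and m: "\<phi> (-\<infinity>) = - (pi / 2)"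
    by (auto simp: \<phi>_def)
  have "isCont \<phi> x" for x
  proof (cases x)
    case (real r)
    have "(arctan \<longlongrightarrow> arctan r) (at r)" using isCont_arctan isCont_def by blast
    then have "(\<phi> \<longlongrightarrow> \<phi> (ereal r)) (at (ereal r))"
      unfolding at_ereal filterlim_filtermap r fun_cong[OF r] .
    then show ?thesis by (simp add: isCont_def real)
  next
    case PInf
    have "at (\<infinity>::ereal) = at_left \<infinity>"
      unfolding at_within_def by (rule arg_cong[where f = "\<lambda>S. inf (nhds \<infinity>) (principal S)"]) auto
    then have "(\<phi> \<longlongrightarrow> \<phi> \<infinity>) (at \<infinity>)"
      using tendsto_arctan_at_top by (simp add: p at_left_PInf filterlim_filtermap r)
    then show ?thesis by (simp add: isCont_def PInf)
  next
    case MInf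
    have "at (-\<infinity>::ereal) = at_right (-\<infinity>)"
      unfolding at_within_def by (rule arg_cong[where f = "\<lambda>S. inf (nhds (-\<infinity>)) (principal S)"]) auto
    then have "(\<phi> \<longlongrightarrow> \<phi> (-\<infinity>)) (at (-\<infinity>))"
      using tendsto_arctan_at_bot by (simp add: m at_right_MInf filterlim_filtermap r)
    then show ?thesis by (simp add: isCont_def MInf)
  qed
  then show "continuous_on UNIV \<phi>" by (simp add: continuous_at_imp_continuous_on)
  have b: "- (pi / 2) < \<phi> (ereal r)" "\<phi> (ereal r) < pi / 2" for r
    using fun_cong[OF r] arctan_lbound arctan_ubound by auto
  show "inj \<phi>"
  proof (rule injI)
    fix x y assume xy: "\<phi> x = \<phi> y"
    show "x = y"
      using xy b[of "real_of_ereal x"] b[of "real_of_ereal y"] pi_gt_zero fun_cong[OF r]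
      by (cases x; cases y) (auto simp: p m arctan_eq_iff)
  qed
qed

text \<open>Ramps of slope k in the distance to the image of C. That image is closed by compactness,
  hence a point off C has positive distance and is eventually sent to 0.\<close>

lemma closed_ereal_approx:
  fixes C :: "ereal set"
  assumes C: "closed C"
  shows "\<exists>F :: nat \<Rightarrow> ereal \<Rightarrow> real. \<forall>k. continuous_on UNIV (F k) \<and>
    (\<forall>x. 0 \<le> F k x \<and> F k x \<le> 1 \<and> (x \<in> C \<longrightarrow> F k x = 1) \<and> (x \<notin> C \<longrightarrow> (\<lambda>k. F k x) \<longlonglongrightarrow> 0))"
proof (cases "C = {}")
  case True
  show ?thesis by (rule exI[of _ "\<lambda>_ _. 0"]) (auto simp: True)
next
  case False
  obtain \<phi> :: "ereal \<Rightarrow> real" where \<phi>: "continuous_on UNIV \<phi>" "inj \<phi>" by (rule ereal_embedding)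
  have "compact C" using compact_Int_closed[OF compact_UNIV C] by simp
  then have cl: "closed (\<phi> ` C)"
    by (intro compact_imp_closed compact_continuous_image continuous_on_subset[OF \<phi>(1)]) auto
  show ?thesis
  proof (intro exI[of _ "\<lambda>k x. max 0 (1 - real k * infdist (\<phi> x) (\<phi> ` C))"] allI conjI impI)
    fix k :: nat show "continuous_on UNIV (\<lambda>x. max 0 (1 - real k * infdist (\<phi> x) (\<phi> ` C)))"
      by (intro continuous_intros \<phi>)
  next
    fix x assume x: "x \<notin> C"
    then have "\<phi> x \<notin> \<phi> ` C" using \<phi>(2) by (auto dest: injD)
    then have "infdist (\<phi> x) (\<phi> ` C) \<noteq> 0" using in_closed_iff_infdist_zero[OF cl] False by auto
    then have pos: "0 < infdist (\<phi> x) (\<phi> ` C)" using infdist_nonneg[of "\<phi> x" "\<phi> ` C"] by simp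
    obtain n where n: "1 / infdist (\<phi> x) (\<phi> ` C) < real n" using reals_Archimedean2 by blast
    have "\<forall>\<^sub>F k in sequentially. max 0 (1 - real k * infdist (\<phi> x) (\<phi> ` C)) = 0"
      using eventually_ge_at_top[of n]
    proof eventually_elim
      case (elim k)
      have "1 < real n * infdist (\<phi> x) (\<phi> ` C)" using n pos by (simp add: divide_less_eq)
      also have "\<dots> \<le> real k * infdist (\<phi> x) (\<phi> ` C)" using elim pos by simp
      finally show ?case by simp
    qed
    then show "(\<lambda>k. max 0 (1 - real k * infdist (\<phi> x) (\<phi> ` C))) \<longlonglongrightarrow> 0"
      by (rule tendsto_eventually)
  qed (auto simp: infdist_nonneg)
qed

text \<open>Vanishing near 0 takes the place of compact support: in the punctured product of
  extended lines, a single coordinate bounded away from 0 confines a point to a compact set. The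
  infinite points are not cut off.\<close>

definition test_fun :: "real \<Rightarrow> (ereal \<Rightarrow> real) \<Rightarrow> bool" where
  "test_fun e f \<longleftrightarrow> continuous_on UNIV f \<and> (\<forall>x. 0 \<le> f x \<and> f x \<le> 1) \<and> (\<forall>x. \<bar>x\<bar> < ereal e \<longrightarrow> f x = 0)"

lemma test_fun_measurable: "test_fun e f \<Longrightarrow> f \<in> borel_measurable borel"
  unfolding test_fun_def by (auto intro: borel_measurable_continuous_onI)

lemma ereal_cutoff:
  assumes e: "0 < e"
  obtains \<theta> :: "ereal \<Rightarrow> real" where "test_fun (e / 2) \<theta>" "\<And>x. ereal e \<le> \<bar>x\<bar> \<Longrightarrow> \<theta> x = 1"
proof
  \<comment> \<open>Truncation at e keeps the value finite even at the infinite points, so passing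
    to the reals is continuous. The function 2 c - 1 is then negative for |x| < e / 2 and equals 1
    for |x| >= e.\<close>
  define c where "c x = real_of_ereal (min \<bar>x\<bar> (ereal e)) / e" for x
  have fin: "\<bar>min \<bar>x\<bar> (ereal e)\<bar> \<noteq> \<infinity>" for x by (cases x) (auto simp: min_def)
  have c: "continuous_on UNIV c"
  proof -
    have "\<bar>x\<bar> = max x (- x)" for x :: ereal by (cases x) (auto simp: max_def)
    then have "continuous_on UNIV (\<lambda>x::ereal. min \<bar>x\<bar> (ereal e))"
      by (auto intro!: continuous_intros continuous_on_min continuous_on_max continuous_uminus_ereal)
    then have "continuous_on UNIV (\<lambda>x::ereal. real_of_ereal (min \<bar>x\<bar> (ereal e)))"
    proof (rule continuous_on_compose2[of "{x. \<bar>x\<bar> \<noteq> \<infinity>}" real_of_ereal UNIV, rotated])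
      show "continuous_on {x. \<bar>x\<bar> \<noteq> \<infinity>} real_of_ereal"
        by (intro continuous_at_imp_continuous_on ballI continuous_at_of_ereal) (rule CollectD)
      show "(\<lambda>x. min \<bar>x\<bar> (ereal e)) ` UNIV \<subseteq> {x. \<bar>x\<bar> \<noteq> \<infinity>}"
        by (intro image_subsetI CollectI fin)
    qed
    then show ?thesis unfolding c_def using e by (intro continuous_intros) auto
  qed
  have small: "c x < 1/2" if "\<bar>x\<bar> < ereal (e / 2)" for x
    using that e by (cases x) (auto simp: c_def min_def divide_less_eq)
  have big: "c x = 1" if "ereal e \<le> \<bar>x\<bar>" for x
    using that e by (simp add: c_def min_def)
  show "test_fun (e / 2) (\<lambda>x. max 0 (min 1 (2 * c x - 1)))"
    unfolding test_fun_def using small by (auto intro!: continuous_intros c dest!: small)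
  show "max 0 (min 1 (2 * c x - 1)) = 1" if "ereal e \<le> \<bar>x\<bar>" for x using big[OF that] by simp
qed

text \<open>The upper functions decrease to the closure of A, the lower ones come from the
  complement of the interior. Their difference tends to a multiple of the indicator of the frontier,
  a null set; finite mass of tails permits dominated convergence.\<close>

lemma continuity_set_sandwich:
  assumes A: "continuity_set \<nu> A" and \<nu>: "sets \<nu> = sets borel"
    and fin: "\<And>e. 0 < e \<Longrightarrow> emeasure \<nu> {x. ereal e \<le> \<bar>x\<bar>} < \<infinity>" and \<delta>: "0 < \<delta>"
  obtains e f g where "0 < e" "test_fun e f" "test_fun e g" "\<And>x. g x \<le> indicator A x" "\<And>x. indicator A x \<le> f x"
    "(LINT x|\<nu>. f x - g x) < \<delta>"
proof -
  note [measurable_cong] = \<nu>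
  obtain e where e: "0 < e" "\<And>x. x \<in> A \<Longrightarrow> ereal e \<le> \<bar>x\<bar>" and fr: "emeasure \<nu> (frontier A) = 0"
    using A by (auto simp: continuity_set_def)
  obtain \<theta> where \<theta>: "test_fun (e / 2) \<theta>" "\<And>x. ereal e \<le> \<bar>x\<bar> \<Longrightarrow> \<theta> x = 1" using ereal_cutoff[OF e(1)] by metis
  from closed_ereal_approx[OF closed_closure[of A]] obtain F :: "nat \<Rightarrow> ereal \<Rightarrow> real" where
    F: "\<forall>k. continuous_on UNIV (F k) \<and> (\<forall>x. 0 \<le> F k x \<and> F k x \<le> 1 \<and> (x \<in> closure A \<longrightarrow> F k x = 1)
      \<and> (x \<notin> closure A \<longrightarrow> (\<lambda>k. F k x) \<longlonglongrightarrow> 0))" ..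
  from closed_ereal_approx[OF closed_Compl[OF open_interior[of A]]] obtain G :: "nat \<Rightarrow> ereal \<Rightarrow> real" where
    G: "\<forall>k. continuous_on UNIV (G k) \<and> (\<forall>x. 0 \<le> G k x \<and> G k x \<le> 1 \<and> (x \<in> - interior A \<longrightarrow> G k x = 1)
      \<and> (x \<notin> - interior A \<longrightarrow> (\<lambda>k. G k x) \<longlonglongrightarrow> 0))" ..
  define f where "f k x = \<theta> x * F k x" for k x
  define g where "g k x = \<theta> x * (1 - G k x)" for k x
  have \<theta>': "0 \<le> \<theta> x" "\<theta> x \<le> 1" "\<bar>x\<bar> < ereal (e / 2) \<Longrightarrow> \<theta> x = 0" for x
    using \<theta>(1) by (auto simp: test_fun_def)
  have c: "continuous_on UNIV \<theta>" using \<theta>(1) by (auto simp: test_fun_def)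
  have tf: "test_fun (e / 2) (f k)" for k
    unfolding test_fun_def f_def using F \<theta>' by (auto intro!: continuous_intros c mult_le_one)
  have tg: "test_fun (e / 2) (g k)" for k
    unfolding test_fun_def g_def using G \<theta>' by (auto intro!: continuous_intros c mult_le_one)
  have gA: "g k x \<le> indicator A x" for k x
  proof (cases "x \<in> A")
    case True then show ?thesis using tg[of k] by (auto simp: test_fun_def)
  next
    case False then have "x \<in> - interior A" using interior_subset by auto
    then show ?thesis using False by (simp add: g_def G)
  qed
  have fA: "indicator A x \<le> f k x" for k x
  proof (cases "x \<in> A")
    case True then have "F k x = 1" using F closure_subset by blast
    then show ?thesis using True \<theta>(2)[OF e(2)[OF True]] by (simp add: f_def)
  next
    case False then show ?thesis using tf[of k] by (auto simp: test_fun_def)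
  qed
  have "(\<lambda>k. LINT x|\<nu>. f k x - g k x) \<longlonglongrightarrow> (LINT x|\<nu>. \<theta> x * indicator (frontier A) x)"
  proof (rule integral_dominated_convergence[where w = "indicator {x. ereal (e / 2) \<le> \<bar>x\<bar>}"])
    show "integrable \<nu> (indicator {x. ereal (e / 2) \<le> \<bar>x\<bar>} :: ereal \<Rightarrow> real)"
      using fin[of "e / 2"] e by (intro integrable_real_indicator) auto
    show "AE x in \<nu>. (\<lambda>k. f k x - g k x) \<longlonglongrightarrow> \<theta> x * indicator (frontier A) x"
    proof (rule AE_I2)
      fix x
      have "(\<lambda>k. F k x) \<longlonglongrightarrow> indicator (closure A) x"
        by (cases "x \<in> closure A") (auto simp: F)
      moreover have "(\<lambda>k. G k x) \<longlonglongrightarrow> indicator (- interior A) x"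
        by (cases "x \<in> interior A") (auto simp: G)
      ultimately have "(\<lambda>k. f k x - g k x) \<longlonglongrightarrow> \<theta> x * indicator (closure A) x - \<theta> x * (1 - indicator (- interior A) x)"
        unfolding f_def g_def by (intro tendsto_intros)
      moreover have "\<theta> x * indicator (closure A) x - \<theta> x * (1 - indicator (- interior A) x) = \<theta> x * indicator (frontier A) x"
        using interior_subset[of A] closure_subset[of A] by (auto simp: frontier_def indicator_def)
      ultimately show "(\<lambda>k. f k x - g k x) \<longlonglongrightarrow> \<theta> x * indicator (frontier A) x" by simp
    qed
    show "AE x in \<nu>. norm (f k x - g k x) \<le> indicator {x. ereal (e / 2) \<le> \<bar>x\<bar>} x" for k
    proof (rule AE_I2)
      fix x
      have "0 \<le> f k x" "f k x \<le> 1" "0 \<le> g k x" "g k x \<le> 1" using tf[of k] tg[of k] by (auto simp: test_fun_def)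
      moreover have "f k x = 0" "g k x = 0" if "\<bar>x\<bar> < ereal (e / 2)"
        using tf[of k] tg[of k] that by (auto simp: test_fun_def)
      ultimately show "norm (f k x - g k x) \<le> indicator {x. ereal (e / 2) \<le> \<bar>x\<bar>} x"
        by (cases "\<bar>x\<bar> < ereal (e / 2)") (auto simp: indicator_def not_less)
    qed
    have "f k \<in> borel_measurable \<nu>" "g k \<in> borel_measurable \<nu>" for k
      using test_fun_measurable[OF tf] test_fun_measurable[OF tg] by (simp_all add: measurable_cong_sets[OF \<nu> refl])
    then show "(\<lambda>x. f k x - g k x) \<in> borel_measurable \<nu>" for k by (intro borel_measurable_diff)
    have "\<theta> \<in> borel_measurable \<nu>" "indicator (frontier A) \<in> borel_measurable \<nu>"
      using test_fun_measurable[OF \<theta>(1)] by (simp_all add: measurable_cong_sets[OF \<nu> refl] borel_closed)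
    then show "(\<lambda>x. \<theta> x * indicator (frontier A) x) \<in> borel_measurable \<nu>" by (intro borel_measurable_times)
  qed
  moreover have "(LINT x|\<nu>. \<theta> x * indicator (frontier A) x) = 0"
  proof (rule integral_eq_zero_AE)
    have "AE x in \<nu>. x \<notin> frontier A"
      by (rule AE_I[where N = "frontier A"]) (auto simp: fr \<nu> borel_closed)
    then show "AE x in \<nu>. \<theta> x * indicator (frontier A) x = 0" by eventually_elim simp
  qed
  ultimately have "(\<lambda>k. LINT x|\<nu>. f k x - g k x) \<longlonglongrightarrow> 0" by simp
  from order_tendstoD(2)[OF this \<delta>] obtain k where "(LINT x|\<nu>. f k x - g k x) < \<delta>"
    by (auto simp: eventually_sequentially)
  then show ?thesis using that[of "e / 2" "f k" "g k"] e tf tg gA fA by simp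
qed

lemma continuous_map_borel_measurable:
  fixes f :: "'a \<Rightarrow> 'b::topological_space"
  assumes T: "radon_measure_on T \<nu>" and f: "continuous_map T euclidean f"
  shows "f \<in> borel_measurable \<nu>"
proof (rule borel_measurableI)
  fix S :: "'b set" assume "open S"
  then have "openin T {x \<in> topspace T. f x \<in> S}"
    using openin_continuous_map_preimage[OF f, of S] by simp
  moreover have "f -` S \<inter> space \<nu> = {x \<in> topspace T. f x \<in> S}"
    using T by (auto simp: radon_measure_on_def)
  ultimately show "f -` S \<inter> space \<nu> \<in> sets \<nu>"
    using T by (auto simp: radon_measure_on_def intro: sigma_sets.Basic)
qed

lemma coordinate_continuous_map: "s \<in> I \<Longrightarrow> continuous_map (punctured I) euclidean (\<lambda>y. y s)"
  unfolding punctured_def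
  using continuous_map_product_projection[of s I "\<lambda>_. euclidean"]
  by (auto intro: continuous_map_from_subtopology)

lemma topspace_punctured: "topspace (punctured I) = (I \<rightarrow>\<^sub>E UNIV) - {\<lambda>s\<in>I. 0}"
  by (auto simp: punctured_def)

text \<open>The product of extended lines is compact by Tychonoff, and the closed set in question
  misses the origin, so it stays compact after puncturing. This is the gain from working on the
  compactified line.\<close>

lemma compactin_coordinate_tail:
  assumes s: "s \<in> I" and e: "0 < e"
  shows "compactin (punctured I) {y \<in> topspace (punctured I). ereal e \<le> \<bar>y s\<bar>}"
proof -
  let ?T = "product_topology (\<lambda>_. euclidean :: ereal topology) I"
  have "ereal e \<le> \<bar>x\<bar> \<longleftrightarrow> ereal e \<le> x \<or> x \<le> - ereal e" for x
    using e by (cases x) auto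
  then have "{x::ereal. ereal e \<le> \<bar>x\<bar>} = {x. ereal e \<le> x} \<union> {x. x \<le> - ereal e}" by auto
  then have "closedin euclidean {x::ereal. ereal e \<le> \<bar>x\<bar>}"
    by (simp add: closed_Un closed_Collect_le continuous_on_const)
  from closedin_continuous_map_preimage[OF continuous_map_product_projection[OF s] this]
  have "closedin ?T {y \<in> topspace ?T. ereal e \<le> \<bar>y s\<bar>}" by simp
  moreover have "compact_space (euclidean :: ereal topology)" by (simp add: compact_space_def compact_UNIV)
  then have "compact_space ?T" by (simp add: compact_space_product_topology)
  ultimately have "compactin ?T {y \<in> topspace ?T. ereal e \<le> \<bar>y s\<bar>}" by (rule closedin_compact_space[rotated])
  moreover have "{y \<in> topspace ?T. ereal e \<le> \<bar>y s\<bar>} = {y \<in> topspace (punctured I). ereal e \<le> \<bar>y s\<bar>}"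
    using s e by (auto simp: punctured_def)
  ultimately show ?thesis
    by (auto simp: punctured_def compactin_subtopology)
qed

lemma integral_scale_measure_nonneg:
  fixes f :: "'a \<Rightarrow> real"
  assumes [measurable]: "f \<in> borel_measurable M" and f: "\<And>x. 0 \<le> f x" and c: "0 \<le> c"
  shows "(LINT x|scale_measure (ennreal c) M. f x) = c * (LINT x|M. f x)"
proof -
  have m: "f \<in> borel_measurable (scale_measure (ennreal c) M)" by simp
  have "(LINT x|scale_measure (ennreal c) M. f x) = enn2real (ennreal c * (\<integral>\<^sup>+x. ennreal (f x) \<partial>M))"
    using integral_eq_nn_integral[OF m] f by (simp add: nn_integral_scale_measure)
  also have "\<dots> = c * enn2real (\<integral>\<^sup>+x. ennreal (f x) \<partial>M)"
    using c by (simp add: enn2real_mult)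
  also have "enn2real (\<integral>\<^sup>+x. ennreal (f x) \<partial>M) = (LINT x|M. f x)"
    using integral_eq_nn_integral[of f M] f by simp
  finally show ?thesis .
qed

section \<open>Limits of scaled probabilities of a stationary regularly varying field\<close>

locale rv_field = prob_space M for M :: "'w measure" +
  fixes X :: "real^'d::finite \<Rightarrow> 'w \<Rightarrow> real" and a :: "nat \<Rightarrow> real"
    and \<mu> :: "(real^'d) set \<Rightarrow> (real^'d \<Rightarrow> ereal) measure"
  assumes meas: "\<forall>s. X s \<in> borel_measurable M"
    and stat: "strictly_stationary M X"
    and regvar: "regularly_varying M X a \<mu>"
begin

lemma X_measurable[measurable]: "X s \<in> borel_measurable M" using meas by blast

lemma stationary_expectation:
  fixes \<Psi> :: "(real^'d \<Rightarrow> real) \<Rightarrow> real"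
  assumes I: "finite I" and [measurable]: "\<Psi> \<in> borel_measurable (Pi\<^sub>M I (\<lambda>_. borel))"
  shows "expectation (\<lambda>\<omega>. \<Psi> (\<lambda>s\<in>I. X (s + u) \<omega>)) = expectation (\<lambda>\<omega>. \<Psi> (\<lambda>s\<in>I. X s \<omega>))"
proof -
  have "expectation (\<lambda>\<omega>. \<Psi> (\<lambda>s\<in>I. X (s + u) \<omega>)) = (LINT y|distr M (Pi\<^sub>M I (\<lambda>_. borel)) (\<lambda>\<omega>. \<lambda>s\<in>I. X (s + u) \<omega>). \<Psi> y)"
    by (subst integral_distr) auto
  also have "\<dots> = (LINT y|distr M (Pi\<^sub>M I (\<lambda>_. borel)) (\<lambda>\<omega>. \<lambda>s\<in>I. X s \<omega>). \<Psi> y)"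
    using stat I by (simp add: strictly_stationary_def)
  also have "\<dots> = expectation (\<lambda>\<omega>. \<Psi> (\<lambda>s\<in>I. X s \<omega>))"
    by (subst integral_distr) auto
  finally show ?thesis .
qed

lemma radon: "finite I \<Longrightarrow> I \<noteq> {} \<Longrightarrow> radon_measure_on (punctured I) (\<mu> I)"
  using regvar by (simp add: regularly_varying_def)

lemma space_mu: "finite I \<Longrightarrow> I \<noteq> {} \<Longrightarrow> space (\<mu> I) = topspace (punctured I)"
  using radon by (simp add: radon_measure_on_def)

lemma coordinate_measurable: "finite I \<Longrightarrow> s \<in> I \<Longrightarrow> (\<lambda>y. y s) \<in> borel_measurable (\<mu> I)"
  using continuous_map_borel_measurable[OF radon coordinate_continuous_map] by blast

lemma tail_finite:
  assumes "finite I" "s \<in> I" "0 < e"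
  shows "emeasure (\<mu> I) {y \<in> topspace (punctured I). ereal e \<le> \<bar>y s\<bar>} < \<infinity>"
  using radon[of I] assms compactin_coordinate_tail[of s I e] by (auto simp: radon_measure_on_def)

text \<open>One factor is enough for compact support, since the product vanishes wherever that
  coordinate is small. The factors are indexed by J and placed by \<sigma>, so several of them may
  sit at the same site.\<close>

lemma
  fixes f :: "'j \<Rightarrow> ereal \<Rightarrow> real"
  assumes I: "finite I" and J: "finite J" "J \<noteq> {}" and \<sigma>: "\<And>j. j \<in> J \<Longrightarrow> \<sigma> j \<in> I"
    and e: "0 < e" and f: "\<And>j. j \<in> J \<Longrightarrow> test_fun e (f j)"
  shows test_prod_integrable: "integrable (\<mu> I) (\<lambda>y. \<Prod>j\<in>J. f j (y (\<sigma> j)))"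
    and test_prod_limit: "(\<lambda>n. real n ^ CARD('d) * expectation (\<lambda>\<omega>. \<Prod>j\<in>J. f j (ereal (X (\<sigma> j) \<omega> / a n))))
      \<longlonglongrightarrow> (LINT y|\<mu> I. (\<Prod>j\<in>J. f j (y (\<sigma> j))))"
proof -
  let ?\<phi> = "\<lambda>y. \<Prod>j\<in>J. f j (y (\<sigma> j))"
  obtain k where k: "k \<in> J" using J by blast
  have I0: "I \<noteq> {}" using \<sigma>[OF k] by blast
  have f01: "0 \<le> f j x" "f j x \<le> 1" if "j \<in> J" for j x using f[OF that] by (auto simp: test_fun_def)
  have p0: "0 \<le> ?\<phi> y" for y using f01 by (auto intro: prod_nonneg)
  have p1: "?\<phi> y \<le> 1" for y using f01 by (auto intro: prod_le_1)
  let ?K = "{y \<in> topspace (punctured I). ereal e \<le> \<bar>y (\<sigma> k)\<bar>}"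
  have off: "?\<phi> y = 0" if "\<not> ereal e \<le> \<bar>y (\<sigma> k)\<bar>" for y
    using that k f[OF k] J(1) by (auto simp: test_fun_def not_le)
  have cont: "continuous_map (punctured I) euclideanreal ?\<phi>"
  proof (intro continuous_map_prod J)
    fix j assume j: "j \<in> J"
    have "continuous_map euclidean euclidean (f j)" using f[OF j] by (simp add: test_fun_def)
    from continuous_map_compose[OF coordinate_continuous_map[OF \<sigma>[OF j]] this]
    show "continuous_map (punctured I) euclideanreal (\<lambda>y. f j (y (\<sigma> j)))" by (simp add: o_def)
  qed
  have [measurable]: "?\<phi> \<in> borel_measurable (\<mu> I)"
    by (rule continuous_map_borel_measurable[OF radon[OF I I0] cont])
  have [measurable]: "(\<lambda>y. y (\<sigma> k)) \<in> borel_measurable (\<mu> I)" by (rule coordinate_measurable[OF I \<sigma>[OF k]])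
  have "{x::ereal. ereal e \<le> \<bar>x\<bar>} \<in> sets borel" by measurable
  from measurable_sets[OF coordinate_measurable[OF I \<sigma>[OF k]] this] have K: "?K \<in> sets (\<mu> I)"
    by (simp add: vimage_def Int_def space_mu[OF I I0] conj_commute)
  show "integrable (\<mu> I) ?\<phi>"
  proof (rule Bochner_Integration.integrable_bound[where f = "indicator ?K :: _ \<Rightarrow> real"])
    show "integrable (\<mu> I) (indicator ?K :: _ \<Rightarrow> real)"
      using tail_finite[OF I \<sigma>[OF k] e] K by (intro integrable_real_indicator) auto
    show "AE y in \<mu> I. norm (?\<phi> y) \<le> norm (indicator ?K y :: real)"
    proof (rule AE_I2)
      fix y assume "y \<in> space (\<mu> I)"
      then show "norm (?\<phi> y) \<le> norm (indicator ?K y :: real)"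
        using off[of y] p0[of y] p1[of y] by (cases "ereal e \<le> \<bar>y (\<sigma> k)\<bar>") (auto simp: space_mu[OF I I0])
    qed
  qed measurable
  have "(LINT y|scaled_law M X a I n. ?\<phi> y) = real n ^ CARD('d) * expectation (\<lambda>\<omega>. \<Prod>j\<in>J. f j (ereal (X (\<sigma> j) \<omega> / a n)))" for n
  proof -
    let ?P = "Pi\<^sub>M I (\<lambda>_. borel :: ereal measure)"
    let ?D = "distr M ?P (\<lambda>\<omega>. \<lambda>s\<in>I. ereal (X s \<omega> / a n))"
    have phi[measurable]: "?\<phi> \<in> borel_measurable ?P"
    proof (rule borel_measurable_prod)
      fix j assume j: "j \<in> J"
      show "(\<lambda>y. f j (y (\<sigma> j))) \<in> borel_measurable ?P"
        using test_fun_measurable[OF f[OF j]] measurable_component_singleton[OF \<sigma>[OF j], of "\<lambda>_. borel"]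
        by (rule measurable_compose[rotated])
    qed
    have "{\<lambda>s\<in>I. 0} = Pi\<^sub>E I (\<lambda>_. {0 :: ereal})" by auto
    also have "\<dots> \<in> sets ?P" by (rule sets_PiM_I_finite[OF I]) auto
    finally have "space ?P - {\<lambda>s\<in>I. 0} \<in> sets ?P" by blast
    then have \<Omega>: "topspace (punctured I) \<inter> space ?D \<in> sets ?D"
      by (simp add: topspace_punctured space_PiM Int_absorb2 Diff_subset)
    have "(LINT y|scaled_law M X a I n. ?\<phi> y) = real n ^ CARD('d) * (LINT y|restrict_space ?D (topspace (punctured I)). ?\<phi> y)"
      unfolding scaled_law_def using p0
      by (intro integral_scale_measure_nonneg) (auto intro!: measurable_restrict_space1)
    also have "(LINT y|restrict_space ?D (topspace (punctured I)). ?\<phi> y) = (LINT y|?D. indicator (topspace (punctured I)) y *\<^sub>R ?\<phi> y)"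
      by (rule integral_restrict_space[OF \<Omega>])
    \<comment> \<open>Restricting to the punctured space removes only the origin, where the product
      is 0.\<close>
    also have "\<dots> = (LINT y|?D. ?\<phi> y)"
    proof (rule Bochner_Integration.integral_cong)
      fix y assume y: "y \<in> space ?D"
      show "indicator (topspace (punctured I)) y *\<^sub>R ?\<phi> y = ?\<phi> y"
      proof (cases "y \<in> topspace (punctured I)")
        case False
        then have "y (\<sigma> k) = 0" using y \<sigma>[OF k] by (auto simp: topspace_punctured space_PiM)
        then show ?thesis using off[of y] e by simp
      qed simp
    qed simp
    also have "\<dots> = expectation (\<lambda>\<omega>. ?\<phi> (\<lambda>s\<in>I. ereal (X s \<omega> / a n)))"
      by (rule integral_distr) auto
    also have "\<dots> = expectation (\<lambda>\<omega>. \<Prod>j\<in>J. f j (ereal (X (\<sigma> j) \<omega> / a n)))"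
      using \<sigma> by (intro Bochner_Integration.integral_cong refl prod.cong) auto
    finally show ?thesis .
  qed
  moreover have "(\<lambda>n. LINT y|scaled_law M X a I n. ?\<phi> y) \<longlonglongrightarrow> (LINT y|\<mu> I. ?\<phi> y)"
  proof -
    have "vaguely_converges (punctured I) (scaled_law M X a I) (\<mu> I)"
      using regvar I I0 by (simp add: regularly_varying_def)
    moreover have "compactin (punctured I) ?K" by (rule compactin_coordinate_tail[OF \<sigma>[OF k] e])
    ultimately show ?thesis using cont off unfolding vaguely_converges_def by blast
  qed
  ultimately show "(\<lambda>n. real n ^ CARD('d) * expectation (\<lambda>\<omega>. \<Prod>j\<in>J. f j (ereal (X (\<sigma> j) \<omega> / a n)))) \<longlonglongrightarrow> (LINT y|\<mu> I. ?\<phi> y)"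
    by simp
qed

lemma sets_mu0[simp]: "sets (mu0 \<mu>) = sets borel" by (simp add: mu0_def)

lemma mu0_tail_finite: "0 < e \<Longrightarrow> emeasure (mu0 \<mu>) {x. ereal e \<le> \<bar>x\<bar>} < \<infinity>"
proof -
  assume e: "0 < e"
  have [measurable]: "(\<lambda>y. y 0) \<in> borel_measurable (\<mu> {0})" by (rule coordinate_measurable) auto
  have "emeasure (mu0 \<mu>) {x. ereal e \<le> \<bar>x\<bar>} = emeasure (\<mu> {0}) ((\<lambda>y. y 0) -` {x. ereal e \<le> \<bar>x\<bar>} \<inter> space (\<mu> {0}))"
    unfolding mu0_def by (rule emeasure_distr) measurable
  also have "(\<lambda>y. y 0) -` {x. ereal e \<le> \<bar>x\<bar>} \<inter> space (\<mu> {0}) = {y \<in> topspace (punctured {0}). ereal e \<le> \<bar>y 0\<bar>}"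
    by (auto simp: space_mu)
  finally show ?thesis using tail_finite[of "{0}" 0 e] e by simp
qed

text \<open>Both sides are limits of the same sequence by stationarity. Hence \<open>mu0\<close>
  governs every coordinate of every \<mu> I, and boundary conditions on sets are needed in one
  dimension only.\<close>

lemma integral_coordinate:
  assumes I: "finite I" "s \<in> I" and e: "0 < e" and f: "test_fun e f"
  shows "(LINT y|\<mu> I. f (y s)) = (LINT x|mu0 \<mu>. f x)"
proof -
  have fm[measurable]: "f \<in> borel_measurable borel" by (rule test_fun_measurable[OF f])
  have 1: "(\<lambda>n. real n ^ CARD('d) * expectation (\<lambda>\<omega>. f (ereal (X s \<omega> / a n)))) \<longlonglongrightarrow> (LINT y|\<mu> I. f (y s))"
    using test_prod_limit[of I "{()}" "\<lambda>_. s" e "\<lambda>_. f"] assms by simp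
  have 2: "(\<lambda>n. real n ^ CARD('d) * expectation (\<lambda>\<omega>. f (ereal (X 0 \<omega> / a n)))) \<longlonglongrightarrow> (LINT y|\<mu> {0}. f (y 0))"
    using test_prod_limit[of "{0}" "{()}" "\<lambda>_. 0" e "\<lambda>_. f"] assms by simp
  have "expectation (\<lambda>\<omega>. f (ereal (X s \<omega> / a n))) = expectation (\<lambda>\<omega>. f (ereal (X 0 \<omega> / a n)))" for n
    using stationary_expectation[of "{0}" "\<lambda>y. f (ereal (y 0 / a n))" s] by simp
  then have "(LINT y|\<mu> I. f (y s)) = (LINT y|\<mu> {0}. f (y 0))"
    using LIMSEQ_unique[OF 1] 2 by simp
  also have "\<dots> = (LINT x|mu0 \<mu>. f x)"
    unfolding mu0_def by (rule integral_distr[symmetric, OF coordinate_measurable fm]) auto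
  finally show ?thesis .
qed

lemma test_fun_mono: "test_fun e f \<Longrightarrow> e' \<le> e \<Longrightarrow> test_fun e' f"
  unfolding test_fun_def by (meson ereal_less_eq(3) order_less_le_trans)

text \<open>A portmanteau statement for rectangles. Products of the one-dimensional sandwiching
  functions enclose the indicator, and their gap is at most the sum of the one-dimensional gaps; no
  boundary in the product space has to be analysed.\<close>

lemma rv_limit:
  assumes I: "finite I" and J: "finite J" "J \<noteq> {}" and \<sigma>: "\<And>j. j \<in> J \<Longrightarrow> \<sigma> j \<in> I"
    and C: "\<And>j. j \<in> J \<Longrightarrow> continuity_set (mu0 \<mu>) (C j)"
  shows "(\<lambda>n. real n ^ CARD('d) * \<P>(\<omega> in M. \<forall>j\<in>J. ereal (X (\<sigma> j) \<omega> / a n) \<in> C j))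
    \<longlonglongrightarrow> measure (\<mu> I) {y \<in> topspace (punctured I). \<forall>j\<in>J. y (\<sigma> j) \<in> C j}"
proof (rule LIMSEQ_I)
  fix \<delta> :: real assume \<delta>: "0 < \<delta>"
  have I0: "I \<noteq> {}" using J \<sigma> by blast
  \<comment> \<open>The card J gaps then add up to \<delta> / 2; the other half is left for the
    vague convergence.\<close>
  define \<eta> where "\<eta> = \<delta> / (2 * card J)"
  have cJ: "0 < card J" using J by (simp add: card_gt_0_iff)
  have \<eta>: "0 < \<eta>" using \<delta> cJ by (simp add: \<eta>_def)
  have "\<forall>j\<in>J. \<exists>efg. case efg of (e, f, g) \<Rightarrow> 0 < e \<and> test_fun e f \<and> test_fun e g \<and> (\<forall>x. g x \<le> indicator (C j) x)
    \<and> (\<forall>x. indicator (C j) x \<le> f x) \<and> (LINT x|mu0 \<mu>. f x - g x) < \<eta>"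
  proof
    fix j assume j: "j \<in> J"
    show "\<exists>efg. case efg of (e, f, g) \<Rightarrow> 0 < e \<and> test_fun e f \<and> test_fun e g \<and> (\<forall>x. g x \<le> indicator (C j) x)
      \<and> (\<forall>x. indicator (C j) x \<le> f x) \<and> (LINT x|mu0 \<mu>. f x - g x) < \<eta>"
    proof (rule continuity_set_sandwich[OF C[OF j] sets_mu0 mu0_tail_finite \<eta>])
      fix e f g assume "0 < e" "test_fun e f" "test_fun e g" "\<And>x. g x \<le> indicator (C j) x" "\<And>x. indicator (C j) x \<le> f x"
        "(LINT x|mu0 \<mu>. f x - g x) < \<eta>"
      then show ?thesis by (intro exI[of _ "(e, f, g)"]) simp
    qed
  qed
  then obtain efg where efg: "\<forall>j\<in>J. case efg j of (e, f, g) \<Rightarrow> 0 < e \<and> test_fun e f \<and> test_fun e g \<and> (\<forall>x. g x \<le> indicator (C j) x)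
    \<and> (\<forall>x. indicator (C j) x \<le> f x) \<and> (LINT x|mu0 \<mu>. f x - g x) < \<eta>"
    by (rule bchoice[THEN exE])
  define e f g where "e j = fst (efg j)" and "f j = fst (snd (efg j))" and "g j = snd (snd (efg j))" for j
  have fg: "0 < e j" "test_fun (e j) (f j)" "test_fun (e j) (g j)" "\<And>x. g j x \<le> indicator (C j) x"
     "\<And>x. indicator (C j) x \<le> f j x" "(LINT x|mu0 \<mu>. f j x - g j x) < \<eta>" if "j \<in> J" for j
    using bspec[OF efg that] by (simp_all add: e_def f_def g_def split_beta)
  \<comment> \<open>The factors are required to vanish on a common neighbourhood of 0.\<close>
  define e0 where "e0 = Min (e ` J)"
  have e0: "0 < e0" using J fg(1) by (simp add: e0_def)
  have le: "e0 \<le> e j" if "j \<in> J" for j using J that by (simp add: e0_def)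
  have tf: "test_fun e0 (f j)" and tg: "test_fun e0 (g j)" if "j \<in> J" for j
    using test_fun_mono[OF fg(2) le] test_fun_mono[OF fg(3) le] that by auto
  have fg01: "0 \<le> f j x" "f j x \<le> 1" "0 \<le> g j x" "g j x \<le> 1" if "j \<in> J" for j x
    using tf[OF that] tg[OF that] by (auto simp: test_fun_def)
  let ?S = "{y \<in> topspace (punctured I). \<forall>j\<in>J. y (\<sigma> j) \<in> C j}"
  let ?F = "\<lambda>y. \<Prod>j\<in>J. f j (y (\<sigma> j))" and ?G = "\<lambda>y. \<Prod>j\<in>J. g j (y (\<sigma> j))"
  have GI: "(\<Prod>j\<in>J. g j (z j)) \<le> of_bool (\<forall>j\<in>J. z j \<in> C j)" for z
  proof (cases "\<forall>j\<in>J. z j \<in> C j")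
    case True then show ?thesis using fg01 by (auto intro!: prod_le_1)
  next
    case False
    then obtain j where j: "j \<in> J" "z j \<notin> C j" by blast
    then have "g j (z j) = 0" using fg(4)[OF j(1), of "z j"] fg01(3)[OF j(1), of "z j"] by simp
    then have "(\<Prod>j\<in>J. g j (z j)) = 0" using j(1) by (intro prod_zero[OF J(1)]) blast
    then show ?thesis by simp
  qed
  have IF: "of_bool (\<forall>j\<in>J. z j \<in> C j) \<le> (\<Prod>j\<in>J. f j (z j))" for z
  proof (cases "\<forall>j\<in>J. z j \<in> C j")
    case True
    then have "f j (z j) = 1" if "j \<in> J" for j
      using fg(5)[OF that, of "z j"] fg01(2)[OF that, of "z j"] that by simp
    then show ?thesis by simp
  next
    case False then show ?thesis using fg01 by (auto intro!: prod_nonneg)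
  qed
  have Cb: "C j \<in> sets borel" if "j \<in> J" for j using C[OF that] by (simp add: continuity_set_def)
  have sp: "space (\<mu> I) = topspace (punctured I)" by (rule space_mu[OF I I0])
  have Sm: "?S \<in> sets (\<mu> I)"
  proof -
    have "{y \<in> space (\<mu> I). \<forall>j\<in>J. y (\<sigma> j) \<in> C j} \<in> sets (\<mu> I)"
    proof (rule sets.sets_Collect_finite_All'[OF _ J])
      fix j assume j: "j \<in> J"
      show "{y \<in> space (\<mu> I). y (\<sigma> j) \<in> C j} \<in> sets (\<mu> I)"
        using measurable_sets[OF coordinate_measurable[OF I \<sigma>[OF j]] Cb[OF j]] by (simp add: vimage_def Int_def conj_commute)
    qed
    then show ?thesis by (simp add: sp)
  qed
  note iF = test_prod_integrable[OF I J \<sigma> e0 tf] and iG = test_prod_integrable[OF I J \<sigma> e0 tg]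
  have iS: "integrable (\<mu> I) (\<lambda>y. indicator ?S y :: real)"
  proof (rule Bochner_Integration.integrable_bound[OF iF])
    show "AE y in \<mu> I. norm (indicator ?S y :: real) \<le> norm (?F y)"
    proof (rule AE_I2)
      fix y show "norm (indicator ?S y :: real) \<le> norm (?F y)"
        using IF[of "\<lambda>j. y (\<sigma> j)"] by (auto simp: indicator_def)
    qed
  qed (use Sm in auto)
  have mS: "measure (\<mu> I) ?S = (LINT y|\<mu> I. indicator ?S y)" using Sm sets.sets_into_space[OF Sm] by (simp add: Int_absorb1 Int_absorb2)
  have lo: "(LINT y|\<mu> I. ?G y) \<le> measure (\<mu> I) ?S"
    unfolding mS
  proof (rule integral_mono[OF iG iS])
    fix y assume "y \<in> space (\<mu> I)"
    then show "?G y \<le> indicator ?S y" using GI[of "\<lambda>j. y (\<sigma> j)"] by (auto simp: indicator_def sp)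
  qed
  have hi: "measure (\<mu> I) ?S \<le> (LINT y|\<mu> I. ?F y)"
    unfolding mS
  proof (rule integral_mono[OF iS iF])
    fix y assume "y \<in> space (\<mu> I)"
    then show "indicator ?S y \<le> ?F y" using IF[of "\<lambda>j. y (\<sigma> j)"] by (auto simp: indicator_def sp)
  qed
  have sing: "integrable (\<mu> I) (\<lambda>y. h (y (\<sigma> j)))" if "j \<in> J" "test_fun e0 h" for j h
    using test_prod_integrable[of I "{()}" "\<lambda>_. \<sigma> j" e0 "\<lambda>_. h"] I \<sigma> that e0 by simp
  have m0: "integrable (mu0 \<mu>) h" if "test_fun e0 h" for h
  proof -
    have "integrable (\<mu> {0}) (\<lambda>y. h (y 0))"
      using test_prod_integrable[of "{0}" "{()}" "\<lambda>_. 0" e0 "\<lambda>_. h"] that e0 by simp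
    then show ?thesis
      unfolding mu0_def using test_fun_measurable[OF that] coordinate_measurable[of "{0}" 0] by (subst integrable_distr_eq) auto
  qed
  have gap: "(LINT y|\<mu> I. ?F y) - (LINT y|\<mu> I. ?G y) \<le> \<delta> / 2"
  proof -
    have "(LINT y|\<mu> I. ?F y) - (LINT y|\<mu> I. ?G y) = (LINT y|\<mu> I. ?F y - ?G y)" using iF iG by simp
    also have "\<dots> \<le> (LINT y|\<mu> I. (\<Sum>j\<in>J. f j (y (\<sigma> j)) - g j (y (\<sigma> j))))"
    proof (rule integral_mono)
      show "integrable (\<mu> I) (\<lambda>y. ?F y - ?G y)" using iF iG by simp
      show "integrable (\<mu> I) (\<lambda>y. \<Sum>j\<in>J. f j (y (\<sigma> j)) - g j (y (\<sigma> j)))"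
        using sing tf tg by (intro Bochner_Integration.integrable_sum Bochner_Integration.integrable_diff) auto
      fix y
      have "?F y - ?G y \<le> norm (?F y - ?G y)" by simp
      \<comment> \<open>Replacing one factor at a time: all other factors lie in [0,1] and do not
        enlarge the difference.\<close>
      also have "\<dots> \<le> (\<Sum>j\<in>J. norm (f j (y (\<sigma> j)) - g j (y (\<sigma> j))))"
        using fg01 by (intro norm_prod_diff) auto
      also have "\<dots> = (\<Sum>j\<in>J. f j (y (\<sigma> j)) - g j (y (\<sigma> j)))"
      proof (rule sum.cong[OF refl])
        fix j assume j: "j \<in> J"
        show "norm (f j (y (\<sigma> j)) - g j (y (\<sigma> j))) = f j (y (\<sigma> j)) - g j (y (\<sigma> j))"
          using order_trans[OF fg(4)[OF j] fg(5)[OF j]] by simp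
      qed
      finally show "?F y - ?G y \<le> (\<Sum>j\<in>J. f j (y (\<sigma> j)) - g j (y (\<sigma> j)))" .
    qed
    also have "\<dots> = (\<Sum>j\<in>J. (LINT y|\<mu> I. f j (y (\<sigma> j))) - (LINT y|\<mu> I. g j (y (\<sigma> j))))"
      using sing tf tg by (subst Bochner_Integration.integral_sum) (auto intro!: sum.cong Bochner_Integration.integral_diff)
    also have "\<dots> = (\<Sum>j\<in>J. (LINT x|mu0 \<mu>. f j x - g j x))"
      using integral_coordinate[OF I \<sigma> e0] tf tg m0 by (intro sum.cong refl) simp
    also have "\<dots> \<le> card J * \<eta>"
      using fg(6) by (intro sum_bounded_above) (auto intro: less_imp_le)
    also have "\<dots> = \<delta> / 2" using cJ by (simp add: \<eta>_def)
    finally show ?thesis .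
  qed
  have ev: "{\<omega>\<in>space M. \<forall>j\<in>J. ereal (X (\<sigma> j) \<omega> / a n) \<in> C j} \<in> events" for n
  proof (rule sets.sets_Collect_finite_All'[OF _ J])
    fix j assume "j \<in> J"
    then have [measurable]: "C j \<in> sets borel" by (rule Cb)
    show "{\<omega>\<in>space M. ereal (X (\<sigma> j) \<omega> / a n) \<in> C j} \<in> events" by measurable
  qed
  have iE: "integrable M (\<lambda>\<omega>. \<Prod>j\<in>J. h j (ereal (X (\<sigma> j) \<omega> / a n)))" if "\<And>j. j \<in> J \<Longrightarrow> test_fun e0 (h j)" for h n
  proof (rule integrable_const_bound[of _ 1])
    have "norm (\<Prod>j\<in>J. h j (ereal (X (\<sigma> j) \<omega> / a n))) \<le> 1" for \<omega>
      using that unfolding prod_norm[symmetric] by (intro prod_le_1) (auto simp: test_fun_def)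
    then show "AE \<omega> in M. norm (\<Prod>j\<in>J. h j (ereal (X (\<sigma> j) \<omega> / a n))) \<le> 1" by simp
    show "(\<lambda>\<omega>. \<Prod>j\<in>J. h j (ereal (X (\<sigma> j) \<omega> / a n))) \<in> borel_measurable M"
    proof (rule borel_measurable_prod)
      fix j assume "j \<in> J"
      then have [measurable]: "h j \<in> borel_measurable borel" using that test_fun_measurable by blast
      show "(\<lambda>\<omega>. h j (ereal (X (\<sigma> j) \<omega> / a n))) \<in> borel_measurable M" by measurable
    qed
  qed
  have PE: "\<P>(\<omega> in M. \<forall>j\<in>J. ereal (X (\<sigma> j) \<omega> / a n) \<in> C j) = expectation (\<lambda>\<omega>. of_bool (\<forall>j\<in>J. ereal (X (\<sigma> j) \<omega> / a n) \<in> C j))"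
    "integrable M (\<lambda>\<omega>. of_bool (\<forall>j\<in>J. ereal (X (\<sigma> j) \<omega> / a n) \<in> C j) :: real)" for n
  proof -
    have *: "integrable M (indicator {\<omega>\<in>space M. \<forall>j\<in>J. ereal (X (\<sigma> j) \<omega> / a n) \<in> C j} :: _ \<Rightarrow> real)"
      using ev by (intro integrable_real_indicator) (auto simp: emeasure_eq_measure)
    have **: "of_bool (\<forall>j\<in>J. ereal (X (\<sigma> j) \<omega> / a n) \<in> C j) = (indicator {\<omega>\<in>space M. \<forall>j\<in>J. ereal (X (\<sigma> j) \<omega> / a n) \<in> C j} \<omega> :: real)"
      if "\<omega> \<in> space M" for \<omega> using that by (simp add: indicator_def)
    show "\<P>(\<omega> in M. \<forall>j\<in>J. ereal (X (\<sigma> j) \<omega> / a n) \<in> C j) = expectation (\<lambda>\<omega>. of_bool (\<forall>j\<in>J. ereal (X (\<sigma> j) \<omega> / a n) \<in> C j))"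
      using ev[of n] by (subst Bochner_Integration.integral_cong[OF refl **]) (auto simp: Int_absorb2 sets.sets_into_space)
    show "integrable M (\<lambda>\<omega>. of_bool (\<forall>j\<in>J. ereal (X (\<sigma> j) \<omega> / a n) \<in> C j) :: real)"
      using * by (subst Bochner_Integration.integrable_cong[OF refl **]) auto
  qed
  let ?P = "\<lambda>n. real n ^ CARD('d) * \<P>(\<omega> in M. \<forall>j\<in>J. ereal (X (\<sigma> j) \<omega> / a n) \<in> C j)"
  let ?Fn = "\<lambda>n. real n ^ CARD('d) * expectation (\<lambda>\<omega>. \<Prod>j\<in>J. f j (ereal (X (\<sigma> j) \<omega> / a n)))"
  let ?Gn = "\<lambda>n. real n ^ CARD('d) * expectation (\<lambda>\<omega>. \<Prod>j\<in>J. g j (ereal (X (\<sigma> j) \<omega> / a n)))"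
  have P1: "?Gn n \<le> ?P n" for n
    unfolding PE(1) by (intro mult_left_mono integral_mono iE PE(2) GI tg) auto
  have P2: "?P n \<le> ?Fn n" for n
    unfolding PE(1) by (intro mult_left_mono integral_mono iE PE(2) IF tf) auto
  have "\<forall>\<^sub>F n in sequentially. ?Fn n < (LINT y|\<mu> I. ?F y) + \<delta> / 2"
    by (rule order_tendstoD(2)[OF test_prod_limit[OF I J \<sigma> e0 tf]]) (use \<delta> in auto)
  moreover have "\<forall>\<^sub>F n in sequentially. ?Gn n > (LINT y|\<mu> I. ?G y) - \<delta> / 2"
    by (rule order_tendstoD(1)[OF test_prod_limit[OF I J \<sigma> e0 tg]]) (use \<delta> in auto)
  ultimately have "\<forall>\<^sub>F n in sequentially. norm (?P n - measure (\<mu> I) ?S) < \<delta>"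
  proof eventually_elim
    case (elim n)
    then show ?case using P1[of n] P2[of n] gap lo hi unfolding real_norm_def abs_less_iff by linarith
  qed
  then show "\<exists>no. \<forall>n\<ge>no. norm (?P n - measure (\<mu> I) ?S) < \<delta>" by (simp add: eventually_sequentially)
qed

end

section \<open>Lattice geometry\<close>

context
  fixes nrm :: "real^'d::finite \<Rightarrow> real"
  assumes nrm: "is_norm nrm"
begin

lemma nrm_nonneg: "0 \<le> nrm x" and nrm_zero: "nrm 0 = 0" and nrm_triangle: "nrm (x + y) \<le> nrm x + nrm y"
  and nrm_scale: "nrm (c *\<^sub>R x) = \<bar>c\<bar> * nrm x" and nrm_eq_0: "nrm x = 0 \<longleftrightarrow> x = 0"
  using nrm by (auto simp: is_norm_def)

lemma nrm_minus: "nrm (- x) = nrm x" using nrm_scale[of "-1" x] by simp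

lemma nrm_minus_commute: "nrm (x - y) = nrm (y - x)" using nrm_minus[of "x - y"] by simp

lemma nrm_sum: "nrm (\<Sum>i\<in>I. f i) \<le> (\<Sum>i\<in>I. nrm (f i))"
  by (induction I rule: infinite_finite_induct) (auto simp: nrm_zero intro: order_trans[OF nrm_triangle])

lemma nrm_le_norm: "nrm x \<le> (\<Sum>i\<in>UNIV. nrm (axis i 1)) * norm x"
proof -
  have "nrm x = nrm (\<Sum>i\<in>UNIV. x $ i *\<^sub>R axis i 1)"
    using basis_expansion[of x] by (simp add: scalar_mult_eq_scaleR)
  also have "\<dots> \<le> (\<Sum>i\<in>UNIV. \<bar>x $ i\<bar> * nrm (axis i 1))"
    by (rule order_trans[OF nrm_sum]) (simp add: nrm_scale)
  also have "\<dots> \<le> (\<Sum>i\<in>UNIV. norm x * nrm (axis i 1))"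
    by (intro sum_mono mult_right_mono component_le_norm_cart nrm_nonneg)
  finally show ?thesis by (simp add: sum_distrib_left mult.commute)
qed

text \<open>Equivalence of norms: \<open>nrm\<close> is Lipschitz for the Euclidean norm, hence
  attains a positive minimum on the compact unit sphere.\<close>

lemma component_le_nrm: "\<exists>C>0. \<forall>x i. \<bar>x $ i\<bar> \<le> C * nrm x"
proof -
  define L where "L = (\<Sum>i\<in>UNIV. nrm (axis i 1 :: real^'d))"
  have L: "0 \<le> L" unfolding L_def by (intro sum_nonneg nrm_nonneg)
  have "L-lipschitz_on UNIV nrm"
  proof (rule lipschitz_onI[OF _ L])
    fix x y :: "real^'d"
    have "nrm x \<le> nrm (x - y) + nrm y" "nrm y \<le> nrm (y - x) + nrm x"
      using nrm_triangle[of "x - y" y] nrm_triangle[of "y - x" x] by auto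
    then have "\<bar>nrm x - nrm y\<bar> \<le> nrm (x - y)" using nrm_minus_commute[of x y] by linarith
    also have "\<dots> \<le> L * norm (x - y)" unfolding L_def by (rule nrm_le_norm)
    finally show "dist (nrm x) (nrm y) \<le> L * dist x y" by (simp add: dist_norm)
  qed
  then have cont: "continuous_on (sphere 0 1) nrm"
    by (rule continuous_on_subset[OF lipschitz_on_continuous_on]) simp
  have "axis undefined 1 \<in> sphere (0::real^'d) 1" by simp
  then have "sphere (0::real^'d) 1 \<noteq> {}" by blast
  from continuous_attains_inf[OF compact_sphere this cont] obtain x0 :: "real^'d" where
    x0: "norm x0 = 1" "\<And>x. norm x = 1 \<Longrightarrow> nrm x0 \<le> nrm x" by auto
  have c: "0 < nrm x0" using x0(1) nrm_nonneg[of x0] nrm_eq_0[of x0] by (cases "x0 = 0") auto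
  have "\<bar>x $ i\<bar> \<le> (1 / nrm x0) * nrm x" for x i
  proof (cases "x = 0")
    case False
    have "nrm x0 \<le> nrm ((1 / norm x) *\<^sub>R x)" using False by (intro x0(2)) simp
    also have "\<dots> = nrm x / norm x" using False by (simp add: nrm_scale)
    finally have "norm x * nrm x0 \<le> nrm x" using False by (simp add: pos_le_divide_eq mult.commute)
    then have "norm x \<le> nrm x / nrm x0" using c by (simp add: pos_le_divide_eq)
    then show ?thesis using component_le_norm_cart[of x i] by simp
  qed (simp add: nrm_zero)
  then show ?thesis using c by (intro exI[of _ "1 / nrm x0"]) auto
qed

text \<open>By equivalence of norms the ball lies in a box with 2 floor(C R) + 1 integers per
  coordinate, which is at most (2 C + 1) R as soon as R is at least 1. For small R the count does
  not go to 0, hence the restriction.\<close>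

lemma lattice_ball_card:
  obtains C where "0 < C" "\<And>R. finite {u \<in> Zd. nrm u \<le> R}"
    "\<And>R. 1 \<le> R \<Longrightarrow> real (card {u \<in> Zd. nrm u \<le> R}) \<le> C * R ^ CARD('d)"
proof -
  obtain C where C: "0 < C" "\<And>x i. \<bar>x $ i\<bar> \<le> C * nrm x" using component_le_nrm by blast
  define v :: "('d \<Rightarrow> int) \<Rightarrow> real^'d" where "v f = (\<chi> i. real_of_int (f i))" for f
  define B where "B R = (UNIV :: 'd set) \<rightarrow>\<^sub>E {- \<lfloor>C * R\<rfloor> .. \<lfloor>C * R\<rfloor>}" for R
  have sub: "{u \<in> Zd. nrm u \<le> R} \<subseteq> v ` B R" for R
  proof
    fix u assume u: "u \<in> {u \<in> Zd. nrm u \<le> R}"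
    have fl: "real_of_int \<lfloor>u $ i\<rfloor> = u $ i" for i using u by (auto simp: Zd_def)
    have "\<bar>u $ i\<bar> \<le> C * R" for i
      using order_trans[OF C(2)[of u i] mult_left_mono[of "nrm u" R C]] u C(1) by simp
    then have "\<bar>\<lfloor>u $ i\<rfloor>\<bar> \<le> \<lfloor>C * R\<rfloor>" for i by (metis fl le_floor_iff of_int_abs)
    then have "(\<lambda>i. \<lfloor>u $ i\<rfloor>) \<in> B R" by (auto simp: B_def PiE_def abs_le_iff minus_le_iff)
    moreover have "u = v (\<lambda>i. \<lfloor>u $ i\<rfloor>)" by (simp add: v_def fl vec_eq_iff)
    ultimately show "u \<in> v ` B R" by blast
  qed
  have finB: "finite (B R)" for R unfolding B_def by (intro finite_PiE) auto
  show ?thesis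
  proof (rule that[of "(2 * C + 1) ^ CARD('d)"])
    show "0 < (2 * C + 1) ^ CARD('d)" using C by simp
    show "finite {u \<in> Zd. nrm u \<le> R}" for R using finite_subset[OF sub finite_imageI[OF finB]] .
    fix R :: real assume R: "1 \<le> R"
    have "card {u \<in> Zd. nrm u \<le> R} \<le> card (B R)"
      using card_mono[OF finite_imageI[OF finB] sub] card_image_le[OF finB] by (rule order_trans)
    also have "card (B R) = nat (2 * \<lfloor>C * R\<rfloor> + 1) ^ CARD('d)" by (simp add: B_def card_PiE)
    finally have "real (card {u \<in> Zd. nrm u \<le> R}) \<le> real (nat (2 * \<lfloor>C * R\<rfloor> + 1)) ^ CARD('d)"
      by (metis of_nat_le_iff of_nat_power)
    also have "\<dots> \<le> ((2 * C + 1) * R) ^ CARD('d)"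
    proof (rule power_mono)
      have "0 \<le> C * R" using C R by simp
      then have "real (nat (2 * \<lfloor>C * R\<rfloor> + 1)) = 2 * real_of_int \<lfloor>C * R\<rfloor> + 1" by simp
      also have "\<dots> \<le> (2 * C + 1) * R" using R of_int_floor_le[of "C * R"] by (simp add: algebra_simps) linarith
      finally show "real (nat (2 * \<lfloor>C * R\<rfloor> + 1)) \<le> (2 * C + 1) * R" .
    qed simp
    finally show "real (card {u \<in> Zd. nrm u \<le> R}) \<le> (2 * C + 1) ^ CARD('d) * R ^ CARD('d)"
      by (simp add: power_mult_distrib)
  qed
qed

end

lemma box_image_card:
  fixes S :: "'d::finite \<Rightarrow> nat set"
  shows "card ((\<lambda>f. \<chi> i. real (f i)) ` (\<Pi>\<^sub>E i\<in>UNIV. S i)) = (\<Prod>i\<in>UNIV. card (S i))"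
proof -
  have "inj_on (\<lambda>f. (\<chi> i. real (f i)) :: real^'d) (\<Pi>\<^sub>E i\<in>UNIV. S i)"
    by (rule inj_onI) (auto simp: vec_eq_iff fun_eq_iff)
  then show ?thesis by (simp add: card_image card_PiE)
qed

lemma box_eq_image:
  "{s :: real^'d::finite. \<forall>i. s $ i \<in> real ` S i} = (\<lambda>f. \<chi> i. real (f i)) ` (\<Pi>\<^sub>E i\<in>UNIV. S i)"
proof (intro equalityI subsetI)
  fix s :: "real^'d" assume "s \<in> {s. \<forall>i. s $ i \<in> real ` S i}"
  then have "\<forall>i. \<exists>k. k \<in> S i \<and> s $ i = real k" by auto
  then obtain f where "\<forall>i. f i \<in> S i \<and> s $ i = real (f i)" by metis
  then show "s \<in> (\<lambda>f. \<chi> i. real (f i)) ` (\<Pi>\<^sub>E i\<in>UNIV. S i)"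
    by (intro image_eqI[of _ _ f]) (auto simp: vec_eq_iff PiE_def)
qed (auto simp: PiE_def Pi_def)

lemma card_grid: "card (grid n :: (real^'d::finite) set) = n ^ CARD('d)"
  using box_image_card[of "\<lambda>_::'d. {1..n}"] by (simp add: grid_def box_eq_image)

lemma finite_grid: "finite (grid n :: (real^'d::finite) set)"
  unfolding grid_def box_eq_image by (intro finite_imageI finite_PiE) auto

lemma grid_subset_Zd: "grid n \<subseteq> Zd"
  unfolding grid_def Zd_def by (auto simp: image_iff) (metis Ints_of_nat)

text \<open>The set of sites whose translate stays in the grid is again a box, and in coordinate i
  it loses at most |h_i| of the n points.\<close>

lemma card_grid_lag_ratio:
  fixes h :: "real^'d::finite"
  assumes h: "h \<in> Zd"
  shows "(\<lambda>n. real (card (grid_lag n h)) / real n ^ CARD('d)) \<longlonglongrightarrow> 1"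
proof -
  define S where "S n i = {x \<in> {1..n}. real x + h $ i \<in> real ` {1..n}}" for n i
  have "s $ i \<in> real ` S n i \<longleftrightarrow> s $ i \<in> real ` {1..n} \<and> s $ i + h $ i \<in> real ` {1..n}" for n s i
    by (auto simp: S_def)
  then have "grid_lag n h = {s. \<forall>i. s $ i \<in> real ` S n i}" for n
    by (auto simp only: grid_lag_def grid_def mem_Collect_eq vector_add_component)
  then have "card (grid_lag n h) = (\<Prod>i\<in>UNIV. card (S n i))" for n
    by (simp add: box_eq_image box_image_card)
  then have eq: "real (card (grid_lag n h)) / real n ^ CARD('d) = (\<Prod>i\<in>UNIV. real (card (S n i)) / real n)" for n
    by (simp add: prod_dividef)
  have "(\<lambda>n. real (card (S n i)) / real n) \<longlonglongrightarrow> 1" for i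
  proof -
    obtain z where z: "h $ i = real_of_int z" using h by (auto simp: Zd_def elim: Ints_cases)
    \<comment> \<open>Subtraction of natural numbers makes the bound trivial when the shift exceeds
      n.\<close>
    have lo: "n - nat \<bar>z\<bar> \<le> card (S n i)" for n
    proof (cases "0 \<le> z")
      case True
      have "{1..n - nat z} \<subseteq> S n i"
      proof
        fix x assume x: "x \<in> {1..n - nat z}"
        then have "real x + h $ i = real (x + nat z)" "x + nat z \<in> {1..n}" using True by (auto simp: z)
        then show "x \<in> S n i" using x unfolding S_def by (auto simp del: of_nat_add)
      qed
      from card_mono[OF _ this] show ?thesis using True by (simp add: S_def)
    next
      case False
      have "{1 + nat (- z)..n} \<subseteq> S n i"
      proof
        fix x assume x: "x \<in> {1 + nat (- z)..n}"
        then have "real x + h $ i = real (x - nat (- z))" "x - nat (- z) \<in> {1..n}" using False by (auto simp: z of_nat_diff)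
        then have "real x + h $ i \<in> real ` {1..n}" by (rule image_eqI)
        then show "x \<in> S n i" using x unfolding S_def by simp
      qed
      from card_mono[OF _ this] show ?thesis using False by (simp add: S_def)
    qed
    have hi: "card (S n i) \<le> n" for n
    proof -
      have "S n i \<subseteq> {1..n}" by (auto simp: S_def)
      from card_mono[OF _ this] show ?thesis by simp
    qed
    have up: "\<forall>\<^sub>F n in sequentially. real (card (S n i)) / real n \<le> 1"
      using hi by (auto simp: divide_le_eq)
    have low: "\<forall>\<^sub>F n in sequentially. 1 - real (nat \<bar>z\<bar>) / real n \<le> real (card (S n i)) / real n"
      using eventually_gt_at_top[of 0]
    proof eventually_elim
      case (elim n)
      have "real n - real (nat \<bar>z\<bar>) \<le> real (card (S n i))" using lo[of n] by linarith
      from divide_right_mono[OF this, of "real n"] elim show ?case by (simp add: diff_divide_distrib)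
    qed
    have "(\<lambda>n. 1 - real (nat \<bar>z\<bar>) / real n) \<longlonglongrightarrow> 1 - 0"
      by (intro tendsto_intros lim_const_over_n)
    then have "(\<lambda>n. 1 - real (nat \<bar>z\<bar>) / real n) \<longlonglongrightarrow> 1" by simp
    then show ?thesis by (rule tendsto_sandwich[OF low up _ tendsto_const])
  qed
  then have "(\<lambda>n. \<Prod>i\<in>UNIV. real (card (S n i)) / real n) \<longlonglongrightarrow> (\<Prod>i\<in>(UNIV::'d set). 1)"
    by (intro tendsto_prod)
  then show ?thesis by (simp add: eq)
qed

section \<open>Dominated sums\<close>

context
  fixes g :: "nat \<Rightarrow> 'u \<Rightarrow> real" and \<kappa> :: "'u \<Rightarrow> real" and Z :: "'u set" and N :: "'u \<Rightarrow> real"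
  assumes fin: "\<And>k. finite {u \<in> Z. N u \<le> k}"
    and lim: "\<And>u. u \<in> Z \<Longrightarrow> (\<lambda>n. g n u) \<longlonglongrightarrow> \<kappa> u"
    and tail: "\<And>\<epsilon>. 0 < \<epsilon> \<Longrightarrow> \<exists>k. \<forall>\<^sub>F n in sequentially. \<forall>F. finite F \<longrightarrow> F \<subseteq> {u \<in> Z. k < N u} \<longrightarrow> (\<Sum>u\<in>F. \<bar>g n u\<bar>) \<le> \<epsilon>"
begin

text \<open>Tails of \<kappa> inherit the bound because finite sums converge termwise. The tails of
  \<open>g n\<close> are controlled only for large n, depending on \<epsilon>, so no fixed summable
  majorant is at hand.\<close>

lemma tannery_limit_tail:
  assumes \<epsilon>: "0 < \<epsilon>"
  shows "\<exists>k. (\<forall>\<^sub>F n in sequentially. \<forall>F. finite F \<longrightarrow> F \<subseteq> {u \<in> Z. k < N u} \<longrightarrow> (\<Sum>u\<in>F. \<bar>g n u\<bar>) \<le> \<epsilon>) \<and>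
    (\<forall>F. finite F \<longrightarrow> F \<subseteq> {u \<in> Z. k < N u} \<longrightarrow> (\<Sum>u\<in>F. \<bar>\<kappa> u\<bar>) \<le> \<epsilon>)"
proof -
  obtain k where k: "\<forall>\<^sub>F n in sequentially. \<forall>F. finite F \<longrightarrow> F \<subseteq> {u \<in> Z. k < N u} \<longrightarrow> (\<Sum>u\<in>F. \<bar>g n u\<bar>) \<le> \<epsilon>"
    using tail[OF \<epsilon>] by blast
  have "(\<Sum>u\<in>F. \<bar>\<kappa> u\<bar>) \<le> \<epsilon>" if F: "finite F" "F \<subseteq> {u \<in> Z. k < N u}" for F
  proof (rule tendsto_upperbound)
    show "(\<lambda>n. \<Sum>u\<in>F. \<bar>g n u\<bar>) \<longlonglongrightarrow> (\<Sum>u\<in>F. \<bar>\<kappa> u\<bar>)"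
      using F by (intro tendsto_sum tendsto_rabs lim) auto
    show "\<forall>\<^sub>F n in sequentially. (\<Sum>u\<in>F. \<bar>g n u\<bar>) \<le> \<epsilon>"
      using k by eventually_elim (use F in blast)
  qed simp
  with k show ?thesis by blast
qed

lemma tannery_bounded:
  "\<exists>C. \<forall>\<^sub>F n in sequentially. \<forall>F. finite F \<longrightarrow> F \<subseteq> Z \<longrightarrow> (\<Sum>u\<in>F. \<bar>g n u\<bar>) \<le> C"
proof -
  obtain k where k: "\<forall>\<^sub>F n in sequentially. \<forall>F. finite F \<longrightarrow> F \<subseteq> {u \<in> Z. k < N u} \<longrightarrow> (\<Sum>u\<in>F. \<bar>g n u\<bar>) \<le> 1"
    using tail[of 1] by auto
  let ?B = "{u \<in> Z. N u \<le> k}"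
  have "(\<lambda>n. \<Sum>u\<in>?B. \<bar>g n u\<bar>) \<longlonglongrightarrow> (\<Sum>u\<in>?B. \<bar>\<kappa> u\<bar>)"
    by (intro tendsto_sum tendsto_rabs lim) auto
  then have "\<forall>\<^sub>F n in sequentially. (\<Sum>u\<in>?B. \<bar>g n u\<bar>) < (\<Sum>u\<in>?B. \<bar>\<kappa> u\<bar>) + 1"
    by (rule order_tendstoD) simp
  with k have "\<forall>\<^sub>F n in sequentially. \<forall>F. finite F \<longrightarrow> F \<subseteq> Z \<longrightarrow> (\<Sum>u\<in>F. \<bar>g n u\<bar>) \<le> (\<Sum>u\<in>?B. \<bar>\<kappa> u\<bar>) + 2"
  proof eventually_elim
    case (elim n)
    show ?case
    proof (intro allI impI)
      fix F assume F: "finite F" "F \<subseteq> Z"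
      have "F - ?B \<subseteq> {u \<in> Z. k < N u}" using F(2) by auto
      then have "(\<Sum>u\<in>F - ?B. \<bar>g n u\<bar>) \<le> 1" using elim(1) F(1) by blast
      moreover have "(\<Sum>u\<in>F \<inter> ?B. \<bar>g n u\<bar>) \<le> (\<Sum>u\<in>?B. \<bar>g n u\<bar>)" by (rule sum_mono2[OF fin]) auto
      moreover have "(\<Sum>u\<in>F. \<bar>g n u\<bar>) = (\<Sum>u\<in>F \<inter> ?B. \<bar>g n u\<bar>) + (\<Sum>u\<in>F - ?B. \<bar>g n u\<bar>)"
        by (rule sum.Int_Diff[OF F(1)])
      ultimately show "(\<Sum>u\<in>F. \<bar>g n u\<bar>) \<le> (\<Sum>u\<in>?B. \<bar>\<kappa> u\<bar>) + 2" using elim(2) by linarith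
    qed
  qed
  then show ?thesis by blast
qed

text \<open>Summability of the limits is a consequence of the uniform tails. It is what gives the
  infinite sums in \<open>Sigma_mat\<close> their meaning.\<close>

lemma tannery_summable: "\<kappa> summable_on Z"
proof -
  obtain k where k: "\<And>F. finite F \<Longrightarrow> F \<subseteq> {u \<in> Z. k < N u} \<Longrightarrow> (\<Sum>u\<in>F. \<bar>\<kappa> u\<bar>) \<le> 1"
    using tannery_limit_tail[of 1] by auto
  let ?B = "{u \<in> Z. N u \<le> k}"
  have "(\<lambda>u. norm (\<kappa> u)) summable_on Z"
  proof (rule nonneg_bdd_above_summable_on)
    show "bdd_above (sum (\<lambda>u. norm (\<kappa> u)) ` {F. F \<subseteq> Z \<and> finite F})"
    proof (rule bdd_aboveI2)
      fix F assume "F \<in> {F. F \<subseteq> Z \<and> finite F}"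
      then have F: "finite F" "F \<subseteq> Z" by auto
      have "F - ?B \<subseteq> {u \<in> Z. k < N u}" using F(2) by auto
      then have "(\<Sum>u\<in>F - ?B. \<bar>\<kappa> u\<bar>) \<le> 1" using k F(1) by blast
      moreover have "(\<Sum>u\<in>F \<inter> ?B. \<bar>\<kappa> u\<bar>) \<le> (\<Sum>u\<in>?B. \<bar>\<kappa> u\<bar>)" by (rule sum_mono2[OF fin]) auto
      moreover have "(\<Sum>u\<in>F. \<bar>\<kappa> u\<bar>) = (\<Sum>u\<in>F \<inter> ?B. \<bar>\<kappa> u\<bar>) + (\<Sum>u\<in>F - ?B. \<bar>\<kappa> u\<bar>)"
        by (rule sum.Int_Diff[OF F(1)])
      ultimately show "(\<Sum>u\<in>F. norm (\<kappa> u)) \<le> (\<Sum>u\<in>?B. \<bar>\<kappa> u\<bar>) + 1" by simp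
    qed
  qed simp
  then show ?thesis by (rule abs_summable_summable)
qed

text \<open>In the application U n is a lattice ball of growing radius, and w n u is the proportion
  of grid sites that admit the lag u.\<close>

lemma tannery:
  assumes U: "\<And>n. finite (U n)" "\<And>n. U n \<subseteq> Z" and ev: "\<And>u. u \<in> Z \<Longrightarrow> \<forall>\<^sub>F n in sequentially. u \<in> U n"
    and w: "\<And>n u. 0 \<le> w n u" "\<And>n u. w n u \<le> 1" "\<And>u. u \<in> Z \<Longrightarrow> (\<lambda>n. w n u) \<longlonglongrightarrow> 1"
  shows "(\<lambda>n. \<Sum>u\<in>U n. w n u * g n u) \<longlonglongrightarrow> (\<Sum>\<^sub>\<infinity>u\<in>Z. \<kappa> u)"
proof (rule LIMSEQ_I)
  fix \<epsilon> :: real assume \<epsilon>: "0 < \<epsilon>"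
  \<comment> \<open>Three errors of this size occur: on the finite part, in the tail of the sums and
    in the tail of the limit.\<close>
  then have "0 < \<epsilon> / 4" by simp
  from tannery_limit_tail[OF this] obtain k where
    k: "\<forall>\<^sub>F n in sequentially. \<forall>F. finite F \<longrightarrow> F \<subseteq> {u \<in> Z. k < N u} \<longrightarrow> (\<Sum>u\<in>F. \<bar>g n u\<bar>) \<le> \<epsilon> / 4"
    "\<And>F. finite F \<Longrightarrow> F \<subseteq> {u \<in> Z. k < N u} \<Longrightarrow> (\<Sum>u\<in>F. \<bar>\<kappa> u\<bar>) \<le> \<epsilon> / 4" by auto
  let ?B = "{u \<in> Z. N u \<le> k}"
  have ZB: "Z = ?B \<union> (Z - ?B)" "?B \<inter> (Z - ?B) = {}" by auto
  have sB: "\<kappa> summable_on (Z - ?B)" by (rule summable_on_subset[OF tannery_summable]) auto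
  have i1: "(\<Sum>\<^sub>\<infinity>u\<in>Z. \<kappa> u) = (\<Sum>u\<in>?B. \<kappa> u) + (\<Sum>\<^sub>\<infinity>u\<in>Z - ?B. \<kappa> u)"
    using infsum_Un_disjoint[OF summable_on_finite[OF fin[of k]] sB ZB(2)] fin[of k] ZB(1) by simp
  have i2: "\<bar>\<Sum>\<^sub>\<infinity>u\<in>Z - ?B. \<kappa> u\<bar> \<le> \<epsilon> / 4"
  proof -
    have 1: "(\<Sum>\<^sub>\<infinity>u\<in>Z - ?B. \<kappa> u) \<le> \<epsilon> / 4"
    proof (rule infsum_le_finite_sums[OF sB])
      fix F assume F: "finite F" "F \<subseteq> Z - ?B"
      have "F \<subseteq> {u \<in> Z. k < N u}" using F(2) by auto
      from k(2)[OF F(1) this] show "sum \<kappa> F \<le> \<epsilon> / 4" using sum_abs[of \<kappa> F] abs_ge_self[of "sum \<kappa> F"] by linarith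
    qed
    have "(\<Sum>\<^sub>\<infinity>u\<in>Z - ?B. - \<kappa> u) \<le> \<epsilon> / 4"
    proof (rule infsum_le_finite_sums)
      show "(\<lambda>u. - \<kappa> u) summable_on Z - ?B" using sB by (simp add: summable_on_uminus)
      fix F assume F: "finite F" "F \<subseteq> Z - ?B"
      have "F \<subseteq> {u \<in> Z. k < N u}" using F(2) by auto
      from k(2)[OF F(1) this] show "(\<Sum>u\<in>F. - \<kappa> u) \<le> \<epsilon> / 4"
        using sum_abs[of \<kappa> F] abs_ge_minus_self[of "sum \<kappa> F"] unfolding sum_negf by linarith
    qed
    with 1 show ?thesis by (simp add: infsum_uminus abs_le_iff)
  qed
  have "(\<lambda>n. \<Sum>u\<in>?B. w n u * g n u) \<longlonglongrightarrow> (\<Sum>u\<in>?B. 1 * \<kappa> u)"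
    by (intro tendsto_sum tendsto_mult w lim) auto
  then have "\<forall>\<^sub>F n in sequentially. dist (\<Sum>u\<in>?B. w n u * g n u) (\<Sum>u\<in>?B. 1 * \<kappa> u) < \<epsilon> / 4"
    by (rule tendstoD) (use \<epsilon> in simp)
  moreover have "\<forall>\<^sub>F n in sequentially. \<forall>u\<in>?B. u \<in> U n"
    by (rule eventually_ball_finite[OF fin]) (use ev in auto)
  ultimately have "\<forall>\<^sub>F n in sequentially. norm ((\<Sum>u\<in>U n. w n u * g n u) - (\<Sum>\<^sub>\<infinity>u\<in>Z. \<kappa> u)) < \<epsilon>"
    using k(1)
  proof eventually_elim
    case (elim n)
    have "U n - ?B \<subseteq> {u \<in> Z. k < N u}" using U(2)[of n] by auto
    then have t: "(\<Sum>u\<in>U n - ?B. \<bar>g n u\<bar>) \<le> \<epsilon> / 4" using elim(3) U(1)[of n] by blast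
    have "\<bar>\<Sum>u\<in>U n - ?B. w n u * g n u\<bar> \<le> (\<Sum>u\<in>U n - ?B. \<bar>g n u\<bar>)"
    proof (rule order_trans[OF sum_abs sum_mono])
      fix u show "\<bar>w n u * g n u\<bar> \<le> \<bar>g n u\<bar>"
        using mult_right_mono[OF w(2)[of n u] abs_ge_zero[of "g n u"]] w(1)[of n u] by (simp add: abs_mult)
    qed
    moreover have "(\<Sum>u\<in>U n. w n u * g n u) = (\<Sum>u\<in>?B. w n u * g n u) + (\<Sum>u\<in>U n - ?B. w n u * g n u)"
      using sum.subset_diff[of ?B "U n" "\<lambda>u. w n u * g n u"] elim(2) U(1)[of n] by (simp add: subset_iff add.commute)
    ultimately show ?case using i1 i2 elim(1) t \<epsilon> unfolding dist_real_def real_norm_def mult_1 by linarith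
  qed
  then show "\<exists>no. \<forall>n\<ge>no. norm ((\<Sum>u\<in>U n. w n u * g n u) - (\<Sum>\<^sub>\<infinity>u\<in>Z. \<kappa> u)) < \<epsilon>"
    by (simp add: eventually_sequentially)
qed

end

section \<open>Mixing coefficients of the vectorized field\<close>

text \<open>Packages \<open>gen_sigma\<close> as a measure space, since \<open>subalgebra\<close>
  and measurability of functions refer to such objects.\<close>

definition field_algebra :: "'w measure \<Rightarrow> ('s \<Rightarrow> 'w \<Rightarrow> real) \<Rightarrow> 's set \<Rightarrow> 'w measure" where
  "field_algebra M X \<Lambda> = sigma (space M) {X s -` E \<inter> space M | s E. s \<in> \<Lambda> \<and> E \<in> sets borel}"

lemma sets_field_algebra: "sets (field_algebra M X \<Lambda>) = gen_sigma M X \<Lambda>"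
  unfolding field_algebra_def gen_sigma_def by (rule sets_measure_of) auto

lemma space_field_algebra: "space (field_algebra M X \<Lambda>) = space M"
  unfolding field_algebra_def by (rule space_measure_of) auto

lemma field_algebra_measurable:
  assumes "s \<in> \<Lambda>"
  shows "X s \<in> borel_measurable (field_algebra M X \<Lambda>)"
proof (rule measurableI)
  fix E :: "real set" assume "E \<in> sets borel"
  then have "X s -` E \<inter> space M \<in> gen_sigma M X \<Lambda>"
    unfolding gen_sigma_def using assms by (intro sigma_sets.Basic) blast
  then show "X s -` E \<inter> space (field_algebra M X \<Lambda>) \<in> sets (field_algebra M X \<Lambda>)"
    by (simp add: sets_field_algebra space_field_algebra)
qed simp

lemma field_algebra_subalgebra:
  assumes X: "\<And>s. X s \<in> borel_measurable M"
  shows "subalgebra M (field_algebra M X \<Lambda>)"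
proof -
  have "gen_sigma M X \<Lambda> \<subseteq> sets M"
    unfolding gen_sigma_def by (rule sets.sigma_sets_subset) (auto intro: measurable_sets[OF X])
  then show ?thesis by (simp add: subalgebra_def sets_field_algebra space_field_algebra)
qed

lemma site_dist_ge:
  assumes "\<And>s t. s \<in> \<Lambda>1 \<Longrightarrow> t \<in> \<Lambda>2 \<Longrightarrow> \<rho> \<le> nrm (s - t)"
  shows "ereal \<rho> \<le> site_dist nrm \<Lambda>1 \<Lambda>2"
  unfolding site_dist_def using assms by (intro INF_greatest) auto

context prob_space
begin

lemma dependence_le_1: "\<bar>prob A - prob B * prob C\<bar> \<le> 1"
proof -
  have "0 \<le> prob B * prob C" "prob B * prob C \<le> 1" by (auto intro: mult_le_one)
  then show ?thesis using measure_nonneg[of M A] prob_le_1[of A] by linarith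
qed

lemma alpha_Y_upper:
  assumes "\<Lambda>1 \<subseteq> Zd" "finite \<Lambda>1" "card \<Lambda>1 \<le> k" "\<Lambda>2 \<subseteq> Zd" "finite \<Lambda>2" "card \<Lambda>2 \<le> l"
    and "\<And>s t. s \<in> \<Lambda>1 \<Longrightarrow> t \<in> \<Lambda>2 \<Longrightarrow> \<rho> \<le> nrm (s - t)"
    and "P \<in> gen_sigma M X (\<Union>s\<in>\<Lambda>1. zball nrm s \<gamma>)" "Q \<in> gen_sigma M X (\<Union>s\<in>\<Lambda>2. zball nrm s \<gamma>)"
  shows "\<bar>prob (P \<inter> Q) - prob P * prob Q\<bar> \<le> alpha_Y M X nrm \<gamma> k l \<rho>"
  unfolding alpha_Y_def
proof (rule cSup_upper)
  have sd: "ereal \<rho> \<le> site_dist nrm \<Lambda>1 \<Lambda>2" by (rule site_dist_ge) (use assms in auto)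
  show "\<bar>prob (P \<inter> Q) - prob P * prob Q\<bar> \<in> {\<bar>prob (A1 \<inter> A2) - prob A1 * prob A2\<bar> | A1 A2 \<Lambda>1 \<Lambda>2.
            \<Lambda>1 \<subseteq> Zd \<and> finite \<Lambda>1 \<and> card \<Lambda>1 \<le> k \<and> \<Lambda>2 \<subseteq> Zd \<and> finite \<Lambda>2 \<and> card \<Lambda>2 \<le> l \<and>
            ereal \<rho> \<le> site_dist nrm \<Lambda>1 \<Lambda>2 \<and>
            A1 \<in> gen_sigma M X (\<Union>s\<in>\<Lambda>1. zball nrm s \<gamma>) \<and>
            A2 \<in> gen_sigma M X (\<Union>s\<in>\<Lambda>2. zball nrm s \<gamma>)}"
    unfolding mem_Collect_eq
    by (rule exI[of _ P], rule exI[of _ Q], rule exI[of _ \<Lambda>1], rule exI[of _ \<Lambda>2], use assms sd in simp)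
qed (auto intro!: bdd_aboveI[of _ 1] dependence_le_1)

text \<open>Empty site sets are at infinite distance, so the supremum always runs over a set
  containing 0.\<close>

lemma alpha_Y_nonneg: "0 \<le> alpha_Y M X nrm \<gamma> k l \<rho>"
proof -
  have "\<bar>prob ({} \<inter> {}) - prob {} * prob {}\<bar> \<le> alpha_Y M X nrm \<gamma> k l \<rho>"
    by (rule alpha_Y_upper[of "{}" k "{}" l]) (auto simp: gen_sigma_def intro: sigma_sets.Empty)
  then show ?thesis by simp
qed

end

section \<open>Extremal covariances\<close>

locale extremogram_clt = rv_field M X a \<mu>
  for M :: "'w measure" and X :: "real^'d::finite \<Rightarrow> 'w \<Rightarrow> real" and a :: "nat \<Rightarrow> real"
    and \<mu> :: "(real^'d) set \<Rightarrow> (real^'d \<Rightarrow> ereal) measure" +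
  fixes nrm :: "real^'d \<Rightarrow> real" and \<gamma> :: real and h :: "'p::finite \<Rightarrow> real^'d"
    and A B :: "ereal set" and m :: "nat \<Rightarrow> nat" and r :: "nat \<Rightarrow> real"
  assumes norm: "is_norm nrm"
    and gamma: "\<gamma> > 0"
    and lags: "range h \<subseteq> zball nrm 0 \<gamma>"
    and A: "continuity_set (mu0 \<mu>) A" "measure (mu0 \<mu>) A > 0"
    and B: "continuity_set (mu0 \<mu>) B"
    and m_pos: "\<forall>n\<ge>1. m n > 0"
    and m_r: "filterlim m at_top sequentially" "filterlim r at_top sequentially"
      "(\<lambda>n. real (m n) / real n) \<longlonglongrightarrow> 0" "(\<lambda>n. r n / real (m n)) \<longlonglongrightarrow> 0"
    and M2: "(\<lambda>n. (real (m n))\<^sup>2 * (r n)\<^sup>2 / real n) \<longlonglongrightarrow> 0"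
    and M3: "\<forall>\<epsilon>>0.
      (\<lambda>k::nat. limsup (\<lambda>n. ereal (\<Sum>u\<in>{u \<in> Zd. real k < nrm u \<and> nrm u \<le> r n}.
          real (m n) ^ CARD('d) *
          \<P>(\<omega> in M. Max ((\<lambda>s. \<bar>X s \<omega>\<bar>) ` zball nrm 0 \<gamma>) > \<epsilon> * a (m n) \<and>
                      Max ((\<lambda>s. \<bar>X s \<omega>\<bar>) ` zball nrm u \<gamma>) > \<epsilon> * a (m n))))) \<longlonglongrightarrow> 0"
    and M4_i: "(\<lambda>n. real (m n) ^ CARD('d) *
        (\<Sum>\<^sub>\<infinity>u\<in>{u \<in> Zd. nrm u > r n}. alpha_Y M X nrm \<gamma> 1 1 (nrm u))) \<longlonglongrightarrow> 0"
    and M4_ii: "\<forall>k l. 2 \<le> k + l \<and> k + l \<le> 4 \<longrightarrow>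
        (\<lambda>u. alpha_Y M X nrm \<gamma> k l (nrm u)) summable_on Zd"
    and M4_iii: "(\<lambda>n. real (m n) powr (real CARD('d) / 2) * real n powr (real CARD('d) / 2) *
        alpha_Y M X nrm \<gamma> 1 (n ^ CARD('d)) (r n)) \<longlonglongrightarrow> 0"
begin

lemmas nrm_facts = nrm_nonneg[OF norm] nrm_zero[OF norm] nrm_minus[OF norm]

lemma zero_in_Zd: "0 \<in> Zd" by (simp add: Zd_def)

lemma Zd_add: "s \<in> Zd \<Longrightarrow> t \<in> Zd \<Longrightarrow> s + t \<in> Zd" and Zd_diff: "s \<in> Zd \<Longrightarrow> t \<in> Zd \<Longrightarrow> s - t \<in> Zd"
  and Zd_minus: "s \<in> Zd \<Longrightarrow> - s \<in> Zd"
  by (auto simp: Zd_def)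

text \<open>The index \<open>None\<close> becomes the lag \<open>0\<close> with target set \<open>A\<close>, so that all \<open>p + 1\<close> events have the
  form \<open>X(s) \<in> A, X(s + lag i) \<in> lag_set i\<close>.\<close>

definition lag :: "'p option \<Rightarrow> real^'d" where "lag i = (case i of None \<Rightarrow> 0 | Some j \<Rightarrow> h j)"

definition lag_set :: "'p option \<Rightarrow> ereal set" where "lag_set i = (case i of None \<Rightarrow> A | Some j \<Rightarrow> B)"

definition ind :: "'p option \<Rightarrow> nat \<Rightarrow> real^'d \<Rightarrow> 'w \<Rightarrow> real" where
  "ind i n s \<omega> = indicator A (ereal (X s \<omega> / a (m n))) * indicator (lag_set i) (ereal (X (s + lag i) \<omega> / a (m n)))"

definition p :: "'p option \<Rightarrow> nat \<Rightarrow> real" where "p i n = expectation (ind i n 0)"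

definition cov :: "'p option \<Rightarrow> 'p option \<Rightarrow> nat \<Rightarrow> real^'d \<Rightarrow> real" where
  "cov i j n u = expectation (\<lambda>\<omega>. ind i n 0 \<omega> * ind j n u \<omega>) - p i n * p j n"

abbreviation D_set :: "'p option \<Rightarrow> (real^'d \<Rightarrow> ereal) set" where "D_set \<equiv> Dset nrm \<gamma> A B h"

text \<open>The limit of the rescaled covariance at lag u. Including the value at lag 0 makes every
  entry of \<open>Sigma_mat\<close> a single sum over the whole lattice.\<close>

definition \<kappa> :: "'p option \<Rightarrow> 'p option \<Rightarrow> real^'d \<Rightarrow> real" where
  "\<kappa> i j u = (if u = 0 then measure (\<mu> (zball nrm 0 \<gamma>)) (D_set i \<inter> D_set j)
     else tau M X a nrm \<gamma> u (D_set i) (D_set j))"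

lemma zero_in_ball: "0 \<in> zball nrm 0 \<gamma>"
  using gamma by (simp add: zball_def zero_in_Zd nrm_facts)

lemma lag_in_ball: "lag i \<in> zball nrm 0 \<gamma>"
  using lags zero_in_ball by (auto simp: lag_def split: option.split)

lemma shifted_in_ball: "s \<in> Zd \<Longrightarrow> s \<in> zball nrm s \<gamma>" "s \<in> Zd \<Longrightarrow> s + lag i \<in> zball nrm s \<gamma>"
  using lag_in_ball[of i] gamma by (auto simp: zball_def Zd_add nrm_facts)

lemma finite_zball: "finite (zball nrm s \<gamma>)"
proof -
  obtain C where "\<And>R. finite {u \<in> Zd. nrm u \<le> R}" by (rule lattice_ball_card[OF norm]) blast
  then have "finite {u \<in> Zd. nrm u \<le> \<gamma> + nrm s}" by blast
  moreover have "zball nrm s \<gamma> \<subseteq> {u \<in> Zd. nrm u \<le> \<gamma> + nrm s}"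
  proof
    fix u assume u: "u \<in> zball nrm s \<gamma>"
    have "nrm u \<le> nrm (u - s) + nrm s" using nrm_triangle[OF norm, of "u - s" s] by simp
    then show "u \<in> {u \<in> Zd. nrm u \<le> \<gamma> + nrm s}"
      using u nrm_minus_commute[OF norm, of u s] by (auto simp: zball_def)
  qed
  ultimately show ?thesis by (rule finite_subset[rotated])
qed

lemma A_borel[measurable]: "A \<in> sets borel" and B_borel[measurable]: "B \<in> sets borel"
  using A B by (auto simp: continuity_set_def)

lemma lag_set_borel[measurable]: "lag_set i \<in> sets borel"
  by (auto simp: lag_set_def split: option.split)

lemma lag_set_continuity: "continuity_set (mu0 \<mu>) (lag_set i)"
  using A B by (auto simp: lag_set_def split: option.split)

lemma ind_measurable[measurable]: "ind i n s \<in> borel_measurable M"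
  unfolding ind_def by measurable

lemma ind_field_measurable:
  assumes "s \<in> Zd" "zball nrm s \<gamma> \<subseteq> \<Lambda>"
  shows "ind i n s \<in> borel_measurable (field_algebra M X \<Lambda>)"
proof -
  have [measurable]: "X s \<in> borel_measurable (field_algebra M X \<Lambda>)" "X (s + lag i) \<in> borel_measurable (field_algebra M X \<Lambda>)"
    using shifted_in_ball[OF assms(1)] assms(2) by (auto intro!: field_algebra_measurable)
  show ?thesis unfolding ind_def by measurable
qed

lemma ind_nonneg: "0 \<le> ind i n s \<omega>" and ind_le_1: "ind i n s \<omega> \<le> 1" and ind_le_None: "ind i n s \<omega> \<le> ind None n s \<omega>"
  and ind_idem: "ind i n s \<omega> * ind i n s \<omega> = ind i n s \<omega>"
  by (auto simp: ind_def indicator_def lag_def lag_set_def)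

lemma integrable_ind: "integrable M (ind i n s)"
  by (rule integrable_const_bound[of _ 1]) (auto simp: ind_nonneg ind_le_1)

lemma integrable_ind_mult: "integrable M (\<lambda>\<omega>. ind i n s \<omega> * ind j n t \<omega>)"
  by (rule integrable_const_bound[of _ 1]) (auto simp: ind_nonneg ind_le_1 mult_le_one)

lemma ind_mult_stationary:
  "expectation (\<lambda>\<omega>. ind i n s \<omega> * ind j n (s + u) \<omega>) = expectation (\<lambda>\<omega>. ind i n 0 \<omega> * ind j n u \<omega>)"
proof -
  let ?I = "{0, lag i, u, u + lag j}"
  let ?c = "a (m n)"
  define \<Psi> where "\<Psi> y = indicator A (ereal (y 0 / ?c)) * indicator (lag_set i) (ereal (y (lag i) / ?c))
    * (indicator A (ereal (y u / ?c)) * indicator (lag_set j) (ereal (y (u + lag j) / ?c)) :: real)" for y :: "real^'d \<Rightarrow> real"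
  have [measurable]: "(\<lambda>y. y t) \<in> borel_measurable (Pi\<^sub>M ?I (\<lambda>_. borel :: real measure))" if "t \<in> ?I" for t
    by (rule measurable_component_singleton[OF that])
  have "\<Psi> \<in> borel_measurable (Pi\<^sub>M ?I (\<lambda>_. borel))" unfolding \<Psi>_def by measurable
  from stationary_expectation[OF _ this, of s]
  have "expectation (\<lambda>\<omega>. \<Psi> (\<lambda>t\<in>?I. X (t + s) \<omega>)) = expectation (\<lambda>\<omega>. \<Psi> (\<lambda>t\<in>?I. X t \<omega>))" by simp
  then show ?thesis
    by (simp add: \<Psi>_def ind_def ac_simps)
qed

lemma expectation_ind: "expectation (ind i n s) = p i n"
  using ind_mult_stationary[of i n s i 0] by (simp add: ind_idem p_def)

lemma cov_stationary:
  "expectation (\<lambda>\<omega>. (ind i n s \<omega> - p i n) * (ind j n t \<omega> - p j n)) = cov i j n (t - s)"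
proof -
  have "expectation (\<lambda>\<omega>. (ind i n s \<omega> - p i n) * (ind j n t \<omega> - p j n))
      = expectation (\<lambda>\<omega>. ind i n s \<omega> * ind j n t \<omega> - p j n * ind i n s \<omega> - p i n * ind j n t \<omega> + p i n * p j n)"
    by (simp add: algebra_simps)
  also have "\<dots> = expectation (\<lambda>\<omega>. ind i n s \<omega> * ind j n t \<omega>) - p i n * p j n"
    using integrable_ind_mult[of i n s j t] integrable_ind by (simp add: expectation_ind prob_space mult.commute)
  finally show ?thesis using ind_mult_stationary[of i n s j "t - s"] by (simp add: cov_def)
qed

lemma zero_notin_A: "0 \<notin> A"
  using A(1) by (auto simp: continuity_set_def)

text \<open>Membership in the punctured space is automatic: the coordinate at 0 lies in A, which
  does not contain 0.\<close>

lemma vec_scaled_in_D_set: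
  "vec_scaled X nrm \<gamma> c s \<omega> \<in> D_set i \<longleftrightarrow> ereal (X s \<omega> / c) \<in> A \<and> ereal (X (s + lag i) \<omega> / c) \<in> lag_set i"
proof -
  have "vec_scaled X nrm \<gamma> c s \<omega> \<in> topspace (punctured (zball nrm 0 \<gamma>))" if "ereal (X s \<omega> / c) \<in> A"
  proof -
    have "vec_scaled X nrm \<gamma> c s \<omega> 0 \<noteq> (\<lambda>s\<in>zball nrm 0 \<gamma>. 0) 0"
      using that zero_notin_A zero_in_ball by (auto simp: vec_scaled_def simp flip: zero_ereal_def)
    then have "vec_scaled X nrm \<gamma> c s \<omega> \<noteq> (\<lambda>s\<in>zball nrm 0 \<gamma>. 0)" by metis
    then show ?thesis by (simp add: topspace_punctured vec_scaled_def)
  qed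
  then show ?thesis
    using zero_in_ball lag_in_ball[of i]
    by (cases i) (auto simp: Dset_def lag_def lag_set_def vec_scaled_def)
qed

lemma D_set_eq: "D_set i = {y \<in> topspace (punctured (zball nrm 0 \<gamma>)). y 0 \<in> A \<and> y (lag i) \<in> lag_set i}"
  by (cases i) (auto simp: Dset_def lag_def lag_set_def)

text \<open>Enumerates the four one-coordinate constraints of a pair of events, for use in
  \<open>rv_limit\<close>. Constraints rather than sites are counted, as the sites coincide when a
  lag or u is 0.\<close>

definition pair_site :: "'p option \<Rightarrow> 'p option \<Rightarrow> real^'d \<Rightarrow> nat \<Rightarrow> real^'d" where
  "pair_site i j u q = (if q = 0 then 0 else if q = 1 then lag i else if q = 2 then u else u + lag j)"

definition pair_set :: "'p option \<Rightarrow> 'p option \<Rightarrow> nat \<Rightarrow> ereal set" where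
  "pair_set i j q = (if q = 1 then lag_set i else if q = 3 then lag_set j else A)"

lemma pair_event: "(\<forall>q\<in>{0,1,2,3::nat}. f (pair_site i j u q) \<in> pair_set i j q) \<longleftrightarrow>
    (f 0 \<in> A \<and> f (lag i) \<in> lag_set i) \<and> (f u \<in> A \<and> f (u + lag j) \<in> lag_set j)"
  by (auto simp: pair_site_def pair_set_def)

text \<open>For u = 0 the ball itself serves as index set, so the limit is the measure of the
  intersection. Otherwise the four sites serve, and the existence of the limit identifies it with
  the \<open>lim\<close> in \<open>tau\<close>.\<close>

lemma pair_limit:
  "(\<lambda>n. real n ^ CARD('d) * \<P>(\<omega> in M. vec_scaled X nrm \<gamma> (a n) 0 \<omega> \<in> D_set i \<and> vec_scaled X nrm \<gamma> (a n) u \<omega> \<in> D_set j))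
    \<longlonglongrightarrow> \<kappa> i j u"
proof -
  have C: "continuity_set (mu0 \<mu>) (pair_set i j q)" for q using A(1) lag_set_continuity by (auto simp: pair_set_def)
  have ev: "\<P>(\<omega> in M. vec_scaled X nrm \<gamma> (a n) 0 \<omega> \<in> D_set i \<and> vec_scaled X nrm \<gamma> (a n) u \<omega> \<in> D_set j)
    = \<P>(\<omega> in M. \<forall>q\<in>{0,1,2,3::nat}. ereal (X (pair_site i j u q) \<omega> / a n) \<in> pair_set i j q)" for n
    unfolding pair_event[where f = "\<lambda>s. ereal (X s _ / a n)"] vec_scaled_in_D_set by simp
  have lim: "(\<lambda>n. real n ^ CARD('d) * \<P>(\<omega> in M. vec_scaled X nrm \<gamma> (a n) 0 \<omega> \<in> D_set i \<and> vec_scaled X nrm \<gamma> (a n) u \<omega> \<in> D_set j))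
    \<longlonglongrightarrow> measure (\<mu> I) {y \<in> topspace (punctured I). \<forall>q\<in>{0,1,2,3::nat}. y (pair_site i j u q) \<in> pair_set i j q}"
    if "finite I" "pair_site i j u ` {0,1,2,3} \<subseteq> I" for I
    unfolding ev by (rule rv_limit[OF that(1)]) (use that C in auto)
  show ?thesis
  proof (cases "u = 0")
    case True
    have "{y \<in> topspace (punctured (zball nrm 0 \<gamma>)). \<forall>q\<in>{0,1,2,3::nat}. y (pair_site i j u q) \<in> pair_set i j q}
        = D_set i \<inter> D_set j"
      unfolding pair_event[where f = "\<lambda>s. _ s"] D_set_eq using True by auto
    then show ?thesis
      using lim[OF finite_zball[of 0]] zero_in_ball lag_in_ball True by (auto simp: \<kappa>_def pair_site_def)
  next
    case False
    from lim[OF _ order_refl] limI[OF lim[OF _ order_refl]] show ?thesis using False by (simp add: \<kappa>_def tau_def)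
  qed
qed

lemma expectation_ind_mult:
  "expectation (\<lambda>\<omega>. ind i n 0 \<omega> * ind j n u \<omega>)
    = \<P>(\<omega> in M. vec_scaled X nrm \<gamma> (a (m n)) 0 \<omega> \<in> D_set i \<and> vec_scaled X nrm \<gamma> (a (m n)) u \<omega> \<in> D_set j)"
proof -
  let ?E = "{\<omega> \<in> space M. vec_scaled X nrm \<gamma> (a (m n)) 0 \<omega> \<in> D_set i \<and> vec_scaled X nrm \<gamma> (a (m n)) u \<omega> \<in> D_set j}"
  have "expectation (\<lambda>\<omega>. ind i n 0 \<omega> * ind j n u \<omega>) = expectation (indicator ?E)"
    by (rule Bochner_Integration.integral_cong) (auto simp: ind_def vec_scaled_in_D_set indicator_def)
  also have "\<dots> = prob (?E \<inter> space M)" by (rule Bochner_Integration.integral_indicator)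
  also have "?E \<inter> space M = ?E" by auto
  finally show ?thesis .
qed

lemma scaled_ind_limit: "(\<lambda>n. real (m n) ^ CARD('d) * expectation (\<lambda>\<omega>. ind i n 0 \<omega> * ind j n u \<omega>)) \<longlonglongrightarrow> \<kappa> i j u"
  unfolding expectation_ind_mult by (rule filterlim_compose[OF pair_limit m_r(1)])

lemma scaled_p_limit: "(\<lambda>n. real (m n) ^ CARD('d) * p i n) \<longlonglongrightarrow> measure (\<mu> (zball nrm 0 \<gamma>)) (D_set i)"
  using scaled_ind_limit[of i i 0] by (simp add: ind_idem \<kappa>_def p_def)

text \<open>The same sequence of scaled probabilities is evaluated once with index set {0} and once
  with the ball.\<close>

lemma measure_D_None: "measure (\<mu> (zball nrm 0 \<gamma>)) (D_set None) = measure (mu0 \<mu>) A"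
proof -
  have "(\<lambda>n. real n ^ CARD('d) * \<P>(\<omega> in M. \<forall>j\<in>{()}. ereal (X 0 \<omega> / a n) \<in> A))
    \<longlonglongrightarrow> measure (\<mu> {0}) {y \<in> topspace (punctured {0}). \<forall>j\<in>{()}. y 0 \<in> A}"
    by (rule rv_limit[of "{0}" "{()}" "\<lambda>_. 0" "\<lambda>_. A"]) (use A in auto)
  moreover have "\<P>(\<omega> in M. \<forall>j\<in>{()}. ereal (X 0 \<omega> / a n) \<in> A)
     = \<P>(\<omega> in M. vec_scaled X nrm \<gamma> (a n) 0 \<omega> \<in> D_set None \<and> vec_scaled X nrm \<gamma> (a n) 0 \<omega> \<in> D_set None)" for n
    unfolding vec_scaled_in_D_set by (simp add: lag_def lag_set_def)
  ultimately have "(\<lambda>n. real n ^ CARD('d) * \<P>(\<omega> in M. vec_scaled X nrm \<gamma> (a n) 0 \<omega> \<in> D_set None \<and> vec_scaled X nrm \<gamma> (a n) 0 \<omega> \<in> D_set None))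
    \<longlonglongrightarrow> measure (\<mu> {0}) {y \<in> topspace (punctured {0}). \<forall>j\<in>{()}. y 0 \<in> A}" by (simp only:)
  from LIMSEQ_unique[OF this pair_limit]
  have "measure (\<mu> {0}) {y \<in> topspace (punctured {0}). y 0 \<in> A} = measure (\<mu> (zball nrm 0 \<gamma>)) (D_set None)"
    by (simp add: \<kappa>_def)
  moreover have "measure (mu0 \<mu>) A = measure (\<mu> {0}) {y \<in> topspace (punctured {0}). y 0 \<in> A}"
    unfolding mu0_def using coordinate_measurable[of "{0}" 0]
    by (subst measure_distr) (auto simp: space_mu vimage_def Int_def conj_commute)
  ultimately show ?thesis by simp
qed

lemma m_top: "filterlim (\<lambda>n. real (m n)) at_top sequentially"
  by (rule filterlim_compose[OF filterlim_real_sequentially m_r(1)])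

lemma m_pow_top: "filterlim (\<lambda>n. real (m n) ^ CARD('d)) at_top sequentially"
  by (rule filterlim_compose[OF filterlim_pow_at_top m_top]) (auto simp: filterlim_ident)

lemma p_limit: "p i \<longlonglongrightarrow> 0"
proof -
  have "(\<lambda>n. (real (m n) ^ CARD('d) * p i n) * inverse (real (m n) ^ CARD('d))) \<longlonglongrightarrow> measure (\<mu> (zball nrm 0 \<gamma>)) (D_set i) * 0"
    by (intro tendsto_mult scaled_p_limit tendsto_inverse_0_at_top m_pow_top)
  moreover have "\<forall>\<^sub>F n in sequentially. (real (m n) ^ CARD('d) * p i n) * inverse (real (m n) ^ CARD('d)) = p i n"
    using eventually_ge_at_top[of 1] by eventually_elim (use m_pos in auto)
  ultimately show ?thesis by (simp add: tendsto_cong)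
qed

text \<open>The product of means is of smaller order: after scaling, one factor converges while the
  other tends to 0.\<close>

lemma cov_limit: "(\<lambda>n. real (m n) ^ CARD('d) * cov i j n u) \<longlonglongrightarrow> \<kappa> i j u"
proof -
  have "(\<lambda>n. real (m n) ^ CARD('d) * expectation (\<lambda>\<omega>. ind i n 0 \<omega> * ind j n u \<omega>) - real (m n) ^ CARD('d) * p i n * p j n)
      \<longlonglongrightarrow> \<kappa> i j u - measure (\<mu> (zball nrm 0 \<gamma>)) (D_set i) * 0"
    by (intro tendsto_diff tendsto_mult scaled_ind_limit scaled_p_limit p_limit)
  then show ?thesis by (simp add: cov_def algebra_simps)
qed

lemma p_nonneg: "0 \<le> p i n" and p_le_1: "p i n \<le> 1" and p_le_None: "p i n \<le> p None n"
proof -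
  show "0 \<le> p i n" unfolding p_def by (simp add: ind_nonneg)
  show "p i n \<le> 1" unfolding p_def by (rule integral_le_const[OF integrable_ind]) (simp add: ind_le_1)
  show "p i n \<le> p None n" unfolding p_def by (rule integral_mono[OF integrable_ind integrable_ind ind_le_None])
qed

end

section \<open>Domination of the covariances at large lags and second moments of sums\<close>

context extremogram_clt
begin

abbreviation \<alpha> :: "nat \<Rightarrow> nat \<Rightarrow> real \<Rightarrow> real" where "\<alpha> \<equiv> alpha_Y M X nrm \<gamma>"

abbreviation site_algebra :: "(real^'d) set \<Rightarrow> 'w measure" where
  "site_algebra \<Lambda> \<equiv> field_algebra M X (\<Union>s\<in>\<Lambda>. zball nrm s \<gamma>)"

lemma site_algebra_subalgebra: "subalgebra M (site_algebra \<Lambda>)"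
  by (rule field_algebra_subalgebra) simp

lemma ind_site_measurable: "s \<in> \<Lambda> \<Longrightarrow> s \<in> Zd \<Longrightarrow> ind i n s \<in> borel_measurable (site_algebra \<Lambda>)"
  by (rule ind_field_measurable) auto

lemma cov_alpha_bound:
  assumes u: "u \<in> Zd"
  shows "\<bar>cov i j n u\<bar> \<le> 4 * \<alpha> 1 1 (nrm u)"
proof -
  have "\<bar>expectation (\<lambda>\<omega>. ind i n 0 \<omega> * ind j n u \<omega>) - expectation (ind i n 0) * expectation (ind j n u)\<bar>
      \<le> 4 * 1 * 1 * \<alpha> 1 1 (nrm u)"
  proof (rule covariance_inequality[OF site_algebra_subalgebra[of "{0}"] site_algebra_subalgebra[of "{u}"]])
    fix P Q assume P: "P \<in> sets (site_algebra {0})" and Q: "Q \<in> sets (site_algebra {u})"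
    show "\<bar>prob (P \<inter> Q) - prob P * prob Q\<bar> \<le> \<alpha> 1 1 (nrm u)"
    proof (rule alpha_Y_upper[of "{0}" _ "{u}"])
      show "P \<in> gen_sigma M X (\<Union>s\<in>{0}. zball nrm s \<gamma>)" using P unfolding sets_field_algebra .
      show "Q \<in> gen_sigma M X (\<Union>s\<in>{u}. zball nrm s \<gamma>)" using Q unfolding sets_field_algebra .
    qed (use u zero_in_Zd nrm_facts in auto)
  next
    show "ind i n 0 \<in> borel_measurable (site_algebra {0})" by (rule ind_site_measurable) (auto simp: zero_in_Zd)
    show "ind j n u \<in> borel_measurable (site_algebra {u})" by (rule ind_site_measurable) (auto simp: u)
  qed (simp_all add: ind_nonneg ind_le_1)
  then show ?thesis by (simp add: cov_def expectation_ind)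
qed

text \<open>A majorant that serves all pairs i, j at once, since each event implies the one with
  index \<open>None\<close>. Up to distance r_n joint exceedances are counted, as (M3) permits;
  beyond it mixing takes over.\<close>

definition cov_bound :: "nat \<Rightarrow> real^'d \<Rightarrow> real" where
  "cov_bound n u = (if nrm u \<le> r n then expectation (\<lambda>\<omega>. ind None n 0 \<omega> * ind None n u \<omega>) + (p None n)\<^sup>2
     else 4 * \<alpha> 1 1 (nrm u))"

lemma cov_le_cov_bound:
  assumes u: "u \<in> Zd"
  shows "\<bar>cov i j n u\<bar> \<le> cov_bound n u"
proof (cases "nrm u \<le> r n")
  case True
  have 1: "expectation (\<lambda>\<omega>. ind i n 0 \<omega> * ind j n u \<omega>) \<le> expectation (\<lambda>\<omega>. ind None n 0 \<omega> * ind None n u \<omega>)"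
    by (intro integral_mono integrable_ind_mult mult_mono ind_le_None ind_nonneg)
  have 2: "0 \<le> expectation (\<lambda>\<omega>. ind i n 0 \<omega> * ind j n u \<omega>)" by (simp add: ind_nonneg)
  have 3: "p i n * p j n \<le> (p None n)\<^sup>2"
    unfolding power2_eq_square by (intro mult_mono p_le_None p_nonneg)
  have 4: "0 \<le> p i n * p j n" by (simp add: p_nonneg)
  show ?thesis unfolding cov_bound_def cov_def using True 1 2 3 4 by simp
qed (use cov_alpha_bound[OF u] in \<open>simp add: cov_bound_def\<close>)

lemma finite_ball: "finite {u \<in> Zd. nrm u \<le> k}"
  by (rule lattice_ball_card[OF norm]) blast

text \<open>Halving e turns the weak inequality satisfied by the points of A into the strict
  exceedance that (M3) speaks of. The centre of each ball already realises the maximum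
  bound.\<close>

lemma joint_exceedance_bound:
  assumes e: "0 < e" "\<And>x. x \<in> A \<Longrightarrow> ereal e \<le> \<bar>x\<bar>" and n: "1 \<le> n" and u: "u \<in> Zd"
  shows "expectation (\<lambda>\<omega>. ind None n 0 \<omega> * ind None n u \<omega>)
    \<le> \<P>(\<omega> in M. Max ((\<lambda>s. \<bar>X s \<omega>\<bar>) ` zball nrm 0 \<gamma>) > e / 2 * a (m n) \<and>
                      Max ((\<lambda>s. \<bar>X s \<omega>\<bar>) ` zball nrm u \<gamma>) > e / 2 * a (m n))"
proof -
  have "1 \<le> m n" using m_pos n by (simp add: Suc_leI)
  then have a: "0 < a (m n)" using regvar by (simp add: regularly_varying_def)
  have Max: "Max ((\<lambda>s. \<bar>X s \<omega>\<bar>) ` zball nrm v \<gamma>) > c \<longleftrightarrow> (\<exists>s\<in>zball nrm v \<gamma>. \<bar>X s \<omega>\<bar> > c)" if "v \<in> Zd" for v \<omega> and c :: real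
    using finite_zball[of v] shifted_in_ball(1)[OF that] by (subst Max_gr_iff) auto
  have imp: "\<bar>X v \<omega>\<bar> > e / 2 * a (m n)" if "ereal (X v \<omega> / a (m n)) \<in> A" for v \<omega>
  proof -
    have "e \<le> \<bar>X v \<omega>\<bar> / a (m n)" using e(2)[OF that] a by (simp add: abs_divide)
    then have "e * a (m n) \<le> \<bar>X v \<omega>\<bar>" using a by (simp add: pos_le_divide_eq)
    moreover have "e / 2 * a (m n) < e * a (m n)" using e a by simp
    ultimately show ?thesis by linarith
  qed
  show ?thesis unfolding expectation_ind_mult
  proof (rule finite_measure_mono)
    have [measurable]: "{\<omega> \<in> space M. \<exists>s\<in>zball nrm v \<gamma>. \<bar>X s \<omega>\<bar> > e / 2 * a (m n)} \<in> events" for v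
      by (rule sets.sets_Collect_finite_Ex[OF _ finite_zball]) measurable
    have "{\<omega> \<in> space M. (\<exists>s\<in>zball nrm 0 \<gamma>. \<bar>X s \<omega>\<bar> > e / 2 * a (m n)) \<and> (\<exists>s\<in>zball nrm u \<gamma>. \<bar>X s \<omega>\<bar> > e / 2 * a (m n))} \<in> events"
      by (rule sets.sets_Collect_conj) measurable
    then show "{\<omega> \<in> space M. Max ((\<lambda>s. \<bar>X s \<omega>\<bar>) ` zball nrm 0 \<gamma>) > e / 2 * a (m n) \<and>
                      Max ((\<lambda>s. \<bar>X s \<omega>\<bar>) ` zball nrm u \<gamma>) > e / 2 * a (m n)} \<in> events"
      unfolding Max[OF zero_in_Zd] Max[OF u] .
    show "{\<omega> \<in> space M. vec_scaled X nrm \<gamma> (a (m n)) 0 \<omega> \<in> D_set None \<and> vec_scaled X nrm \<gamma> (a (m n)) u \<omega> \<in> D_set None}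
      \<subseteq> {\<omega> \<in> space M. Max ((\<lambda>s. \<bar>X s \<omega>\<bar>) ` zball nrm 0 \<gamma>) > e / 2 * a (m n) \<and>
                      Max ((\<lambda>s. \<bar>X s \<omega>\<bar>) ` zball nrm u \<gamma>) > e / 2 * a (m n)}"
      unfolding Max[OF zero_in_Zd] Max[OF u] vec_scaled_in_D_set
      using imp shifted_in_ball(1)[OF u] zero_in_ball by blast
  qed
qed

lemma r_ge_1: "\<forall>\<^sub>F n in sequentially. 1 \<le> r n"
  using m_r(2) by (auto simp: filterlim_at_top)

text \<open>The products of means within distance r_n add up to order r^d m^d p^2 = (r / m)^d (m^d
  p)^2, and here r_n / m_n -> 0 enters.\<close>

lemma ball_card_p_limit: "(\<lambda>n. real (card {u \<in> Zd. nrm u \<le> r n}) * (real (m n) ^ CARD('d) * (p None n)\<^sup>2)) \<longlonglongrightarrow> 0"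
proof -
  obtain C where C: "0 < C" "\<And>R. 1 \<le> R \<Longrightarrow> real (card {u \<in> Zd. nrm u \<le> R}) \<le> C * R ^ CARD('d)"
    by (rule lattice_ball_card[OF norm]) blast
  let ?b = "\<lambda>n. C * (r n / real (m n)) ^ CARD('d) * (real (m n) ^ CARD('d) * p None n)\<^sup>2"
  have "?b \<longlonglongrightarrow> C * 0 ^ CARD('d) * (measure (\<mu> (zball nrm 0 \<gamma>)) (D_set None))\<^sup>2"
    by (intro tendsto_intros m_r scaled_p_limit)
  moreover have "C * 0 ^ CARD('d) * (measure (\<mu> (zball nrm 0 \<gamma>)) (D_set None))\<^sup>2 = 0" by (simp add: power_0_left)
  ultimately have lim: "?b \<longlonglongrightarrow> 0" by (simp only:)
  have up: "\<forall>\<^sub>F n in sequentially. real (card {u \<in> Zd. nrm u \<le> r n}) * (real (m n) ^ CARD('d) * (p None n)\<^sup>2) \<le> ?b n"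
    using r_ge_1 eventually_ge_at_top[of 1]
  proof eventually_elim
    case (elim n)
    have m0: "0 < real (m n) ^ CARD('d)" using m_pos elim(2) by simp
    have "real (card {u \<in> Zd. nrm u \<le> r n}) * (real (m n) ^ CARD('d) * (p None n)\<^sup>2) \<le> (C * r n ^ CARD('d)) * (real (m n) ^ CARD('d) * (p None n)\<^sup>2)"
      using C(2)[OF elim(1)] by (rule mult_right_mono) simp
    also have "\<dots> = ?b n" using m0 by (simp add: power_divide power2_eq_square)
    finally show ?case .
  qed
  have low: "\<forall>\<^sub>F n in sequentially. 0 \<le> real (card {u \<in> Zd. nrm u \<le> r n}) * (real (m n) ^ CARD('d) * (p None n)\<^sup>2)"
    by simp
  show ?thesis by (rule tendsto_sandwich[OF low up tendsto_const lim])
qed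

text \<open>Three contributions, each eventually at most \<epsilon>/3: joint exceedances up to r_n
  by (M3), which also fixes k; the products of means; and the mixing bound beyond r_n by
  (M4)(i).\<close>

lemma cov_bound_tail:
  assumes \<epsilon>: "0 < \<epsilon>"
  shows "\<exists>k. \<forall>\<^sub>F n in sequentially. \<forall>F. finite F \<longrightarrow> F \<subseteq> {u \<in> Zd. k < nrm u} \<longrightarrow>
    (\<Sum>u\<in>F. real (m n) ^ CARD('d) * cov_bound n u) \<le> \<epsilon>"
proof -
  obtain e where e: "0 < e" "\<And>x. x \<in> A \<Longrightarrow> ereal e \<le> \<bar>x\<bar>" using A(1) by (auto simp: continuity_set_def)
  define S where "S k n = (\<Sum>u\<in>{u \<in> Zd. real k < nrm u \<and> nrm u \<le> r n}. real (m n) ^ CARD('d) *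
          \<P>(\<omega> in M. Max ((\<lambda>s. \<bar>X s \<omega>\<bar>) ` zball nrm 0 \<gamma>) > e / 2 * a (m n) \<and>
                      Max ((\<lambda>s. \<bar>X s \<omega>\<bar>) ` zball nrm u \<gamma>) > e / 2 * a (m n)))" for k n
  have "(\<lambda>k. limsup (\<lambda>n. ereal (S k n))) \<longlonglongrightarrow> 0"
    unfolding S_def by (rule M3[rule_format]) (use e(1) in simp)
  from order_tendstoD(2)[OF this, of "ereal (\<epsilon> / 3)"] \<epsilon>
  obtain k where k: "limsup (\<lambda>n. ereal (S k n)) < ereal (\<epsilon> / 3)" by (auto simp: eventually_sequentially)
  have e1: "\<forall>\<^sub>F n in sequentially. ereal (S k n) < ereal (\<epsilon> / 3)" by (rule Limsup_lessD[OF k])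
  have e2: "\<forall>\<^sub>F n in sequentially. real (card {u \<in> Zd. nrm u \<le> r n}) * (real (m n) ^ CARD('d) * (p None n)\<^sup>2) < \<epsilon> / 3"
    by (rule order_tendstoD[OF ball_card_p_limit]) (use \<epsilon> in simp)
  have "(\<lambda>n. 4 * (real (m n) ^ CARD('d) * (\<Sum>\<^sub>\<infinity>u\<in>{u \<in> Zd. nrm u > r n}. \<alpha> 1 1 (nrm u)))) \<longlonglongrightarrow> 4 * 0"
    by (intro tendsto_intros M4_i)
  then have e3: "\<forall>\<^sub>F n in sequentially. 4 * (real (m n) ^ CARD('d) * (\<Sum>\<^sub>\<infinity>u\<in>{u \<in> Zd. nrm u > r n}. \<alpha> 1 1 (nrm u))) < \<epsilon> / 3"
    by (rule order_tendstoD) (use \<epsilon> in simp)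
  have summ: "(\<lambda>u. \<alpha> 1 1 (nrm u)) summable_on {u \<in> Zd. nrm u > x}" for x
    by (rule summable_on_subset[where A = Zd]) (use M4_ii in auto)
  have "\<forall>\<^sub>F n in sequentially. \<forall>F. finite F \<longrightarrow> F \<subseteq> {u \<in> Zd. real k < nrm u} \<longrightarrow>
    (\<Sum>u\<in>F. real (m n) ^ CARD('d) * cov_bound n u) \<le> \<epsilon>"
    using e1 e2 e3 eventually_ge_at_top[of 1]
  proof eventually_elim
    case (elim n)
    let ?md = "real (m n) ^ CARD('d)"
    show ?case
    proof (intro allI impI)
      fix F assume F: "finite F" "F \<subseteq> {u \<in> Zd. real k < nrm u}"
      let ?F1 = "{u \<in> F. nrm u \<le> r n}" and ?F2 = "{u \<in> F. \<not> nrm u \<le> r n}"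
      have "(\<Sum>u\<in>F. ?md * cov_bound n u) = (\<Sum>u\<in>?F1. ?md * cov_bound n u) + (\<Sum>u\<in>?F2. ?md * cov_bound n u)"
      proof -
        have "F = ?F1 \<union> ?F2" by blast
        moreover have "(\<Sum>u\<in>?F1 \<union> ?F2. ?md * cov_bound n u) = (\<Sum>u\<in>?F1. ?md * cov_bound n u) + (\<Sum>u\<in>?F2. ?md * cov_bound n u)"
          by (rule sum.union_disjoint) (use F(1) in auto)
        ultimately show ?thesis by (simp only:)
      qed
      also have "(\<Sum>u\<in>?F2. ?md * cov_bound n u) = 4 * (?md * (\<Sum>u\<in>?F2. \<alpha> 1 1 (nrm u)))"
        by (simp add: cov_bound_def sum_distrib_left mult_ac)
      also have "(\<Sum>u\<in>?F2. \<alpha> 1 1 (nrm u)) \<le> (\<Sum>\<^sub>\<infinity>u\<in>{u \<in> Zd. nrm u > r n}. \<alpha> 1 1 (nrm u))"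
        by (rule finite_sum_le_infsum[OF summ]) (use F in \<open>auto simp: alpha_Y_nonneg\<close>)
      also have "(\<Sum>u\<in>?F1. ?md * cov_bound n u)
          = (\<Sum>u\<in>?F1. ?md * expectation (\<lambda>\<omega>. ind None n 0 \<omega> * ind None n u \<omega>)) + real (card ?F1) * (?md * (p None n)\<^sup>2)"
        by (simp add: cov_bound_def distrib_left sum.distrib)
      also have "(\<Sum>u\<in>?F1. ?md * expectation (\<lambda>\<omega>. ind None n 0 \<omega> * ind None n u \<omega>)) \<le> S k n"
      proof -
        have "(\<Sum>u\<in>?F1. ?md * expectation (\<lambda>\<omega>. ind None n 0 \<omega> * ind None n u \<omega>)) \<le> (\<Sum>u\<in>?F1. ?md *
          \<P>(\<omega> in M. Max ((\<lambda>s. \<bar>X s \<omega>\<bar>) ` zball nrm 0 \<gamma>) > e / 2 * a (m n) \<and>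
                      Max ((\<lambda>s. \<bar>X s \<omega>\<bar>) ` zball nrm u \<gamma>) > e / 2 * a (m n)))"
          using F(2) by (intro sum_mono mult_left_mono joint_exceedance_bound[OF e elim(4)]) auto
        also have "\<dots> \<le> S k n"
          unfolding S_def
        proof (rule sum_mono2)
          show "finite {u \<in> Zd. real k < nrm u \<and> nrm u \<le> r n}"
            by (rule finite_subset[OF _ finite_ball[of "r n"]]) auto
        qed (use F(2) in auto)
        finally show ?thesis .
      qed
      also have "real (card ?F1) * (?md * (p None n)\<^sup>2) \<le> real (card {u \<in> Zd. nrm u \<le> r n}) * (?md * (p None n)\<^sup>2)"
        using F(2) by (intro mult_right_mono of_nat_mono card_mono finite_ball) auto
      finally show "(\<Sum>u\<in>F. ?md * cov_bound n u) \<le> \<epsilon>" using elim(1-3) by (simp add: mult_left_mono)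
    qed
  qed
  then show ?thesis by blast
qed

lemma cov_tail:
  assumes \<epsilon>: "0 < \<epsilon>"
  shows "\<exists>k. \<forall>\<^sub>F n in sequentially. \<forall>F. finite F \<longrightarrow> F \<subseteq> {u \<in> Zd. k < nrm u} \<longrightarrow>
    (\<Sum>u\<in>F. \<bar>real (m n) ^ CARD('d) * cov i j n u\<bar>) \<le> \<epsilon>"
proof -
  obtain k where "\<forall>\<^sub>F n in sequentially. \<forall>F. finite F \<longrightarrow> F \<subseteq> {u \<in> Zd. k < nrm u} \<longrightarrow>
    (\<Sum>u\<in>F. real (m n) ^ CARD('d) * cov_bound n u) \<le> \<epsilon>" using cov_bound_tail[OF \<epsilon>] by blast
  then have "\<forall>\<^sub>F n in sequentially. \<forall>F. finite F \<longrightarrow> F \<subseteq> {u \<in> Zd. k < nrm u} \<longrightarrow>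
    (\<Sum>u\<in>F. \<bar>real (m n) ^ CARD('d) * cov i j n u\<bar>) \<le> \<epsilon>"
  proof eventually_elim
    case (elim n)
    show ?case
    proof (intro allI impI)
      fix F assume F: "finite F" "F \<subseteq> {u \<in> Zd. k < nrm u}"
      have "(\<Sum>u\<in>F. \<bar>real (m n) ^ CARD('d) * cov i j n u\<bar>) \<le> (\<Sum>u\<in>F. real (m n) ^ CARD('d) * cov_bound n u)"
        using F(2) by (intro sum_mono) (auto simp: abs_mult intro!: mult_left_mono cov_le_cov_bound)
      then show "(\<Sum>u\<in>F. \<bar>real (m n) ^ CARD('d) * cov i j n u\<bar>) \<le> \<epsilon>" using elim[rule_format, OF F] by linarith
    qed
  qed
  then show ?thesis by blast
qed

lemma kappa_summable: "\<kappa> i j summable_on Zd"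
  by (rule tannery_summable[OF finite_ball cov_limit cov_tail])

lemma cov_sum_bounded:
  "\<exists>C. \<forall>\<^sub>F n in sequentially. \<forall>F. finite F \<longrightarrow> F \<subseteq> Zd \<longrightarrow> (\<Sum>u\<in>F. \<bar>real (m n) ^ CARD('d) * cov i j n u\<bar>) \<le> C"
  by (rule tannery_bounded[OF finite_ball cov_limit cov_tail])

text \<open>One site's contribution to a linear combination of all p + 1 centred counts. Leaving c
  arbitrary covers both the projections of the limit vector and the individual counts.\<close>

definition \<xi> :: "('p option \<Rightarrow> real) \<Rightarrow> nat \<Rightarrow> real^'d \<Rightarrow> 'w \<Rightarrow> real" where
  "\<xi> c n s \<omega> = (\<Sum>i\<in>UNIV. c i * (ind i n s \<omega> - p i n))"

definition cov_comb :: "('p option \<Rightarrow> real) \<Rightarrow> nat \<Rightarrow> real^'d \<Rightarrow> real" where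
  "cov_comb c n u = (\<Sum>i\<in>UNIV. \<Sum>j\<in>UNIV. c i * c j * cov i j n u)"

text \<open>The quadratic form of \<open>Sigma_mat\<close> at c, as \<open>Sigma_entry\<close> will
  show.\<close>

definition asym_var :: "('p option \<Rightarrow> real) \<Rightarrow> real" where
  "asym_var c = (\<Sum>i\<in>UNIV. \<Sum>j\<in>UNIV. c i * c j * (\<Sum>\<^sub>\<infinity>u\<in>Zd. \<kappa> i j u))"

definition coeff_norm :: "('p option \<Rightarrow> real) \<Rightarrow> real" where "coeff_norm c = (\<Sum>i\<in>UNIV. \<bar>c i\<bar>)"

lemma coeff_norm_nonneg: "0 \<le> coeff_norm c" by (simp add: coeff_norm_def sum_nonneg)

lemma xi_measurable[measurable]: "\<xi> c n s \<in> borel_measurable M"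
  unfolding \<xi>_def by measurable

lemma xi_site_measurable: "s \<in> \<Lambda> \<Longrightarrow> s \<in> Zd \<Longrightarrow> \<xi> c n s \<in> borel_measurable (site_algebra \<Lambda>)"
  unfolding \<xi>_def
  by (intro borel_measurable_sum borel_measurable_times borel_measurable_diff borel_measurable_const ind_site_measurable)

lemma xi_bound: "\<bar>\<xi> c n s \<omega>\<bar> \<le> coeff_norm c"
  unfolding \<xi>_def coeff_norm_def
proof (rule order_trans[OF sum_abs sum_mono])
  fix i
  have "\<bar>ind i n s \<omega> - p i n\<bar> \<le> 1"
    using ind_nonneg[of i n s \<omega>] ind_le_1[of i n s \<omega>] p_nonneg[of i n] p_le_1[of i n] by linarith
  then show "\<bar>c i * (ind i n s \<omega> - p i n)\<bar> \<le> \<bar>c i\<bar>"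
    using mult_left_mono[of "\<bar>ind i n s \<omega> - p i n\<bar>" 1 "\<bar>c i\<bar>"] by (simp add: abs_mult)
qed

lemma xi_mult_integrable: "integrable M (\<lambda>\<omega>. \<xi> c n s \<omega> * \<xi> c n t \<omega>)"
proof (rule integrable_const_bound[of _ "coeff_norm c * coeff_norm c"])
  show "AE \<omega> in M. norm (\<xi> c n s \<omega> * \<xi> c n t \<omega>) \<le> coeff_norm c * coeff_norm c"
    by (rule AE_I2) (simp only: real_norm_def abs_mult, intro mult_mono xi_bound coeff_norm_nonneg abs_ge_zero)
qed simp

lemma xi_mean: "expectation (\<xi> c n s) = 0"
proof -
  have "expectation (\<xi> c n s) = (\<Sum>i\<in>UNIV. c i * (expectation (ind i n s) - p i n))"
    unfolding \<xi>_def using integrable_ind by (simp add: prob_space)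
  then show ?thesis by (simp add: expectation_ind)
qed

lemma xi_cov: "expectation (\<lambda>\<omega>. \<xi> c n s \<omega> * \<xi> c n t \<omega>) = cov_comb c n (t - s)"
proof -
  have i: "integrable M (\<lambda>\<omega>. (ind i n s \<omega> - p i n) * (ind j n t \<omega> - p j n))" for i j
    using integrable_ind_mult[of i n s j t] integrable_ind by (simp add: algebra_simps)
  have "\<xi> c n s \<omega> * \<xi> c n t \<omega> = (\<Sum>i\<in>UNIV. \<Sum>j\<in>UNIV. c i * c j * ((ind i n s \<omega> - p i n) * (ind j n t \<omega> - p j n)))" for \<omega>
    unfolding \<xi>_def sum_product by (simp add: mult_ac)
  then have "expectation (\<lambda>\<omega>. \<xi> c n s \<omega> * \<xi> c n t \<omega>)
    = (\<Sum>i\<in>UNIV. \<Sum>j\<in>UNIV. c i * c j * expectation (\<lambda>\<omega>. (ind i n s \<omega> - p i n) * (ind j n t \<omega> - p j n)))"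
    using i by simp
  then show ?thesis by (simp add: cov_stationary cov_comb_def)
qed

lemma cov_comb_sum_bounded:
  "\<exists>C>0. \<forall>\<^sub>F n in sequentially. \<forall>F. finite F \<longrightarrow> F \<subseteq> Zd \<longrightarrow> (\<Sum>u\<in>F. real (m n) ^ CARD('d) * \<bar>cov_comb c n u\<bar>) \<le> C"
proof -
  have "\<forall>ij. \<exists>C. \<forall>\<^sub>F n in sequentially. \<forall>F. finite F \<longrightarrow> F \<subseteq> Zd \<longrightarrow>
      (\<Sum>u\<in>F. \<bar>real (m n) ^ CARD('d) * cov (fst ij) (snd ij) n u\<bar>) \<le> C"
    by (intro allI cov_sum_bounded)
  from choice[OF this] obtain C where C: "\<forall>ij. \<forall>\<^sub>F n in sequentially. \<forall>F. finite F \<longrightarrow> F \<subseteq> Zd \<longrightarrow>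
      (\<Sum>u\<in>F. \<bar>real (m n) ^ CARD('d) * cov (fst ij) (snd ij) n u\<bar>) \<le> C ij" ..
  let ?C = "\<bar>\<Sum>i\<in>UNIV. \<Sum>j\<in>UNIV. \<bar>c i * c j\<bar> * C (i, j)\<bar> + 1"
  have "\<forall>\<^sub>F n in sequentially. \<forall>ij\<in>UNIV. \<forall>F. finite F \<longrightarrow> F \<subseteq> Zd \<longrightarrow>
      (\<Sum>u\<in>F. \<bar>real (m n) ^ CARD('d) * cov (fst ij) (snd ij) n u\<bar>) \<le> C ij"
    by (rule eventually_ball_finite) (use C in auto)
  then have "\<forall>\<^sub>F n in sequentially. \<forall>F. finite F \<longrightarrow> F \<subseteq> Zd \<longrightarrow> (\<Sum>u\<in>F. real (m n) ^ CARD('d) * \<bar>cov_comb c n u\<bar>) \<le> ?C"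
  proof eventually_elim
    case (elim n)
    show ?case
    proof (intro allI impI)
      fix F :: "(real^'d) set" assume F: "finite F" "F \<subseteq> Zd"
      let ?md = "real (m n) ^ CARD('d)"
      have "(\<Sum>u\<in>F. ?md * \<bar>cov_comb c n u\<bar>) \<le> (\<Sum>u\<in>F. ?md * (\<Sum>i\<in>UNIV. \<Sum>j\<in>UNIV. \<bar>c i * c j\<bar> * \<bar>cov i j n u\<bar>))"
        unfolding cov_comb_def
        by (intro sum_mono mult_left_mono order_trans[OF sum_abs]) (auto simp: abs_mult)
      also have "\<dots> = (\<Sum>u\<in>F. \<Sum>i\<in>UNIV. \<Sum>j\<in>UNIV. \<bar>c i * c j\<bar> * \<bar>?md * cov i j n u\<bar>)"
        by (simp add: sum_distrib_left abs_mult mult_ac)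
      also have "\<dots> = (\<Sum>i\<in>UNIV. \<Sum>j\<in>UNIV. \<bar>c i * c j\<bar> * (\<Sum>u\<in>F. \<bar>?md * cov i j n u\<bar>))"
        unfolding sum_distrib_left by (subst sum.swap) (intro sum.cong refl sum.swap)
      also have "\<dots> \<le> (\<Sum>i\<in>UNIV. \<Sum>j\<in>UNIV. \<bar>c i * c j\<bar> * C (i, j))"
      proof (intro sum_mono mult_left_mono)
        fix i j show "(\<Sum>u\<in>F. \<bar>?md * cov i j n u\<bar>) \<le> C (i, j)"
          using bspec[OF elim, of "(i, j)"] F by simp
      qed simp
      finally show "(\<Sum>u\<in>F. ?md * \<bar>cov_comb c n u\<bar>) \<le> ?C" by linarith
    qed
  qed
  then show ?thesis by (intro exI[of _ ?C]) auto
qed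

text \<open>Each row of the double sum of covariances is, after translation, a sum over distinct
  lags and hence bounded. Uniformity in F matters: the bound is applied to neighbourhoods, to lagged
  grids and to their complements.\<close>

lemma sum_second_moment:
  "\<exists>C>0. \<forall>\<^sub>F n in sequentially. \<forall>F. finite F \<longrightarrow> F \<subseteq> Zd \<longrightarrow>
    real (m n) ^ CARD('d) * expectation (\<lambda>\<omega>. (\<Sum>s\<in>F. \<xi> c n s \<omega>)\<^sup>2) \<le> C * real (card F)"
proof -
  obtain C where C: "0 < C" "\<forall>\<^sub>F n in sequentially. \<forall>F. finite F \<longrightarrow> F \<subseteq> Zd \<longrightarrow> (\<Sum>u\<in>F. real (m n) ^ CARD('d) * \<bar>cov_comb c n u\<bar>) \<le> C"
    using cov_comb_sum_bounded by blast
  from C(2) have "\<forall>\<^sub>F n in sequentially. \<forall>F. finite F \<longrightarrow> F \<subseteq> Zd \<longrightarrow>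
    real (m n) ^ CARD('d) * expectation (\<lambda>\<omega>. (\<Sum>s\<in>F. \<xi> c n s \<omega>)\<^sup>2) \<le> C * real (card F)"
  proof eventually_elim
    case (elim n)
    show ?case
    proof (intro allI impI)
      fix F :: "(real^'d) set" assume F: "finite F" "F \<subseteq> Zd"
      let ?md = "real (m n) ^ CARD('d)"
      have "expectation (\<lambda>\<omega>. (\<Sum>s\<in>F. \<xi> c n s \<omega>)\<^sup>2) = (\<Sum>s\<in>F. \<Sum>t\<in>F. cov_comb c n (t - s))"
        unfolding power2_eq_square sum_product using xi_mult_integrable by (simp add: xi_cov)
      then have "?md * expectation (\<lambda>\<omega>. (\<Sum>s\<in>F. \<xi> c n s \<omega>)\<^sup>2) = (\<Sum>s\<in>F. \<Sum>t\<in>F. ?md * cov_comb c n (t - s))"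
        by (simp add: sum_distrib_left)
      also have "\<dots> \<le> (\<Sum>s\<in>F. C)"
      proof (rule sum_mono)
        fix s assume s: "s \<in> F"
        have "(\<Sum>t\<in>F. ?md * cov_comb c n (t - s)) \<le> (\<Sum>t\<in>F. ?md * \<bar>cov_comb c n (t - s)\<bar>)"
          by (intro sum_mono mult_left_mono) auto
        also have "\<dots> = (\<Sum>u\<in>(\<lambda>t. t - s) ` F. ?md * \<bar>cov_comb c n u\<bar>)"
          by (subst sum.reindex) (auto simp: inj_on_def)
        also have "\<dots> \<le> C"
        proof -
          have "(\<lambda>t. t - s) ` F \<subseteq> Zd" using F(2) s by (auto intro: Zd_diff)
          then show ?thesis by (rule elim[rule_format, OF finite_imageI[OF F(1)]])
        qed
        finally show "(\<Sum>t\<in>F. ?md * cov_comb c n (t - s)) \<le> C" .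
      qed
      finally show "?md * expectation (\<lambda>\<omega>. (\<Sum>s\<in>F. \<xi> c n s \<omega>)\<^sup>2) \<le> C * real (card F)" by (simp add: mult.commute)
    qed
  qed
  then show ?thesis using C(1) by blast
qed

end

section \<open>Central limit theorem for the exceedance counts\<close>

context extremogram_clt
begin

text \<open>This is (m_n / n)^(d/2), the scaling of the counts and the inverse of the scaling of the
  extremograms.\<close>

definition b :: "nat \<Rightarrow> real" where "b n = sqrt (real (m n) / real n) ^ CARD('d)"

definition nbh :: "nat \<Rightarrow> real^'d \<Rightarrow> (real^'d) set" where "nbh n s = {t \<in> grid n. nrm (t - s) \<le> r n}"

abbreviation lball :: "nat \<Rightarrow> (real^'d) set" where "lball n \<equiv> {u \<in> Zd. nrm u \<le> r n}"

lemma b_nonneg: "0 \<le> b n" by (simp add: b_def)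

lemma b_square: "(b n)\<^sup>2 = real (m n) ^ CARD('d) / real n ^ CARD('d)"
proof -
  have "(b n)\<^sup>2 = ((sqrt (real (m n) / real n))\<^sup>2) ^ CARD('d)" by (metis b_def power_mult mult.commute)
  then show ?thesis by (simp add: power_divide)
qed

lemma grid_Zd: "s \<in> grid n \<Longrightarrow> s \<in> Zd" for s :: "real^'d" using grid_subset_Zd by blast

lemma grid_diff: "s \<in> grid n \<Longrightarrow> t \<in> grid n \<Longrightarrow> s - t \<in> Zd" for s t :: "real^'d"
  by (intro Zd_diff grid_Zd)

lemma finite_nbh: "finite (nbh n s)"
  unfolding nbh_def by (rule finite_subset[OF _ finite_grid[of n]]) auto

lemma nbh_subset: "nbh n s \<subseteq> grid n" by (auto simp: nbh_def)

lemma card_nbh_le: "s \<in> grid n \<Longrightarrow> card (nbh n s) \<le> card (lball n)"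
  by (rule card_inj_on_le[of "\<lambda>t. t - s", OF _ _ finite_ball]) (auto simp: nbh_def inj_on_def intro: grid_diff)

text \<open>Ordering the pairs by their difference u leaves one term for every s with both s and s +
  u in the grid.\<close>

lemma nbh_sum:
  fixes f :: "real^'d \<Rightarrow> real"
  shows "(\<Sum>s\<in>grid n. \<Sum>t\<in>nbh n s. f (t - s)) = (\<Sum>u\<in>lball n. real (card (grid_lag n u)) * f u)"
proof -
  have "(\<Sum>s\<in>grid n. \<Sum>t\<in>nbh n s. f (t - s)) = (\<Sum>(s, t)\<in>Sigma (grid n) (nbh n). f (t - s))"
    by (rule sum.Sigma) (auto simp: finite_grid finite_nbh)
  also have "\<dots> = (\<Sum>(u, s)\<in>Sigma (lball n) (grid_lag n). f u)"
    by (rule sum.reindex_bij_witness[where i = "\<lambda>(u, s). (s, s + u)" and j = "\<lambda>(s, t). (t - s, s)"])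
      (auto simp: nbh_def grid_lag_def intro: grid_diff)
  also have "\<dots> = (\<Sum>u\<in>lball n. \<Sum>s\<in>grid_lag n u. f u)"
  proof (rule sum.Sigma[symmetric])
    show "\<forall>u\<in>lball n. finite (grid_lag n u)" using finite_grid[of n] by (auto simp: grid_lag_def)
  qed (rule finite_ball)
  finally show ?thesis by simp
qed

lemma card_grid_lag_le: "real (card (grid_lag n u)) \<le> real n ^ CARD('d)" for u :: "real^'d"
proof -
  have "card (grid_lag n u) \<le> card (grid n :: (real^'d) set)"
    by (rule card_mono[OF finite_grid]) (auto simp: grid_lag_def)
  then show ?thesis unfolding card_grid of_nat_power[symmetric] by (rule of_nat_mono)
qed

text \<open>Grouped by lags, b^2 leaves the factor m^d for the covariances and the weights
  |grid_lag| / n^d; truncation at r_n disappears in the limit by \<open>tannery\<close>.\<close>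

lemma nbh_cov_limit: "(\<lambda>n. (b n)\<^sup>2 * (\<Sum>s\<in>grid n. \<Sum>t\<in>nbh n s. cov_comb c n (t - s))) \<longlonglongrightarrow> asym_var c"
proof -
  let ?w = "\<lambda>n (u::real^'d). real (card (grid_lag n u)) / real n ^ CARD('d)"
  have "(\<lambda>n. \<Sum>u\<in>lball n. ?w n u * (real (m n) ^ CARD('d) * cov i j n u)) \<longlonglongrightarrow> (\<Sum>\<^sub>\<infinity>u\<in>Zd. \<kappa> i j u)" for i j
  proof (rule tannery[OF finite_ball cov_limit cov_tail finite_ball])
    show "\<forall>\<^sub>F n in sequentially. u \<in> lball n" if "u \<in> Zd" for u
    proof -
      have "\<forall>\<^sub>F n in sequentially. nrm u \<le> r n" using m_r(2) by (auto simp: filterlim_at_top)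
      then show ?thesis by eventually_elim (use that in simp)
    qed
    show "?w n u \<le> 1" for n u using card_grid_lag_le[of n u] by (simp add: divide_le_eq)
    show "(\<lambda>n. ?w n u) \<longlonglongrightarrow> 1" if "u \<in> Zd" for u by (rule card_grid_lag_ratio[OF that])
  qed auto
  then have "(\<lambda>n. \<Sum>i\<in>UNIV. \<Sum>j\<in>UNIV. c i * c j * (\<Sum>u\<in>lball n. ?w n u * (real (m n) ^ CARD('d) * cov i j n u))) \<longlonglongrightarrow> asym_var c"
    unfolding asym_var_def by (intro tendsto_sum tendsto_mult tendsto_const)
  moreover have "(\<Sum>i\<in>UNIV. \<Sum>j\<in>UNIV. c i * c j * (\<Sum>u\<in>lball n. ?w n u * (real (m n) ^ CARD('d) * cov i j n u)))
      = (b n)\<^sup>2 * (\<Sum>s\<in>grid n. \<Sum>t\<in>nbh n s. cov_comb c n (t - s))" for n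
  proof -
    have "(b n)\<^sup>2 * (\<Sum>s\<in>grid n. \<Sum>t\<in>nbh n s. cov_comb c n (t - s))
      = (\<Sum>u\<in>lball n. ?w n u * (real (m n) ^ CARD('d) * cov_comb c n u))"
      unfolding nbh_sum b_square by (simp add: sum_distrib_left mult_ac)
    also have "\<dots> = (\<Sum>u\<in>lball n. \<Sum>i\<in>UNIV. \<Sum>j\<in>UNIV. c i * c j * (?w n u * (real (m n) ^ CARD('d) * cov i j n u)))"
      unfolding cov_comb_def by (simp add: sum_distrib_left mult_ac)
    also have "\<dots> = (\<Sum>i\<in>UNIV. \<Sum>j\<in>UNIV. \<Sum>u\<in>lball n. c i * c j * (?w n u * (real (m n) ^ CARD('d) * cov i j n u)))"
      by (subst sum.swap) (intro sum.cong refl sum.swap)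
    finally show ?thesis by (simp only: sum_distrib_left)
  qed
  ultimately show ?thesis by (simp only:)
qed

lemma alpha_summable: "(\<lambda>u. \<alpha> 2 2 (nrm u)) summable_on Zd"
  using M4_ii by simp

lemma alpha_grid_sum:
  assumes x: "x \<in> Zd"
  shows "(\<Sum>t\<in>grid n. \<alpha> 2 2 (nrm (t - x))) \<le> (\<Sum>\<^sub>\<infinity>u\<in>Zd. \<alpha> 2 2 (nrm u))"
proof -
  have "(\<Sum>t\<in>grid n. \<alpha> 2 2 (nrm (t - x))) = (\<Sum>u\<in>(\<lambda>t. t - x) ` grid n. \<alpha> 2 2 (nrm u))"
    by (subst sum.reindex) (auto simp: inj_on_def)
  also have "\<dots> \<le> (\<Sum>\<^sub>\<infinity>u\<in>Zd. \<alpha> 2 2 (nrm u))"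
    by (rule finite_sum_le_infsum[OF alpha_summable])
      (auto simp: alpha_Y_nonneg finite_grid intro: Zd_diff grid_Zd x)
  finally show ?thesis .
qed

text \<open>The distance of two pairs is attained by one of the four differences of sites, hence the
  coefficient is bounded by the sum of all four, and no separation into near and far pairs is needed.\<close>

lemma pair_covariance:
  assumes Z: "s \<in> Zd" "s' \<in> Zd" "t \<in> Zd" "t' \<in> Zd"
  shows "\<bar>expectation (\<lambda>\<omega>. (\<xi> c n s \<omega> * \<xi> c n s' \<omega>) * (\<xi> c n t \<omega> * \<xi> c n t' \<omega>))
      - expectation (\<lambda>\<omega>. \<xi> c n s \<omega> * \<xi> c n s' \<omega>) * expectation (\<lambda>\<omega>. \<xi> c n t \<omega> * \<xi> c n t' \<omega>)\<bar>
    \<le> 4 * coeff_norm c ^ 4 * (\<alpha> 2 2 (nrm (t - s)) + \<alpha> 2 2 (nrm (t' - s)) + \<alpha> 2 2 (nrm (t - s')) + \<alpha> 2 2 (nrm (t' - s')))"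
proof -
  let ?K = "coeff_norm c" and ?N = "{nrm (t - s), nrm (t' - s), nrm (t - s'), nrm (t' - s')}"
  define \<rho> where "\<rho> = Min ?N"
  have rN: "\<rho> \<in> ?N" unfolding \<rho>_def by (rule Min_in) auto
  have rle: "\<rho> \<le> x" if "x \<in> ?N" for x unfolding \<rho>_def using that by (intro Min_le) auto
  have xb: "\<bar>\<xi> c n x \<omega> * \<xi> c n y \<omega>\<bar> \<le> ?K * ?K" for x y \<omega>
    unfolding abs_mult by (intro mult_mono xi_bound coeff_norm_nonneg abs_ge_zero)
  have "\<bar>expectation (\<lambda>\<omega>. (\<xi> c n s \<omega> * \<xi> c n s' \<omega>) * (\<xi> c n t \<omega> * \<xi> c n t' \<omega>))
      - expectation (\<lambda>\<omega>. \<xi> c n s \<omega> * \<xi> c n s' \<omega>) * expectation (\<lambda>\<omega>. \<xi> c n t \<omega> * \<xi> c n t' \<omega>)\<bar>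
    \<le> 4 * (?K * ?K) * (?K * ?K) * \<alpha> 2 2 \<rho>"
  proof (rule covariance_inequality[OF site_algebra_subalgebra[of "{s, s'}"] site_algebra_subalgebra[of "{t, t'}"]])
    fix P Q assume P: "P \<in> sets (site_algebra {s, s'})" and Q: "Q \<in> sets (site_algebra {t, t'})"
    show "\<bar>prob (P \<inter> Q) - prob P * prob Q\<bar> \<le> \<alpha> 2 2 \<rho>"
    proof (rule alpha_Y_upper[of "{s, s'}" _ "{t, t'}"])
      show "P \<in> gen_sigma M X (\<Union>s\<in>{s, s'}. zball nrm s \<gamma>)" using P unfolding sets_field_algebra .
      show "Q \<in> gen_sigma M X (\<Union>s\<in>{t, t'}. zball nrm s \<gamma>)" using Q unfolding sets_field_algebra .
      fix x y assume "x \<in> {s, s'}" "y \<in> {t, t'}"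
      then show "\<rho> \<le> nrm (x - y)" unfolding nrm_minus_commute[OF norm, of x y] by (intro rle) auto
    qed (use Z in \<open>auto simp: card_insert_if\<close>)
  next
    show "(\<lambda>\<omega>. \<xi> c n s \<omega> * \<xi> c n s' \<omega>) \<in> borel_measurable (site_algebra {s, s'})"
      by (intro borel_measurable_times xi_site_measurable) (auto simp: Z)
    show "(\<lambda>\<omega>. \<xi> c n t \<omega> * \<xi> c n t' \<omega>) \<in> borel_measurable (site_algebra {t, t'})"
      by (intro borel_measurable_times xi_site_measurable) (auto simp: Z)
  qed (rule xb)+
  also have "\<dots> = 4 * ?K ^ 4 * \<alpha> 2 2 \<rho>" by (simp add: power4_eq_xxxx mult_ac)
  also have "\<dots> \<le> 4 * ?K ^ 4 * (\<alpha> 2 2 (nrm (t - s)) + \<alpha> 2 2 (nrm (t' - s)) + \<alpha> 2 2 (nrm (t - s')) + \<alpha> 2 2 (nrm (t' - s')))"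
  proof (rule mult_left_mono)
    have nn: "0 \<le> \<alpha> 2 2 x" for x by (rule alpha_Y_nonneg)
    show "\<alpha> 2 2 \<rho> \<le> \<alpha> 2 2 (nrm (t - s)) + \<alpha> 2 2 (nrm (t' - s)) + \<alpha> 2 2 (nrm (t - s')) + \<alpha> 2 2 (nrm (t' - s'))"
      using rN nn[of "nrm (t - s)"] nn[of "nrm (t' - s)"] nn[of "nrm (t - s')"] nn[of "nrm (t' - s')"]
      by (elim insertE) auto
  qed (simp add: coeff_norm_nonneg)
  finally show ?thesis .
qed

text \<open>The random substitute for the variance in Bolthausen's identity. It has to be close to a
  constant in L1.\<close>

definition V :: "('p option \<Rightarrow> real) \<Rightarrow> nat \<Rightarrow> 'w \<Rightarrow> real" where
  "V c n \<omega> = (b n)\<^sup>2 * (\<Sum>s\<in>grid n. \<Sum>t\<in>nbh n s. \<xi> c n s \<omega> * \<xi> c n t \<omega>)"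

lemma V_mean: "expectation (V c n) = (b n)\<^sup>2 * (\<Sum>s\<in>grid n. \<Sum>t\<in>nbh n s. cov_comb c n (t - s))"
  unfolding V_def using xi_mult_integrable by (simp add: xi_cov)

text \<open>The square is a sum over pairs of neighbouring pairs. Each such covariance is bounded by
  4 K^4 times four mixing coefficients, hence 16. Fixing a pair q and one of its sites, the other
  pair contributes a summable series times the size of a ball; the number of q supplies n^d and a
  second ball size.\<close>

lemma V_variance:
  "expectation (\<lambda>\<omega>. (V c n \<omega> - expectation (V c n))\<^sup>2)
    \<le> ((b n)\<^sup>2)\<^sup>2 * (16 * coeff_norm c ^ 4 * (\<Sum>\<^sub>\<infinity>u\<in>Zd. \<alpha> 2 2 (nrm u)) * (real (card (lball n)))\<^sup>2 * real n ^ CARD('d))"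
proof -
  let ?P = "Sigma (grid n) (nbh n)" and ?K = "coeff_norm c" and ?A = "\<Sum>\<^sub>\<infinity>u\<in>Zd. \<alpha> 2 2 (nrm u)"
  have finP: "finite ?P" using finite_grid finite_nbh by (intro finite_SigmaI) auto
  have A0: "0 \<le> ?A" by (rule infsum_nonneg) (rule alpha_Y_nonneg)
  define \<eta> where "\<eta> q \<omega> = \<xi> c n (fst q) \<omega> * \<xi> c n (snd q) \<omega>" for q \<omega>
  have ie: "integrable M (\<eta> q)" for q unfolding \<eta>_def by (rule xi_mult_integrable)
  have eb: "\<bar>\<eta> q \<omega>\<bar> \<le> ?K * ?K" for q \<omega>
    unfolding \<eta>_def abs_mult by (intro mult_mono xi_bound coeff_norm_nonneg abs_ge_zero)
  have iee: "integrable M (\<lambda>\<omega>. \<eta> q \<omega> * \<eta> q' \<omega>)" for q q'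
  proof (rule integrable_const_bound[of _ "(?K * ?K) * (?K * ?K)"])
    show "AE \<omega> in M. norm (\<eta> q \<omega> * \<eta> q' \<omega>) \<le> (?K * ?K) * (?K * ?K)"
      by (rule AE_I2, unfold real_norm_def abs_mult) (intro mult_mono eb abs_ge_zero mult_nonneg_nonneg coeff_norm_nonneg)
    show "(\<lambda>\<omega>. \<eta> q \<omega> * \<eta> q' \<omega>) \<in> borel_measurable M" unfolding \<eta>_def by measurable
  qed
  have iee': "integrable M (\<lambda>\<omega>. (\<eta> q \<omega> - expectation (\<eta> q)) * (\<eta> q' \<omega> - expectation (\<eta> q')))" for q q'
    using iee[of q q'] ie by (simp add: algebra_simps)
  have cv: "expectation (\<lambda>\<omega>. (\<eta> q \<omega> - expectation (\<eta> q)) * (\<eta> q' \<omega> - expectation (\<eta> q')))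
      = expectation (\<lambda>\<omega>. \<eta> q \<omega> * \<eta> q' \<omega>) - expectation (\<eta> q) * expectation (\<eta> q')" for q q'
    using iee[of q q'] ie by (simp add: algebra_simps prob_space)
  have Ve: "V c n \<omega> - expectation (V c n) = (b n)\<^sup>2 * (\<Sum>q\<in>?P. \<eta> q \<omega> - expectation (\<eta> q))" for \<omega>
  proof -
    have V: "V c n = (\<lambda>\<omega>. (b n)\<^sup>2 * (\<Sum>q\<in>?P. \<eta> q \<omega>))"
      unfolding V_def \<eta>_def by (subst sum.Sigma) (auto simp: finite_grid finite_nbh split_beta)
    show ?thesis unfolding V using ie by (simp add: sum_subtractf right_diff_distrib)
  qed
  have PZ: "fst q \<in> Zd" "snd q \<in> Zd" if "q \<in> ?P" for q
  proof -
    have "fst q \<in> grid n" "snd q \<in> grid n" using that by (auto simp: nbh_def)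
    then show "fst q \<in> Zd" "snd q \<in> Zd" by (auto intro: grid_Zd)
  qed
  \<comment> \<open>Being neighbours is symmetric, so the coordinates of the pairs may be exchanged.
    Thus the four sums reduce to sums over first coordinates.\<close>
  have swap: "(\<Sum>q\<in>?P. f (snd q)) = (\<Sum>q\<in>?P. f (fst q))" for f :: "real^'d \<Rightarrow> real"
    by (rule sum.reindex_bij_witness[where i = "\<lambda>(x, y). (y, x)" and j = "\<lambda>(x, y). (y, x)"])
      (auto simp: nbh_def nrm_minus_commute[OF norm])
  \<comment> \<open>The first site of q runs through the grid against the fixed x, and the second
    has at most \<open>card (lball n)\<close> choices.\<close>
  have part: "(\<Sum>q\<in>?P. \<alpha> 2 2 (nrm (fst q - x))) \<le> real (card (lball n)) * ?A" if "x \<in> Zd" for x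
  proof -
    have "(\<Sum>q\<in>?P. \<alpha> 2 2 (nrm (fst q - x))) = (\<Sum>t\<in>grid n. real (card (nbh n t)) * \<alpha> 2 2 (nrm (t - x)))"
    proof -
      have "(\<Sum>q\<in>?P. \<alpha> 2 2 (nrm (fst q - x))) = (\<Sum>t\<in>grid n. \<Sum>t'\<in>nbh n t. \<alpha> 2 2 (nrm (t - x)))"
        by (subst sum.Sigma) (auto simp: finite_grid finite_nbh split_beta)
      then show ?thesis by simp
    qed
    also have "\<dots> \<le> (\<Sum>t\<in>grid n. real (card (lball n)) * \<alpha> 2 2 (nrm (t - x)))"
      by (intro sum_mono mult_right_mono of_nat_mono card_nbh_le alpha_Y_nonneg)
    also have "\<dots> \<le> real (card (lball n)) * ?A"
      unfolding sum_distrib_left[symmetric] using alpha_grid_sum[OF that] by (intro mult_left_mono) auto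
    finally show ?thesis .
  qed
  have cardP: "real (card ?P) \<le> real n ^ CARD('d) * real (card (lball n))"
  proof -
    have "card ?P = (\<Sum>s\<in>grid n. card (nbh n s))" using finite_grid finite_nbh by (intro card_SigmaI) auto
    also have "\<dots> \<le> (\<Sum>s\<in>(grid n :: (real^'d) set). card (lball n))" by (intro sum_mono card_nbh_le)
    also have "\<dots> = n ^ CARD('d) * card (lball n)" by (simp add: card_grid)
    finally have "real (card ?P) \<le> real (n ^ CARD('d) * card (lball n))" by (rule of_nat_mono)
    then show ?thesis by simp
  qed
  have "expectation (\<lambda>\<omega>. (\<Sum>q\<in>?P. \<eta> q \<omega> - expectation (\<eta> q))\<^sup>2)
    = (\<Sum>q\<in>?P. \<Sum>q'\<in>?P. expectation (\<lambda>\<omega>. \<eta> q \<omega> * \<eta> q' \<omega>) - expectation (\<eta> q) * expectation (\<eta> q'))"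
    unfolding power2_eq_square sum_product using iee' by (simp add: cv)
  also have "\<dots> \<le> (\<Sum>q\<in>?P. \<Sum>q'\<in>?P. 4 * ?K ^ 4 * (\<alpha> 2 2 (nrm (fst q' - fst q)) + \<alpha> 2 2 (nrm (snd q' - fst q))
      + \<alpha> 2 2 (nrm (fst q' - snd q)) + \<alpha> 2 2 (nrm (snd q' - snd q))))"
  proof (intro sum_mono)
    fix q q' assume q: "q \<in> ?P" "q' \<in> ?P"
    from pair_covariance[OF PZ[OF q(1)] PZ[OF q(2)], of c n]
    show "expectation (\<lambda>\<omega>. \<eta> q \<omega> * \<eta> q' \<omega>) - expectation (\<eta> q) * expectation (\<eta> q')
      \<le> 4 * ?K ^ 4 * (\<alpha> 2 2 (nrm (fst q' - fst q)) + \<alpha> 2 2 (nrm (snd q' - fst q))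
      + \<alpha> 2 2 (nrm (fst q' - snd q)) + \<alpha> 2 2 (nrm (snd q' - snd q)))"
      unfolding \<eta>_def by linarith
  qed
  also have "\<dots> = 4 * ?K ^ 4 * (\<Sum>q\<in>?P. 2 * (\<Sum>q'\<in>?P. \<alpha> 2 2 (nrm (fst q' - fst q))) + 2 * (\<Sum>q'\<in>?P. \<alpha> 2 2 (nrm (fst q' - snd q))))"
  proof -
    have "(\<Sum>q'\<in>?P. \<alpha> 2 2 (nrm (snd q' - x))) = (\<Sum>q'\<in>?P. \<alpha> 2 2 (nrm (fst q' - x)))" for x
      by (rule swap)
    then show ?thesis by (simp add: sum_distrib_left[symmetric] sum.distrib)
  qed
  also have "\<dots> \<le> 4 * ?K ^ 4 * (\<Sum>q\<in>?P. 4 * (real (card (lball n)) * ?A))"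
  proof (intro mult_left_mono sum_mono)
    fix q assume q: "q \<in> ?P"
    from part[OF PZ(1)[OF q]] part[OF PZ(2)[OF q]]
    show "2 * (\<Sum>q'\<in>?P. \<alpha> 2 2 (nrm (fst q' - fst q))) + 2 * (\<Sum>q'\<in>?P. \<alpha> 2 2 (nrm (fst q' - snd q))) \<le> 4 * (real (card (lball n)) * ?A)"
      by linarith
  qed (simp add: coeff_norm_nonneg)
  also have "\<dots> = 16 * ?K ^ 4 * ?A * real (card (lball n)) * real (card ?P)" by (simp add: mult_ac)
  also have "\<dots> \<le> 16 * ?K ^ 4 * ?A * real (card (lball n)) * (real n ^ CARD('d) * real (card (lball n)))"
    using cardP A0 by (intro mult_left_mono) (auto simp: coeff_norm_nonneg)
  finally have "expectation (\<lambda>\<omega>. (\<Sum>q\<in>?P. \<eta> q \<omega> - expectation (\<eta> q))\<^sup>2)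
     \<le> 16 * ?K ^ 4 * ?A * (real (card (lball n)))\<^sup>2 * real n ^ CARD('d)" by (simp add: power2_eq_square mult_ac)
  then show ?thesis
    unfolding Ve by (simp add: power_mult_distrib mult_left_mono)
qed

lemma ball_card_bound: "\<exists>C>0. \<forall>\<^sub>F n in sequentially. real (card (lball n)) \<le> C * r n ^ CARD('d)"
proof -
  obtain C where C: "0 < C" "\<And>R. 1 \<le> R \<Longrightarrow> real (card {u \<in> Zd. nrm u \<le> R}) \<le> C * R ^ CARD('d)"
    by (rule lattice_ball_card[OF norm]) blast
  have "\<forall>\<^sub>F n in sequentially. real (card (lball n)) \<le> C * r n ^ CARD('d)"
    using r_ge_1 by eventually_elim (rule C(2))
  then show ?thesis using C(1) by blast
qed

text \<open>The bound is of order b^4 r^(2d) n^d = (m^2 r^2 / n)^d, which explains the form of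
  (M2).\<close>

lemma V_variance_limit: "(\<lambda>n. expectation (\<lambda>\<omega>. (V c n \<omega> - expectation (V c n))\<^sup>2)) \<longlonglongrightarrow> 0"
proof -
  obtain C where C: "0 < C" "\<forall>\<^sub>F n in sequentially. real (card (lball n)) \<le> C * r n ^ CARD('d)" using ball_card_bound by blast
  let ?D = "16 * coeff_norm c ^ 4 * (\<Sum>\<^sub>\<infinity>u\<in>Zd. \<alpha> 2 2 (nrm u))"
  have D: "0 \<le> ?D" by (intro mult_nonneg_nonneg infsum_nonneg alpha_Y_nonneg) (auto simp: coeff_norm_nonneg)
  have "(\<lambda>n. ?D * C\<^sup>2 * ((real (m n))\<^sup>2 * (r n)\<^sup>2 / real n) ^ CARD('d)) \<longlonglongrightarrow> ?D * C\<^sup>2 * 0 ^ CARD('d)"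
    by (intro tendsto_intros M2)
  moreover have "?D * C\<^sup>2 * 0 ^ CARD('d) = 0" by (simp add: power_0_left)
  ultimately have lim: "(\<lambda>n. ?D * C\<^sup>2 * ((real (m n))\<^sup>2 * (r n)\<^sup>2 / real n) ^ CARD('d)) \<longlonglongrightarrow> 0" by (simp only:)
  have up: "\<forall>\<^sub>F n in sequentially. expectation (\<lambda>\<omega>. (V c n \<omega> - expectation (V c n))\<^sup>2)
      \<le> ?D * C\<^sup>2 * ((real (m n))\<^sup>2 * (r n)\<^sup>2 / real n) ^ CARD('d)"
    using C(2) eventually_ge_at_top[of 1]
  proof eventually_elim
    case (elim n)
    have n0: "0 < real n ^ CARD('d)" using elim(2) by simp
    have "(real (card (lball n)))\<^sup>2 \<le> (C * r n ^ CARD('d))\<^sup>2" using elim(1) by (intro power_mono) auto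
    then have "?D * (real (card (lball n)))\<^sup>2 * real n ^ CARD('d) \<le> ?D * (C * r n ^ CARD('d))\<^sup>2 * real n ^ CARD('d)"
      using D by (intro mult_right_mono mult_left_mono) auto
    then have "((b n)\<^sup>2)\<^sup>2 * (?D * (real (card (lball n)))\<^sup>2 * real n ^ CARD('d)) \<le> ((b n)\<^sup>2)\<^sup>2 * (?D * (C * r n ^ CARD('d))\<^sup>2 * real n ^ CARD('d))"
      by (rule mult_left_mono) simp
    also have "\<dots> = ?D * C\<^sup>2 * ((real (m n) ^ CARD('d))\<^sup>2 * (r n ^ CARD('d))\<^sup>2 / real n ^ CARD('d))"
      unfolding b_square using n0 by (simp add: power2_eq_square)
    also have "(real (m n) ^ CARD('d))\<^sup>2 * (r n ^ CARD('d))\<^sup>2 / real n ^ CARD('d) = ((real (m n))\<^sup>2 * (r n)\<^sup>2 / real n) ^ CARD('d)"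
      by (simp add: power_mult_distrib power_divide power_mult[symmetric] mult.commute)
    finally show ?case using V_variance[of c n] by linarith
  qed
  have low: "\<forall>\<^sub>F n in sequentially. 0 \<le> expectation (\<lambda>\<omega>. (V c n \<omega> - expectation (V c n))\<^sup>2)" by simp
  show ?thesis by (rule tendsto_sandwich[OF low up tendsto_const lim])
qed

lemma V_integrable: "integrable M (V c n)" "integrable M (\<lambda>\<omega>. (V c n \<omega> - x)\<^sup>2)"
proof -
  obtain C where C: "\<And>\<omega>. \<bar>V c n \<omega>\<bar> \<le> C"
  proof
    fix \<omega>
    have "\<bar>\<Sum>s\<in>grid n. \<Sum>t\<in>nbh n s. \<xi> c n s \<omega> * \<xi> c n t \<omega>\<bar> \<le> (\<Sum>s\<in>(grid n :: (real^'d) set). \<Sum>t\<in>nbh n s. coeff_norm c * coeff_norm c)"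
      by (rule order_trans[OF sum_abs sum_mono[OF order_trans[OF sum_abs sum_mono]]], unfold abs_mult)
        (intro mult_mono xi_bound coeff_norm_nonneg abs_ge_zero)
    then show "\<bar>V c n \<omega>\<bar> \<le> (b n)\<^sup>2 * (\<Sum>s\<in>(grid n :: (real^'d) set). \<Sum>t\<in>nbh n s. coeff_norm c * coeff_norm c)"
      unfolding V_def abs_mult by (simp add: mult_left_mono)
  qed
  have Vm[measurable]: "V c n \<in> borel_measurable M" unfolding V_def by measurable
  show "integrable M (V c n)" by (rule integrable_const_bound[of _ C]) (auto simp: C)
  show "integrable M (\<lambda>\<omega>. (V c n \<omega> - x)\<^sup>2)"
  proof (rule integrable_const_bound[of _ "(C + \<bar>x\<bar>)\<^sup>2"])
    show "AE \<omega> in M. norm ((V c n \<omega> - x)\<^sup>2) \<le> (C + \<bar>x\<bar>)\<^sup>2"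
    proof (rule AE_I2)
      fix \<omega> have "\<bar>V c n \<omega> - x\<bar> \<le> C + \<bar>x\<bar>" using C[of \<omega>] by linarith
      from power_mono[OF this, of 2] show "norm ((V c n \<omega> - x)\<^sup>2) \<le> (C + \<bar>x\<bar>)\<^sup>2" by simp
    qed
  qed simp
qed

lemma V_L1_limit: "(\<lambda>n. expectation (\<lambda>\<omega>. \<bar>V c n \<omega> - asym_var c\<bar>)) \<longlonglongrightarrow> 0"
proof (rule LIMSEQ_I)
  fix \<epsilon> :: real assume \<epsilon>: "0 < \<epsilon>"
  have "\<forall>\<^sub>F n in sequentially. dist (expectation (V c n)) (asym_var c) < \<epsilon> / 3"
    unfolding V_mean by (rule tendstoD[OF nbh_cov_limit]) (use \<epsilon> in simp)
  moreover have "\<forall>\<^sub>F n in sequentially. expectation (\<lambda>\<omega>. (V c n \<omega> - expectation (V c n))\<^sup>2) < (\<epsilon> / 3)\<^sup>2"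
    by (rule order_tendstoD(2)[OF V_variance_limit]) (use \<epsilon> in simp)
  ultimately have "\<forall>\<^sub>F n in sequentially. norm (expectation (\<lambda>\<omega>. \<bar>V c n \<omega> - asym_var c\<bar>) - 0) < \<epsilon>"
  proof eventually_elim
    case (elim n)
    let ?e = "expectation (V c n)" and ?\<delta> = "\<epsilon> / 3"
    have \<delta>: "0 < ?\<delta>" using \<epsilon> by simp
    \<comment> \<open>Passes from L2 to L1 pointwise: with w the centred V and second moment below
      ?\<delta>^2, both terms on the right contribute at most ?\<delta>.\<close>
    have amgm: "\<bar>w\<bar> \<le> ?\<delta> + w\<^sup>2 / ?\<delta>" for w :: real
    proof (cases "\<bar>w\<bar> \<le> ?\<delta>")
      case True then show ?thesis using \<delta> by (simp add: add_increasing2)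
    next
      case False
      then have "\<bar>w\<bar> * ?\<delta> \<le> \<bar>w\<bar> * \<bar>w\<bar>" by (intro mult_left_mono) auto
      then have "\<bar>w\<bar> \<le> w\<^sup>2 / ?\<delta>" unfolding pos_le_divide_eq[OF \<delta>] by (simp add: power2_eq_square)
      then show ?thesis using \<delta> by linarith
    qed
    have "expectation (\<lambda>\<omega>. \<bar>V c n \<omega> - asym_var c\<bar>) \<le> expectation (\<lambda>\<omega>. \<bar>?e - asym_var c\<bar> + (?\<delta> + (V c n \<omega> - ?e)\<^sup>2 / ?\<delta>))"
    proof (rule integral_mono)
      show "integrable M (\<lambda>\<omega>. \<bar>V c n \<omega> - asym_var c\<bar>)" using V_integrable(1) by simp
      show "integrable M (\<lambda>\<omega>. \<bar>?e - asym_var c\<bar> + (?\<delta> + (V c n \<omega> - ?e)\<^sup>2 / ?\<delta>))" using V_integrable(2) by simp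
      fix \<omega> show "\<bar>V c n \<omega> - asym_var c\<bar> \<le> \<bar>?e - asym_var c\<bar> + (?\<delta> + (V c n \<omega> - ?e)\<^sup>2 / ?\<delta>)"
        using amgm[of "V c n \<omega> - ?e"] by linarith
    qed
    also have "\<dots> = \<bar>?e - asym_var c\<bar> + (?\<delta> + expectation (\<lambda>\<omega>. (V c n \<omega> - ?e)\<^sup>2) / ?\<delta>)"
      using V_integrable(2) by (simp add: prob_space)
    also have "expectation (\<lambda>\<omega>. (V c n \<omega> - ?e)\<^sup>2) / ?\<delta> < ?\<delta>"
      unfolding pos_divide_less_eq[OF \<delta>] using elim(2) by (simp add: power2_eq_square)
    finally have "expectation (\<lambda>\<omega>. \<bar>V c n \<omega> - asym_var c\<bar>) < \<epsilon>" using elim(1) by (simp add: dist_real_def)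
    moreover have "0 \<le> expectation (\<lambda>\<omega>. \<bar>V c n \<omega> - asym_var c\<bar>)" by simp
    ultimately show ?case by simp
  qed
  then show "\<exists>no. \<forall>n\<ge>no. norm (expectation (\<lambda>\<omega>. \<bar>V c n \<omega> - asym_var c\<bar>) - 0) < \<epsilon>"
    by (simp add: eventually_sequentially)
qed

end

section \<open>Remaining error terms and the limit of the characteristic functions\<close>

context extremogram_clt
begin

lemma b_cube: "1 \<le> n \<Longrightarrow> b n ^ 3 * real n ^ CARD('d) = b n * real (m n) ^ CARD('d)"
proof -
  assume n: "1 \<le> n"
  have "b n ^ 3 * real n ^ CARD('d) = b n * ((b n)\<^sup>2 * real n ^ CARD('d))"
    by (simp add: power3_eq_cube power2_eq_square mult_ac)
  also have "(b n)\<^sup>2 * real n ^ CARD('d) = real (m n) ^ CARD('d)" using n by (simp add: b_square)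
  finally show ?thesis .
qed

text \<open>Since m_n is at least 1, m r^2 / n is at most m^2 r^2 / n, so the square root of (M2)
  dominates.\<close>

lemma b_ball_limit: "(\<lambda>n. (sqrt (real (m n) / real n) * r n) ^ CARD('d)) \<longlonglongrightarrow> 0"
proof -
  have "(\<lambda>n. sqrt ((real (m n))\<^sup>2 * (r n)\<^sup>2 / real n)) \<longlonglongrightarrow> sqrt 0" by (intro tendsto_intros M2)
  then have lim: "(\<lambda>n. sqrt ((real (m n))\<^sup>2 * (r n)\<^sup>2 / real n)) \<longlonglongrightarrow> 0" by simp
  have up: "\<forall>\<^sub>F n in sequentially. sqrt (real (m n) / real n) * r n \<le> sqrt ((real (m n))\<^sup>2 * (r n)\<^sup>2 / real n)"
    using r_ge_1 eventually_ge_at_top[of 1]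
  proof eventually_elim
    case (elim n)
    have "sqrt (real (m n) / real n) * r n = sqrt (real (m n) * (r n)\<^sup>2 / real n)"
      using elim(1) by (simp add: real_sqrt_mult real_sqrt_divide)
    also have "\<dots> \<le> sqrt ((real (m n))\<^sup>2 * (r n)\<^sup>2 / real n)"
    proof -
      have "1 \<le> real (m n)" using m_pos elim(2) by (simp add: Suc_leI)
      then have "real (m n) * 1 \<le> real (m n) * real (m n)" by (intro mult_left_mono) auto
      then show ?thesis
        by (intro real_sqrt_le_mono divide_right_mono mult_right_mono) (auto simp: power2_eq_square)
    qed
    finally show ?case .
  qed
  have low: "\<forall>\<^sub>F n in sequentially. 0 \<le> sqrt (real (m n) / real n) * r n"
    using r_ge_1 by eventually_elim simp
  have "(\<lambda>n. sqrt (real (m n) / real n) * r n) \<longlonglongrightarrow> 0" by (rule tendsto_sandwich[OF low up tendsto_const lim])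
  then have "(\<lambda>n. (sqrt (real (m n) / real n) * r n) ^ CARD('d)) \<longlonglongrightarrow> 0 ^ CARD('d)" by (rule tendsto_power)
  then show ?thesis by (simp add: power_0_left)
qed

text \<open>A neighbourhood sum has second moment of order r^d / m^d. Over n^d sites and with b^3 in
  front this amounts to b r^d.\<close>

lemma nbh_second_moment_limit:
  "(\<lambda>n. b n ^ 3 * (\<Sum>s\<in>grid n. expectation (\<lambda>\<omega>. (\<Sum>t\<in>nbh n s. \<xi> c n t \<omega>)\<^sup>2))) \<longlonglongrightarrow> 0"
proof -
  obtain C where C: "0 < C" "\<forall>\<^sub>F n in sequentially. \<forall>F. finite F \<longrightarrow> F \<subseteq> Zd \<longrightarrow>
    real (m n) ^ CARD('d) * expectation (\<lambda>\<omega>. (\<Sum>s\<in>F. \<xi> c n s \<omega>)\<^sup>2) \<le> C * real (card F)" using sum_second_moment by blast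
  obtain C1 where C1: "0 < C1" "\<forall>\<^sub>F n in sequentially. real (card (lball n)) \<le> C1 * r n ^ CARD('d)" using ball_card_bound by blast
  have "(\<lambda>n. C * C1 * (sqrt (real (m n) / real n) * r n) ^ CARD('d)) \<longlonglongrightarrow> C * C1 * 0"
    by (intro tendsto_intros b_ball_limit)
  then have lim: "(\<lambda>n. C * C1 * (sqrt (real (m n) / real n) * r n) ^ CARD('d)) \<longlonglongrightarrow> 0" by simp
  have up: "\<forall>\<^sub>F n in sequentially. b n ^ 3 * (\<Sum>s\<in>grid n. expectation (\<lambda>\<omega>. (\<Sum>t\<in>nbh n s. \<xi> c n t \<omega>)\<^sup>2))
      \<le> C * C1 * (sqrt (real (m n) / real n) * r n) ^ CARD('d)"
    using C(2) C1(2) eventually_ge_at_top[of 1]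
  proof eventually_elim
    case (elim n)
    let ?E = "\<lambda>s. expectation (\<lambda>\<omega>. (\<Sum>t\<in>nbh n s. \<xi> c n t \<omega>)\<^sup>2)"
    have m0: "0 < real (m n) ^ CARD('d)" using m_pos elim(3) by simp
    have n0: "0 < real n ^ CARD('d)" using elim(3) by simp
    have "real (m n) ^ CARD('d) * ?E s \<le> C * (C1 * r n ^ CARD('d))" if s: "s \<in> grid n" for s
    proof -
      have "nbh n s \<subseteq> Zd" using nbh_subset grid_subset_Zd by (rule order_trans)
      then have "real (m n) ^ CARD('d) * ?E s \<le> C * real (card (nbh n s))" by (rule elim(1)[rule_format, OF finite_nbh])
      also have "\<dots> \<le> C * real (card (lball n))" using C(1) card_nbh_le[OF s] by (intro mult_left_mono of_nat_mono) auto
      also have "\<dots> \<le> C * (C1 * r n ^ CARD('d))" using C(1) elim(2) by (intro mult_left_mono) auto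
      finally show ?thesis .
    qed
    then have "(\<Sum>s\<in>grid n. real (m n) ^ CARD('d) * ?E s) \<le> (\<Sum>s\<in>(grid n :: (real^'d) set). C * (C1 * r n ^ CARD('d)))"
      by (rule sum_mono)
    then have "real (m n) ^ CARD('d) * (\<Sum>s\<in>grid n. ?E s) \<le> real n ^ CARD('d) * (C * (C1 * r n ^ CARD('d)))"
      by (simp add: sum_distrib_left card_grid)
    then have "(b n / real n ^ CARD('d)) * (real (m n) ^ CARD('d) * (\<Sum>s\<in>grid n. ?E s))
        \<le> (b n / real n ^ CARD('d)) * (real n ^ CARD('d) * (C * (C1 * r n ^ CARD('d))))"
      using b_nonneg[of n] n0 by (intro mult_left_mono) auto
    also have "(b n / real n ^ CARD('d)) * (real n ^ CARD('d) * (C * (C1 * r n ^ CARD('d)))) = C * C1 * (b n * r n ^ CARD('d))"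
      using n0 by simp
    also have "b n * r n ^ CARD('d) = (sqrt (real (m n) / real n) * r n) ^ CARD('d)" by (simp add: b_def power_mult_distrib)
    also have "(b n / real n ^ CARD('d)) * (real (m n) ^ CARD('d) * (\<Sum>s\<in>grid n. ?E s)) = b n ^ 3 * (\<Sum>s\<in>grid n. ?E s)"
    proof -
      have "b n ^ 3 = b n * real (m n) ^ CARD('d) / real n ^ CARD('d)"
        using b_cube[OF elim(3)] n0 by (simp add: eq_divide_eq)
      then show ?thesis by simp
    qed
    finally show ?case .
  qed
  have low: "\<forall>\<^sub>F n in sequentially. 0 \<le> b n ^ 3 * (\<Sum>s\<in>grid n. expectation (\<lambda>\<omega>. (\<Sum>t\<in>nbh n s. \<xi> c n t \<omega>)\<^sup>2))"
    by (simp add: b_nonneg sum_nonneg)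
  show ?thesis by (rule tendsto_sandwich[OF low up tendsto_const lim])
qed

text \<open>One mixing bound per site gives n^d of them, with b in front; the resulting factor is
  the rate in (M4)(iii).\<close>

lemma b_pow: "1 \<le> n \<Longrightarrow> b n * real n ^ CARD('d) = real (m n) powr (real CARD('d) / 2) * real n powr (real CARD('d) / 2)"
proof -
  assume n: "1 \<le> n"
  have pw: "x powr (real CARD('d) / 2) = sqrt x ^ CARD('d)" if "0 < x" for x
  proof -
    have "x powr (real CARD('d) / 2) = (x powr (1/2)) powr real CARD('d)" using that by (simp add: powr_powr)
    then show ?thesis using that by (simp add: powr_half_sqrt powr_realpow)
  qed
  have "sqrt (real (m n) / real n) * real n = sqrt (real (m n)) * sqrt (real n)"
    using n by (simp add: real_sqrt_divide field_simps)
  then have "b n * real n ^ CARD('d) = (sqrt (real (m n)) * sqrt (real n)) ^ CARD('d)"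
    unfolding b_def power_mult_distrib[symmetric] by (rule arg_cong)
  also have "\<dots> = real (m n) powr (real CARD('d) / 2) * real n powr (real CARD('d) / 2)"
    using n m_pos by (simp add: pw power_mult_distrib)
  finally show ?thesis .
qed

text \<open>Sites outside the neighbourhood are more than r_n away from s and there are at most n^d
  of them, which are the parameters of the coefficient in (M4)(iii).\<close>

lemma far_covariance:
  assumes s: "s \<in> grid n"
  shows "cmod (CLINT \<omega>|M. of_real (\<xi> c n s \<omega>) * iexp (l * (b n * (\<Sum>t\<in>grid n - nbh n s. \<xi> c n t \<omega>))))
    \<le> 8 * coeff_norm c * \<alpha> 1 (n ^ CARD('d)) (r n)"
proof (rule complex_covariance_inequality[OF site_algebra_subalgebra[of "{s}"] site_algebra_subalgebra[of "grid n - nbh n s"]])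
  fix P Q assume P: "P \<in> sets (site_algebra {s})" and Q: "Q \<in> sets (site_algebra (grid n - nbh n s))"
  show "\<bar>prob (P \<inter> Q) - prob P * prob Q\<bar> \<le> \<alpha> 1 (n ^ CARD('d)) (r n)"
  proof (rule alpha_Y_upper[of "{s}" _ "grid n - nbh n s"])
    show "P \<in> gen_sigma M X (\<Union>s\<in>{s}. zball nrm s \<gamma>)" using P unfolding sets_field_algebra .
    show "Q \<in> gen_sigma M X (\<Union>s\<in>grid n - nbh n s. zball nrm s \<gamma>)" using Q unfolding sets_field_algebra .
    show "card (grid n - nbh n s) \<le> n ^ CARD('d)"
      using card_mono[OF finite_grid[where 'd = 'd, of n], of "grid n - nbh n s"] by (simp add: card_grid)
    show "finite (grid n - nbh n s)" using finite_grid by (rule finite_Diff)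
    show "grid n - nbh n s \<subseteq> Zd" using grid_subset_Zd by blast
    fix x y assume "x \<in> {s}" "y \<in> grid n - nbh n s"
    then show "r n \<le> nrm (x - y)" using nrm_minus_commute[OF norm, of x y] by (auto simp: nbh_def)
  qed (use s grid_Zd in auto)
next
  show "\<xi> c n s \<in> borel_measurable (site_algebra {s})"
    by (rule xi_site_measurable) (auto intro: grid_Zd s)
  have "(\<lambda>\<omega>. l * (b n * (\<Sum>t\<in>grid n - nbh n s. \<xi> c n t \<omega>))) \<in> borel_measurable (site_algebra (grid n - nbh n s))"
    by (intro borel_measurable_times borel_measurable_const borel_measurable_sum xi_site_measurable) (auto intro: grid_Zd)
  then show "(\<lambda>\<omega>. iexp (l * (b n * (\<Sum>t\<in>grid n - nbh n s. \<xi> c n t \<omega>)))) \<in> borel_measurable (site_algebra (grid n - nbh n s))"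
    by measurable
qed (simp_all add: xi_bound xi_mean)

lemma core_clt:
  "(\<lambda>n. CLINT \<omega>|M. iexp (b n * (\<Sum>s\<in>grid n. \<xi> c n s \<omega>))) \<longlonglongrightarrow> complex_of_real (exp (- asym_var c / 2))"
proof -
  let ?v = "\<lambda>n. expectation (\<lambda>\<omega>. \<bar>V c n \<omega> - asym_var c\<bar>)"
  let ?w = "\<lambda>n. b n ^ 3 * (\<Sum>s\<in>grid n. expectation (\<lambda>\<omega>. (\<Sum>t\<in>nbh n s. \<xi> c n t \<omega>)\<^sup>2))"
  let ?e = "\<lambda>n. 8 * coeff_norm c * (real (m n) powr (real CARD('d) / 2) * real n powr (real CARD('d) / 2) *
        \<alpha> 1 (n ^ CARD('d)) (r n))"
  let ?D = "\<lambda>n. exp (\<bar>asym_var c\<bar> / 2 - asym_var c / 2) * (?v n + coeff_norm c * ?w n + ?e n)"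
  have "?D \<longlonglongrightarrow> exp (\<bar>asym_var c\<bar> / 2 - asym_var c / 2) * (0 + coeff_norm c * 0 + 8 * coeff_norm c * 0)"
    by (intro tendsto_mult tendsto_add tendsto_const V_L1_limit nbh_second_moment_limit M4_iii)
  then have lim: "?D \<longlonglongrightarrow> 0" by simp
  have est: "\<forall>\<^sub>F n in sequentially. cmod ((CLINT \<omega>|M. iexp (b n * (\<Sum>s\<in>grid n. \<xi> c n s \<omega>))) - of_real (exp (- asym_var c / 2))) \<le> ?D n"
    using eventually_ge_at_top[of 1]
  proof eventually_elim
    case (elim n)
    show ?case
    proof (rule bolthausen_estimate[where R = "nbh n"])
      fix l :: real
      have "b n * (\<Sum>s\<in>grid n. cmod (CLINT \<omega>|M. of_real (\<xi> c n s \<omega>) * iexp (l * (b n * (\<Sum>t\<in>grid n - nbh n s. \<xi> c n t \<omega>)))))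
        \<le> b n * (\<Sum>s\<in>(grid n :: (real^'d) set). 8 * coeff_norm c * \<alpha> 1 (n ^ CARD('d)) (r n))"
        by (intro mult_left_mono sum_mono far_covariance b_nonneg)
      also have "\<dots> = 8 * coeff_norm c * ((b n * real n ^ CARD('d)) * \<alpha> 1 (n ^ CARD('d)) (r n))"
        by (simp add: card_grid mult_ac)
      also have "\<dots> = ?e n" unfolding b_pow[OF elim] ..
      finally show "b n * (\<Sum>s\<in>grid n. cmod (CLINT \<omega>|M. of_real (\<xi> c n s \<omega>) * iexp (l * (b n * (\<Sum>t\<in>grid n - nbh n s. \<xi> c n t \<omega>))))) \<le> ?e n" .
    next
      show "expectation (\<lambda>\<omega>. \<bar>(b n)\<^sup>2 * (\<Sum>s\<in>grid n. \<Sum>t\<in>nbh n s. \<xi> c n s \<omega> * \<xi> c n t \<omega>) - asym_var c\<bar>) \<le> ?v n"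
        by (simp add: V_def)
    qed (auto simp: finite_grid nbh_def xi_bound b_nonneg)
  qed
  have "(\<lambda>n. (CLINT \<omega>|M. iexp (b n * (\<Sum>s\<in>grid n. \<xi> c n s \<omega>))) - of_real (exp (- asym_var c / 2))) \<longlonglongrightarrow> 0"
    by (rule Lim_null_comparison[OF est lim])
  then show ?thesis by (simp add: LIM_zero_iff)
qed

end

section \<open>From counts to ratios\<close>

lemma sum_UNIV_option: "(\<Sum>i\<in>UNIV. f i) = f None + (\<Sum>i\<in>UNIV. f (Some i))"
  for f :: "'p::finite option \<Rightarrow> 'b::comm_monoid_add"
  by (simp add: UNIV_option_conv sum.reindex)

context extremogram_clt
begin

definition mA :: real where "mA = measure (mu0 \<mu>) A"

definition mD :: "'p \<Rightarrow> real" where "mD i = measure (\<mu> (zball nrm 0 \<gamma>)) (D_set (Some i))"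

lemma mA_pos: "0 < mA" using A(2) by (simp add: mA_def)

lemma scaled_p_None_limit: "(\<lambda>n. real (m n) ^ CARD('d) * p None n) \<longlonglongrightarrow> mA"
  using scaled_p_limit[of None] by (simp add: measure_D_None mA_def)

lemma scaled_p_Some_limit: "(\<lambda>n. real (m n) ^ CARD('d) * p (Some i) n) \<longlonglongrightarrow> mD i"
  using scaled_p_limit[of "Some i"] by (simp add: mD_def)

text \<open>The ratio x / y has gradient (1 / y, - x / y^2); evaluated at the limits
  \<open>mD\<close> and \<open>mA\<close> and combined with t, this yields the coefficients of the
  counts. They equal the entries of F^T t divided by mu(A)^2.\<close>

definition lin :: "real^'p \<Rightarrow> 'p option \<Rightarrow> real" where
  "lin t i = (case i of None \<Rightarrow> - (\<Sum>k\<in>UNIV. t $ k * mD k) / mA\<^sup>2 | Some k \<Rightarrow> t $ k / mA)"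

definition cnt :: "(real^'d) set \<Rightarrow> 'p option \<Rightarrow> nat \<Rightarrow> 'w \<Rightarrow> real" where
  "cnt F i n \<omega> = (\<Sum>s\<in>F. ind i n s \<omega> - p i n)"

text \<open>The linearised error of the delta method, coordinate by coordinate.\<close>

definition lvec :: "nat \<Rightarrow> 'w \<Rightarrow> real^'p" where
  "lvec n \<omega> = (\<chi> i. b n * (cnt (grid n) (Some i) n \<omega> / mA - mD i / mA\<^sup>2 * cnt (grid n) None n \<omega>))"

lemma cnt_measurable[measurable]: "cnt F i n \<in> borel_measurable M"
  unfolding cnt_def by measurable

lemma inner_lvec: "t \<bullet> lvec n \<omega> = b n * (\<Sum>s\<in>grid n. \<xi> (lin t) n s \<omega>)"
proof -
  have "(\<Sum>s\<in>grid n. \<xi> (lin t) n s \<omega>) = (\<Sum>i\<in>UNIV. lin t i * cnt (grid n) i n \<omega>)"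
    unfolding \<xi>_def cnt_def by (subst sum.swap) (simp add: sum_distrib_left)
  also have "\<dots> = - (\<Sum>k\<in>UNIV. t $ k * mD k) / mA\<^sup>2 * cnt (grid n) None n \<omega> + (\<Sum>k\<in>UNIV. t $ k / mA * cnt (grid n) (Some k) n \<omega>)"
    by (simp add: sum_UNIV_option lin_def)
  finally have e: "(\<Sum>s\<in>grid n. \<xi> (lin t) n s \<omega>)
    = - (\<Sum>k\<in>UNIV. t $ k * mD k) / mA\<^sup>2 * cnt (grid n) None n \<omega> + (\<Sum>k\<in>UNIV. t $ k / mA * cnt (grid n) (Some k) n \<omega>)" .
  have "t \<bullet> lvec n \<omega> = (\<Sum>k\<in>UNIV. b n * (t $ k / mA * cnt (grid n) (Some k) n \<omega>) - b n * (t $ k * mD k / mA\<^sup>2 * cnt (grid n) None n \<omega>))"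
    unfolding inner_vec_def lvec_def by (intro sum.cong refl) (simp add: algebra_simps)
  also have "\<dots> = b n * ((\<Sum>k\<in>UNIV. t $ k / mA * cnt (grid n) (Some k) n \<omega>) - (\<Sum>k\<in>UNIV. t $ k * mD k / mA\<^sup>2 * cnt (grid n) None n \<omega>))"
    by (simp add: sum_subtractf sum_distrib_left right_diff_distrib)
  also have "(\<Sum>k\<in>UNIV. t $ k * mD k / mA\<^sup>2 * cnt (grid n) None n \<omega>) = (\<Sum>k\<in>UNIV. t $ k * mD k) / mA\<^sup>2 * cnt (grid n) None n \<omega>"
    by (simp add: sum_distrib_right sum_divide_distrib)
  finally show ?thesis unfolding e by simp
qed

lemma Sigma_entry: "Sigma_mat M X a \<mu> nrm \<gamma> A B h $ i $ j = (\<Sum>\<^sub>\<infinity>u\<in>Zd. \<kappa> i j u)"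
proof -
  have s: "\<kappa> i j summable_on (Zd - {0})" by (rule summable_on_subset[OF kappa_summable]) auto
  have "(\<Sum>\<^sub>\<infinity>u\<in>Zd. \<kappa> i j u) = (\<Sum>\<^sub>\<infinity>u\<in>{0} \<union> (Zd - {0}). \<kappa> i j u)"
    using zero_in_Zd by (intro arg_cong2[where f = infsum] refl) auto
  also have "\<dots> = (\<Sum>\<^sub>\<infinity>u\<in>{0}. \<kappa> i j u) + (\<Sum>\<^sub>\<infinity>u\<in>Zd - {0}. \<kappa> i j u)"
    by (rule infsum_Un_disjoint) (auto simp: s)
  also have "(\<Sum>\<^sub>\<infinity>u\<in>Zd - {0}. \<kappa> i j u) = (\<Sum>\<^sub>\<infinity>u\<in>Zd - {0}. tau M X a nrm \<gamma> u (D_set i) (D_set j))"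
    by (rule infsum_cong) (simp add: \<kappa>_def)
  also have "(\<Sum>\<^sub>\<infinity>u\<in>{0}. \<kappa> i j u) = measure (\<mu> (zball nrm 0 \<gamma>)) (D_set i \<inter> D_set j)" by (simp add: \<kappa>_def)
  finally show ?thesis by (simp add: Sigma_mat_def)
qed

lemma tau_summable: "(\<lambda>u. tau M X a nrm \<gamma> u (D_set i) (D_set j)) summable_on (Zd - {0})"
proof -
  have "\<kappa> i j summable_on (Zd - {0})" by (rule summable_on_subset[OF kappa_summable]) auto
  then show ?thesis by (rule summable_on_cong[THEN iffD1, rotated]) (simp add: \<kappa>_def)
qed

text \<open>Translating a pair of sites at lag u so that its second site becomes the origin
  exchanges the roles of i and j. This makes \<open>Sigma_mat\<close> symmetric although its single
  terms are not.\<close>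

lemma kappa_swap: "\<kappa> i j u = \<kappa> j i (- u)"
proof (rule LIMSEQ_unique[OF scaled_ind_limit])
  have "expectation (\<lambda>\<omega>. ind j n 0 \<omega> * ind i n (- u) \<omega>) = expectation (\<lambda>\<omega>. ind i n 0 \<omega> * ind j n u \<omega>)" for n
    using ind_mult_stationary[of j n u i "- u"] by (simp add: mult.commute)
  then show "(\<lambda>n. real (m n) ^ CARD('d) * expectation (\<lambda>\<omega>. ind i n 0 \<omega> * ind j n u \<omega>)) \<longlonglongrightarrow> \<kappa> j i (- u)"
    using scaled_ind_limit[of j i "- u"] by simp
qed

lemma Sigma_symmetric: "transpose (Sigma_mat M X a \<mu> nrm \<gamma> A B h) = Sigma_mat M X a \<mu> nrm \<gamma> A B h"
proof -
  have bij: "bij_betw uminus Zd (Zd :: (real^'d) set)"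
    by (rule bij_betwI[where g = uminus]) (auto intro: Zd_minus)
  have "(\<Sum>\<^sub>\<infinity>u\<in>Zd. \<kappa> j i u) = (\<Sum>\<^sub>\<infinity>u\<in>Zd. \<kappa> i j u)" for i j
    using infsum_reindex_bij_betw[OF bij, of "\<kappa> j i"] by (simp add: kappa_swap[of i j])
  then show ?thesis by (simp add: vec_eq_iff transpose_def Sigma_entry)
qed

abbreviation limit_cov :: "real^'p^'p" where "limit_cov \<equiv> Pi_mat M X a \<mu> nrm \<gamma> A B h"

lemma Pi_symmetric: "transpose limit_cov = limit_cov"
proof -
  have "transpose (F_mat \<mu> nrm \<gamma> A B h ** Sigma_mat M X a \<mu> nrm \<gamma> A B h ** transpose (F_mat \<mu> nrm \<gamma> A B h))
    = F_mat \<mu> nrm \<gamma> A B h ** Sigma_mat M X a \<mu> nrm \<gamma> A B h ** transpose (F_mat \<mu> nrm \<gamma> A B h)"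
    by (simp add: matrix_transpose_mul Sigma_symmetric matrix_mul_assoc)
  moreover have "transpose (x *\<^sub>R (Y :: real^'p^'p)) = x *\<^sub>R transpose Y" for x Y
    by (simp add: transpose_def vec_eq_iff)
  ultimately show ?thesis unfolding Pi_mat_def by (simp only:)
qed

text \<open>Since F^T t is mu(A)^2 times \<open>lin t\<close>, the quadratic form picks up the
  fourth power that the prefactor of Pi cancels.\<close>

lemma Pi_quadratic: "t \<bullet> (limit_cov *v t) = asym_var (lin t)"
proof -
  let ?F = "F_mat \<mu> nrm \<gamma> A B h" and ?S = "Sigma_mat M X a \<mu> nrm \<gamma> A B h"
  define y where "y = transpose ?F *v t"
  have yN: "y $ None = - (\<Sum>k\<in>UNIV. t $ k * mD k)"
    unfolding y_def by (simp add: matrix_vector_mult_def transpose_def F_mat_def mD_def sum_negf mult.commute)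
  have yS: "y $ Some k = mA * t $ k" for k
    unfolding y_def by (simp add: matrix_vector_mult_def transpose_def F_mat_def mA_def if_distrib[where f = "\<lambda>x. x * _"] cong: if_cong)
  have y: "y $ i = mA\<^sup>2 * lin t i" for i
    using mA_pos by (cases i) (simp_all add: yN yS lin_def power2_eq_square)
  have "limit_cov *v t = inverse (mA ^ 4) *\<^sub>R (?F *v (?S *v y))"
    unfolding Pi_mat_def y_def mA_def[symmetric]
    by (simp add: scaleR_matrix_vector_assoc[symmetric] matrix_vector_mul_assoc matrix_mul_assoc del: transpose_matrix_vector)
  then have "t \<bullet> (limit_cov *v t) = inverse (mA ^ 4) * (t \<bullet> (?F *v (?S *v y)))" by simp
  also have "t \<bullet> (?F *v (?S *v y)) = y \<bullet> (?S *v y)"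
    unfolding y_def by (metis dot_lmul_matrix transpose_matrix_vector transpose_transpose)
  also have "\<dots> = (\<Sum>i\<in>UNIV. \<Sum>j\<in>UNIV. mA ^ 4 * (lin t i * lin t j * (\<Sum>\<^sub>\<infinity>u\<in>Zd. \<kappa> i j u)))"
    by (simp add: quadratic_form Sigma_entry y power2_eq_square power4_eq_xxxx mult_ac)
  also have "\<dots> = mA ^ 4 * asym_var (lin t)" by (simp add: asym_var_def sum_distrib_left)
  finally show ?thesis using mA_pos by simp
qed

lemma lvec_char_limit:
  "(\<lambda>n. CLINT \<omega>|M. iexp (t \<bullet> lvec n \<omega>)) \<longlonglongrightarrow> of_real (exp (- (t \<bullet> (limit_cov *v t)) / 2))"
  unfolding inner_lvec Pi_quadratic by (rule core_clt)

text \<open>The real exponential is a limit of characteristic functions, hence at most 1, so its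
  exponent cannot be positive.\<close>

lemma Pi_nonneg: "0 \<le> t \<bullet> (limit_cov *v t)"
proof -
  have [measurable]: "(\<lambda>\<omega>. t \<bullet> lvec n \<omega>) \<in> borel_measurable M" for n unfolding inner_lvec by measurable
  have "cmod (CLINT \<omega>|M. iexp (t \<bullet> lvec n \<omega>)) \<le> 1" for n
  proof -
    have "cmod (CLINT \<omega>|M. iexp (t \<bullet> lvec n \<omega>)) \<le> (LINT \<omega>|M. 1)"
      by (rule integral_norm_le) (auto intro!: integrable_const_bound[of _ 1])
    then show ?thesis by (simp add: prob_space)
  qed
  then have "cmod (of_real (exp (- (t \<bullet> (limit_cov *v t)) / 2))) \<le> 1"
    by (intro tendsto_upperbound[OF tendsto_norm[OF lvec_char_limit]] always_eventually allI) auto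
  then show ?thesis by simp
qed

lemma cnt_second_moment:
  "\<exists>C>0. \<forall>\<^sub>F n in sequentially. \<forall>F. finite F \<longrightarrow> F \<subseteq> Zd \<longrightarrow>
    real (m n) ^ CARD('d) * expectation (\<lambda>\<omega>. (cnt F i n \<omega>)\<^sup>2) \<le> C * real (card F)"
proof -
  have "\<xi> (\<lambda>j. of_bool (j = i)) n s \<omega> = ind i n s \<omega> - p i n" for n s \<omega>
    unfolding \<xi>_def by (simp add: of_bool_def if_distrib[where f = "\<lambda>x. x * _"] cong: if_cong)
  then show ?thesis using sum_second_moment[of "\<lambda>j. of_bool (j = i)"] by (simp add: cnt_def)
qed

lemma cnt_square_integrable: "integrable M (\<lambda>\<omega>. (x * cnt F i n \<omega>)\<^sup>2)"
proof (rule integrable_const_bound[of _ "(\<bar>x\<bar> * real (card F))\<^sup>2"])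
  have c: "\<bar>cnt F i n \<omega>\<bar> \<le> real (card F) * 1" for \<omega>
    unfolding cnt_def
  proof (rule order_trans[OF sum_abs sum_bounded_above])
    fix s show "\<bar>ind i n s \<omega> - p i n\<bar> \<le> 1"
      using ind_nonneg[of i n s \<omega>] ind_le_1[of i n s \<omega>] p_nonneg[of i n] p_le_1[of i n] by linarith
  qed
  show "AE \<omega> in M. norm ((x * cnt F i n \<omega>)\<^sup>2) \<le> (\<bar>x\<bar> * real (card F))\<^sup>2"
  proof (rule AE_I2)
    fix \<omega>
    have "\<bar>x * cnt F i n \<omega>\<bar> \<le> \<bar>x\<bar> * real (card F)" using c[of \<omega>] by (simp add: abs_mult mult_left_mono)
    from power_mono[OF this, of 2] show "norm ((x * cnt F i n \<omega>)\<^sup>2) \<le> (\<bar>x\<bar> * real (card F))\<^sup>2" by simp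
  qed
qed simp

text \<open>Disposes of all remainder terms: it suffices that the number of sites, weighted by the
  squared coefficient, is negligible against m^d.\<close>

lemma cnt_null:
  fixes F :: "nat \<Rightarrow> (real^'d) set"
  assumes F: "\<And>n. F n \<subseteq> grid n"
    and lim: "(\<lambda>n. (x n)\<^sup>2 * real (card (F n)) / real (m n) ^ CARD('d)) \<longlonglongrightarrow> 0"
  shows "prob_null (\<lambda>n \<omega>. x n * cnt (F n) i n \<omega>)"
proof (rule prob_null_L2)
  show "integrable M (\<lambda>\<omega>. (x n * cnt (F n) i n \<omega>)\<^sup>2)" for n by (rule cnt_square_integrable)
  obtain C where C: "0 < C" "\<forall>\<^sub>F n in sequentially. \<forall>F. finite F \<longrightarrow> F \<subseteq> Zd \<longrightarrow>
    real (m n) ^ CARD('d) * expectation (\<lambda>\<omega>. (cnt F i n \<omega>)\<^sup>2) \<le> C * real (card F)" using cnt_second_moment by blast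
  have "(\<lambda>n. C * ((x n)\<^sup>2 * real (card (F n)) / real (m n) ^ CARD('d))) \<longlonglongrightarrow> C * 0" by (intro tendsto_intros lim)
  then have l: "(\<lambda>n. C * ((x n)\<^sup>2 * real (card (F n)) / real (m n) ^ CARD('d))) \<longlonglongrightarrow> 0" by simp
  have up: "\<forall>\<^sub>F n in sequentially. expectation (\<lambda>\<omega>. (x n * cnt (F n) i n \<omega>)\<^sup>2) \<le> C * ((x n)\<^sup>2 * real (card (F n)) / real (m n) ^ CARD('d))"
    using C(2) eventually_ge_at_top[of 1]
  proof eventually_elim
    case (elim n)
    have m0: "0 < real (m n) ^ CARD('d)" using m_pos elim(2) by simp
    have "finite (F n)" "F n \<subseteq> Zd" using finite_subset[OF F finite_grid] order_trans[OF F grid_subset_Zd] by auto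
    then have "real (m n) ^ CARD('d) * expectation (\<lambda>\<omega>. (cnt (F n) i n \<omega>)\<^sup>2) \<le> C * real (card (F n))"
      by (rule elim(1)[rule_format])
    then have "expectation (\<lambda>\<omega>. (cnt (F n) i n \<omega>)\<^sup>2) \<le> C * real (card (F n)) / real (m n) ^ CARD('d)"
      using m0 by (simp add: pos_le_divide_eq mult.commute)
    from mult_left_mono[OF this, of "(x n)\<^sup>2"] show ?case by (simp add: power_mult_distrib mult_ac)
  qed
  have low: "\<forall>\<^sub>F n in sequentially. 0 \<le> expectation (\<lambda>\<omega>. (x n * cnt (F n) i n \<omega>)\<^sup>2)" by simp
  show "(\<lambda>n. expectation (\<lambda>\<omega>. (x n * cnt (F n) i n \<omega>)\<^sup>2)) \<longlonglongrightarrow> 0"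
    by (rule tendsto_sandwich[OF low up tendsto_const l])
qed simp

lemma m_gt_0: "1 \<le> n \<Longrightarrow> 0 < m n" using m_pos by simp

lemma b_square_card: "1 \<le> n \<Longrightarrow> (x * b n)\<^sup>2 * k / real (m n) ^ CARD('d) = x\<^sup>2 * (k / real n ^ CARD('d))"
  using m_gt_0[of n] by (simp add: power_mult_distrib b_square)

text \<open>A coordinate is the projection on an axis, so the second moment bound for linear
  combinations applies directly.\<close>

lemma lvec_tight: "prob_tight (\<lambda>n \<omega>. lvec n \<omega> $ i)"
proof -
  have e: "lvec n \<omega> $ i = b n * (\<Sum>s\<in>grid n. \<xi> (lin (axis i 1)) n s \<omega>)" for n \<omega>
    using inner_lvec[of "axis i 1" n \<omega>] by (simp add: inner_axis')
  obtain C where C: "0 < C" "\<forall>\<^sub>F n in sequentially. \<forall>F. finite F \<longrightarrow> F \<subseteq> Zd \<longrightarrow>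
    real (m n) ^ CARD('d) * expectation (\<lambda>\<omega>. (\<Sum>s\<in>F. \<xi> (lin (axis i 1)) n s \<omega>)\<^sup>2) \<le> C * real (card F)"
    using sum_second_moment by blast
  have "\<forall>\<^sub>F n in sequentially. expectation (\<lambda>\<omega>. (b n * (\<Sum>s\<in>grid n. \<xi> (lin (axis i 1)) n s \<omega>))\<^sup>2) \<le> C"
    using C(2) eventually_ge_at_top[of 1]
  proof eventually_elim
    case (elim n)
    have m0: "0 < real (m n) ^ CARD('d)" using m_pos elim(2) by simp
    have n0: "0 < real n ^ CARD('d)" using elim(2) by simp
    have "real (m n) ^ CARD('d) * expectation (\<lambda>\<omega>. (\<Sum>s\<in>grid n. \<xi> (lin (axis i 1)) n s \<omega>)\<^sup>2) \<le> C * real n ^ CARD('d)"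
      using elim(1)[rule_format, OF finite_grid grid_subset_Zd, of n] by (simp add: card_grid)
    then have "(real (m n) ^ CARD('d) * expectation (\<lambda>\<omega>. (\<Sum>s\<in>grid n. \<xi> (lin (axis i 1)) n s \<omega>)\<^sup>2)) / real n ^ CARD('d) \<le> C"
      using n0 by (simp add: pos_divide_le_eq)
    then show ?case by (simp add: power_mult_distrib b_square)
  qed
  then show ?thesis unfolding e
  proof (rule prob_tight_L2[rotated 2])
    show "integrable M (\<lambda>\<omega>. (b n * (\<Sum>s\<in>grid n. \<xi> (lin (axis i 1)) n s \<omega>))\<^sup>2)" for n
      unfolding power_mult_distrib power2_eq_square[of "sum _ _"] sum_product
      by (intro integrable_mult_right Bochner_Integration.integrable_sum xi_mult_integrable)
  qed measurable
qed

text \<open>The denominator of the empirical extremogram, blown up by m^d so that it has a positive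
  limit.\<close>

definition den :: "nat \<Rightarrow> 'w \<Rightarrow> real" where
  "den n \<omega> = real (m n) ^ CARD('d) * ((\<Sum>s\<in>grid n. ind None n s \<omega>) / real n ^ CARD('d))"

lemma den_measurable[measurable]: "den n \<in> borel_measurable M" unfolding den_def by measurable

lemma sum_ind: "finite F \<Longrightarrow> (\<Sum>s\<in>F. ind i n s \<omega>) = real (card F) * p i n + cnt F i n \<omega>"
  by (simp add: cnt_def sum_subtractf)

text \<open>The fluctuation has variance of order (m / n)^d; the remaining difference is
  deterministic, so its exceedance probabilities are eventually exactly 0.\<close>

lemma den_null: "prob_null (\<lambda>n \<omega>. den n \<omega> - mA)"
proof -
  let ?md = "\<lambda>n. real (m n) ^ CARD('d)" and ?nd = "\<lambda>n. real n ^ CARD('d)"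
  have "prob_null (\<lambda>n \<omega>. (?md n / ?nd n) * cnt (grid n) None n \<omega>)"
  proof (rule cnt_null)
    have "(\<lambda>n. (real (m n) / real n) ^ CARD('d)) \<longlonglongrightarrow> 0 ^ CARD('d)" by (intro tendsto_intros m_r)
    then have "(\<lambda>n. (real (m n) / real n) ^ CARD('d)) \<longlonglongrightarrow> 0" by (simp add: power_0_left)
    moreover have "\<forall>\<^sub>F n in sequentially. (real (m n) / real n) ^ CARD('d)
        = (?md n / ?nd n)\<^sup>2 * real (card (grid n :: (real^'d) set)) / ?md n"
      using eventually_ge_at_top[of 1]
    proof eventually_elim
      case (elim n)
      then have "0 < ?md n" "0 < ?nd n" using m_pos by auto
      then show ?case by (simp add: card_grid power_divide power2_eq_square)
    qed
    ultimately show "(\<lambda>n. (?md n / ?nd n)\<^sup>2 * real (card (grid n :: (real^'d) set)) / ?md n) \<longlonglongrightarrow> 0"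
      by (simp add: tendsto_cong)
  qed simp
  moreover have "prob_null (\<lambda>n \<omega>. den n \<omega> - mA - (?md n / ?nd n) * cnt (grid n) None n \<omega>)"
    unfolding prob_null_def
  proof (intro allI impI)
    fix \<epsilon> :: real assume \<epsilon>: "0 < \<epsilon>"
    have "\<forall>\<^sub>F n in sequentially. dist (?md n * p None n) mA < \<epsilon>" by (rule tendstoD[OF scaled_p_None_limit \<epsilon>])
    then have "\<forall>\<^sub>F n in sequentially. 0 = \<P>(\<omega> in M. \<epsilon> < \<bar>den n \<omega> - mA - (?md n / ?nd n) * cnt (grid n) None n \<omega>\<bar>)"
      using eventually_ge_at_top[of 1]
    proof eventually_elim
      case (elim n)
      have n0: "0 < ?nd n" using elim(2) by simp
      have eq: "den n \<omega> - mA - (?md n / ?nd n) * cnt (grid n) None n \<omega> = ?md n * p None n - mA" for \<omega>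
        using n0 unfolding den_def sum_ind[OF finite_grid] by (simp add: card_grid field_simps)
      then have "{\<omega> \<in> space M. \<epsilon> < \<bar>den n \<omega> - mA - (?md n / ?nd n) * cnt (grid n) None n \<omega>\<bar>} = {}"
        unfolding eq using elim(1) by (auto simp: dist_real_def)
      then show ?case by (simp only: measure_empty)
    qed
    then show "(\<lambda>n. \<P>(\<omega> in M. \<epsilon> < \<bar>den n \<omega> - mA - (?md n / ?nd n) * cnt (grid n) None n \<omega>\<bar>)) \<longlonglongrightarrow> 0"
      by (rule Lim_transform_eventually[OF tendsto_const])
  qed
  ultimately have "prob_null (\<lambda>n \<omega>. (den n \<omega> - mA - (?md n / ?nd n) * cnt (grid n) None n \<omega>) + (?md n / ?nd n) * cnt (grid n) None n \<omega>)"
    by (intro prob_null_add) measurable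
  then show ?thesis by simp
qed

definition zvec :: "nat \<Rightarrow> 'w \<Rightarrow> real^'p" where
  "zvec n \<omega> = (real n / real (m n)) powr (real CARD('d) / 2) *\<^sub>R
     (\<chi> i. emp_extremogram X a A B m n (h i) \<omega> - pre_extremogram M X a A B m n (h i))"

text \<open>Three sources of error: averaging over the lagged grid instead of n^d sites, the
  boundary sites whose translate leaves the grid, and the pre-asymptotic ratio in place of its
  limit.\<close>

definition lag_err :: "'p \<Rightarrow> nat \<Rightarrow> 'w \<Rightarrow> real" where
  "lag_err i n \<omega> = ((real n ^ CARD('d) / real (card (grid_lag n (h i))) - 1) * b n) * cnt (grid_lag n (h i)) (Some i) n \<omega>
    + ((- b n) * cnt (grid n - grid_lag n (h i)) (Some i) n \<omega>
    + ((mD i / mA - p (Some i) n / p None n) * b n) * cnt (grid n) None n \<omega>)"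

lemma h_Zd: "h i \<in> Zd" using lags by (auto simp: zball_def)

lemma ratio_limit: "(\<lambda>n. p (Some i) n / p None n) \<longlonglongrightarrow> mD i / mA"
proof -
  have "(\<lambda>n. (real (m n) ^ CARD('d) * p (Some i) n) / (real (m n) ^ CARD('d) * p None n)) \<longlonglongrightarrow> mD i / mA"
    by (intro tendsto_divide scaled_p_Some_limit scaled_p_None_limit) (use mA_pos in simp)
  moreover have "\<forall>\<^sub>F n in sequentially. (real (m n) ^ CARD('d) * p (Some i) n) / (real (m n) ^ CARD('d) * p None n) = p (Some i) n / p None n"
    using eventually_ge_at_top[of 1] by eventually_elim (use m_gt_0 in fastforce)
  ultimately show ?thesis by (simp add: tendsto_cong)
qed

lemma inverse_lag_ratio: "(\<lambda>n. real n ^ CARD('d) / real (card (grid_lag n (h i)))) \<longlonglongrightarrow> 1"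
  using tendsto_inverse[OF card_grid_lag_ratio[OF h_Zd[of i]]] by simp

lemma grid_lag_subset: "grid_lag n u \<subseteq> grid n" by (auto simp: grid_lag_def)

text \<open>Each condition of \<open>cnt_null\<close> becomes a squared coefficient times a
  proportion of sites. The coefficient tends to 0 in the first and third term, the proportion in the
  second.\<close>

lemma lag_err_null: "prob_null (lag_err i)"
  unfolding lag_err_def
proof (intro prob_null_add cnt_null)
  have nz: "\<forall>\<^sub>F n in sequentially. 1 \<le> n" by (rule eventually_ge_at_top)
  show "grid_lag n (h i) \<subseteq> grid n" for n by (rule grid_lag_subset)
  have "(\<lambda>n. (real n ^ CARD('d) / real (card (grid_lag n (h i))) - 1)\<^sup>2 * (real (card (grid_lag n (h i))) / real n ^ CARD('d))) \<longlonglongrightarrow> (1 - 1)\<^sup>2 * 1"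
    by (intro tendsto_intros inverse_lag_ratio card_grid_lag_ratio h_Zd)
  then have "(\<lambda>n. (real n ^ CARD('d) / real (card (grid_lag n (h i))) - 1)\<^sup>2 * (real (card (grid_lag n (h i))) / real n ^ CARD('d))) \<longlonglongrightarrow> 0" by simp
  then show "(\<lambda>n. ((real n ^ CARD('d) / real (card (grid_lag n (h i))) - 1) * b n)\<^sup>2 * real (card (grid_lag n (h i))) / real (m n) ^ CARD('d)) \<longlonglongrightarrow> 0"
    by (rule Lim_transform_eventually) (use nz in eventually_elim, simp add: b_square_card)
  have "(\<lambda>n. 1 - real (card (grid_lag n (h i))) / real n ^ CARD('d)) \<longlonglongrightarrow> 1 - 1"
    by (intro tendsto_intros card_grid_lag_ratio h_Zd)
  then have l: "(\<lambda>n. 1 - real (card (grid_lag n (h i))) / real n ^ CARD('d)) \<longlonglongrightarrow> 0" by simp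
  show "(\<lambda>n. (- b n)\<^sup>2 * real (card (grid n - grid_lag n (h i))) / real (m n) ^ CARD('d)) \<longlonglongrightarrow> 0"
  proof (rule Lim_transform_eventually[OF l])
    show "\<forall>\<^sub>F n in sequentially. 1 - real (card (grid_lag n (h i))) / real n ^ CARD('d)
      = (- b n)\<^sup>2 * real (card (grid n - grid_lag n (h i))) / real (m n) ^ CARD('d)"
      using nz
    proof eventually_elim
      case (elim n)
      have "card (grid n - grid_lag n (h i)) = card (grid n :: (real^'d) set) - card (grid_lag n (h i))"
        by (rule card_Diff_subset[OF finite_subset[OF grid_lag_subset finite_grid] grid_lag_subset])
      moreover have "card (grid_lag n (h i)) \<le> card (grid n :: (real^'d) set)"
        by (rule card_mono[OF finite_grid grid_lag_subset])
      ultimately have "real (card (grid n - grid_lag n (h i))) = real n ^ CARD('d) - real (card (grid_lag n (h i)))"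
        by (simp add: of_nat_diff card_grid)
      then show ?case using b_square_card[OF elim, of 1] elim by (simp add: diff_divide_distrib)
    qed
  qed
  have "(\<lambda>n. (mD i / mA - p (Some i) n / p None n)\<^sup>2) \<longlonglongrightarrow> (mD i / mA - mD i / mA)\<^sup>2"
    by (intro tendsto_intros ratio_limit)
  then have "(\<lambda>n. (mD i / mA - p (Some i) n / p None n)\<^sup>2) \<longlonglongrightarrow> 0" by simp
  then show "(\<lambda>n. ((mD i / mA - p (Some i) n / p None n) * b n)\<^sup>2 * real (card (grid n :: (real^'d) set)) / real (m n) ^ CARD('d)) \<longlonglongrightarrow> 0"
    by (rule Lim_transform_eventually) (use nz in eventually_elim, simp add: b_square_card card_grid)
qed (auto simp: borel_measurable_add)

lemma p_prob: "p i n = \<P>(\<omega> in M. ereal (X 0 \<omega> / a (m n)) \<in> A \<and> ereal (X (lag i) \<omega> / a (m n)) \<in> lag_set i)"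
  using expectation_ind_mult[of i n i 0] unfolding vec_scaled_in_D_set by (simp add: ind_idem p_def)

lemma pre_extremogram_eq: "pre_extremogram M X a A B m n (h i) = p (Some i) n / p None n"
  unfolding pre_extremogram_def p_prob by (simp add: lag_def lag_set_def)

lemma emp_extremogram_eq:
  "emp_extremogram X a A B m n (h i) \<omega>
    = ((\<Sum>s\<in>grid_lag n (h i). ind (Some i) n s \<omega>) / real (card (grid_lag n (h i)))) / ((\<Sum>s\<in>grid n. ind None n s \<omega>) / real n ^ CARD('d))"
proof -
  have "ind (Some i) n s \<omega> = of_bool (ereal (X s \<omega> / a (m n)) \<in> A \<and> ereal (X (s + h i) \<omega> / a (m n)) \<in> B)"
    "ind None n s \<omega> = of_bool (ereal (X s \<omega> / a (m n)) \<in> A)" for s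
    by (auto simp: ind_def lag_def lag_set_def indicator_def)
  then show ?thesis by (simp add: emp_extremogram_def card_grid)
qed

text \<open>An exact identity rather than an expansion, obtained by multiplying out the
  denominator.\<close>

lemma zvec_den:
  assumes n: "1 \<le> n" and p0: "0 < p None n" and \<ell>: "0 < card (grid_lag n (h i))" and d: "0 < den n \<omega>"
  shows "zvec n \<omega> $ i * den n \<omega> = mA * lvec n \<omega> $ i + lag_err i n \<omega>"
proof -
  let ?md = "real (m n) ^ CARD('d)" and ?nd = "real n ^ CARD('d)" and ?l = "real (card (grid_lag n (h i)))"
  let ?q = "p (Some i) n / p None n" and ?TL = "cnt (grid_lag n (h i)) (Some i) n \<omega>" and ?T0 = "cnt (grid n) None n \<omega>"
  have m0: "0 < ?md" and n0: "0 < ?nd" and mn: "0 < real (m n)" "0 < real n" using n m_pos by auto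
  have l0: "0 < ?l" using \<ell> by simp
  have b0: "0 < b n" using mn by (simp add: b_def)
  have sc: "(real n / real (m n)) powr (real CARD('d) / 2) = inverse (b n)"
  proof -
    have "(real n / real (m n)) powr (real CARD('d) / 2) = ((real n / real (m n)) powr (1/2)) powr real CARD('d)"
      by (simp add: powr_powr)
    also have "\<dots> = sqrt (real n / real (m n)) ^ CARD('d)" using mn by (simp add: powr_half_sqrt powr_realpow)
    also have "\<dots> = inverse (b n)" by (simp add: b_def power_inverse[symmetric] real_sqrt_inverse[symmetric])
    finally show ?thesis .
  qed
  define W where "W = (\<Sum>s\<in>grid n. ind None n s \<omega>) / ?nd"
  have W: "W = p None n + ?T0 / ?nd" unfolding W_def sum_ind[OF finite_grid] using n0 by (simp add: card_grid field_simps)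
  have dW: "den n \<omega> = ?md * W" by (simp add: den_def W_def)
  have W0: "0 < W" using d m0 by (simp add: dW zero_less_mult_iff)
  have fl: "finite (grid_lag n (h i))" using finite_subset[OF grid_lag_subset finite_grid] .
  have NL: "(\<Sum>s\<in>grid_lag n (h i). ind (Some i) n s \<omega>) / ?l = p (Some i) n + ?TL / ?l"
    unfolding sum_ind[OF fl] using l0 by (simp add: field_simps)
  have "zvec n \<omega> $ i = inverse (b n) * ((p (Some i) n + ?TL / ?l) / W - ?q)"
  proof -
    have "zvec n \<omega> $ i = inverse (b n) * (emp_extremogram X a A B m n (h i) \<omega> - pre_extremogram M X a A B m n (h i))"
      by (simp add: zvec_def sc)
    then show ?thesis unfolding emp_extremogram_eq pre_extremogram_eq NL W_def .
  qed
  note z0 = this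
  have "zvec n \<omega> $ i * den n \<omega> = inverse (b n) * ?md * (p (Some i) n + ?TL / ?l - ?q * W)"
  proof -
    have "(x / W - q) * W = x - q * W" for x q using W0 by (simp add: left_diff_distrib)
    then have "inverse (b n) * ?md * ((x / W - q) * W) = inverse (b n) * ?md * (x - q * W)" for x q by simp
    from this[of "p (Some i) n + ?TL / ?l" ?q] show ?thesis unfolding dW z0 by (simp only: mult_ac)
  qed
  \<comment> \<open>The means cancel exactly because ?q is the ratio of the pre-asymptotic
    probabilities; centring at the limit would leave a bias here.\<close>
  also have "p (Some i) n + ?TL / ?l - ?q * W = ?TL / ?l - ?q * (?T0 / ?nd)"
    unfolding W using p0 by (simp add: field_simps)
  \<comment> \<open>By b^2 = m^d / n^d the two normalisations combine into that of the
    counts.\<close>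
  also have "inverse (b n) * ?md = b n * ?nd"
  proof -
    have "?md = b n * b n * ?nd" using b_square[of n] n0 by (simp add: power2_eq_square)
    then show ?thesis using b0 by simp
  qed
  also have "b n * ?nd * (?TL / ?l - ?q * (?T0 / ?nd)) = b n * (?nd / ?l * ?TL) - b n * ?q * ?T0"
    using n0 l0 by (simp add: field_simps)
  finally have z: "zvec n \<omega> $ i * den n \<omega> = b n * (?nd / ?l * ?TL) - b n * ?q * ?T0" .
  have split: "cnt (grid n) (Some i) n \<omega> = cnt (grid n - grid_lag n (h i)) (Some i) n \<omega> + ?TL"
    unfolding cnt_def by (rule sum.subset_diff[OF grid_lag_subset finite_grid])
  have L: "mA * lvec n \<omega> $ i = b n * cnt (grid n) (Some i) n \<omega> - b n * (mD i / mA) * ?T0"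
    using mA_pos by (simp add: lvec_def power2_eq_square field_simps)
  show ?thesis unfolding z L lag_err_def split by (simp add: algebra_simps)
qed

lemma zvec_measurable[measurable]: "(\<lambda>\<omega>. zvec n \<omega> $ i) \<in> borel_measurable M"
  unfolding zvec_def by (simp add: emp_extremogram_eq)

lemma lvec_measurable[measurable]: "(\<lambda>\<omega>. lvec n \<omega> $ i) \<in> borel_measurable M"
  unfolding lvec_def by simp

lemma zvec_lvec_null: "prob_null (\<lambda>n \<omega>. zvec n \<omega> $ i - lvec n \<omega> $ i)"
proof (rule prob_null_ratio[where W = den and q = mA and \<delta> = "lag_err i"])
  have "\<forall>\<^sub>F n in sequentially. 0 < real (m n) ^ CARD('d) * p None n"
    by (rule order_tendstoD(1)[OF scaled_p_None_limit mA_pos])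
  moreover have "\<forall>\<^sub>F n in sequentially. 0 < real (card (grid_lag n (h i))) / real n ^ CARD('d)"
    by (rule order_tendstoD(1)[OF card_grid_lag_ratio[OF h_Zd]]) simp
  ultimately show "\<forall>\<^sub>F n in sequentially. \<forall>\<omega>\<in>space M. 0 < den n \<omega> \<longrightarrow> zvec n \<omega> $ i * den n \<omega> = mA * lvec n \<omega> $ i + lag_err i n \<omega>"
    using eventually_ge_at_top[of 1]
  proof eventually_elim
    case (elim n)
    have "0 < p None n" using elim(1) by (simp add: zero_less_mult_iff)
    moreover have "0 < card (grid_lag n (h i))" using elim(2) by (simp add: zero_less_divide_iff)
    ultimately show ?case using zvec_den[OF elim(3)] by blast
  qed
  show "lag_err i n \<in> borel_measurable M" for n unfolding lag_err_def by measurable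
qed (simp_all add: mA_pos lvec_tight lag_err_null den_null)

lemma zvec_tight:
  assumes \<epsilon>: "0 < \<epsilon>"
  shows "\<exists>K. \<forall>\<^sub>F n in sequentially. \<P>(\<omega> in M. norm (zvec n \<omega>) > K) < \<epsilon>"
proof -
  \<comment> \<open>Each of the p coordinates is split into its linearised part and the remainder,
    which makes 2 p exceptional events.\<close>
  let ?e = "\<epsilon> / (2 * real CARD('p))"
  have e: "0 < ?e" using \<epsilon> by simp
  have "\<forall>i. \<exists>K. \<forall>\<^sub>F n in sequentially. \<P>(\<omega> in M. K < \<bar>lvec n \<omega> $ i\<bar>) < ?e"
    using lvec_tight e unfolding prob_tight_def by blast
  from choice[OF this] obtain K where K: "\<forall>i. \<forall>\<^sub>F n in sequentially. \<P>(\<omega> in M. K i < \<bar>lvec n \<omega> $ i\<bar>) < ?e" ..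
  define K0 where "K0 = (\<Sum>i\<in>UNIV. \<bar>K i\<bar>) + 1"
  have K0: "K i + 1 \<le> K0" for i
    using member_le_sum[of i UNIV "\<lambda>i. \<bar>K i\<bar>"] abs_ge_self[of "K i"] by (simp add: K0_def)
  have "\<forall>\<^sub>F n in sequentially. \<P>(\<omega> in M. K0 < \<bar>zvec n \<omega> $ i\<bar>) < ?e + ?e" for i
    using K[rule_format, of i] prob_null_eventually[OF zvec_lvec_null[of i] zero_less_one e]
  proof eventually_elim
    case (elim n)
    have "\<P>(\<omega> in M. K0 < \<bar>zvec n \<omega> $ i\<bar>) \<le> prob ({\<omega> \<in> space M. K i < \<bar>lvec n \<omega> $ i\<bar>} \<union> {\<omega> \<in> space M. 1 < \<bar>zvec n \<omega> $ i - lvec n \<omega> $ i\<bar>})"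
    proof (rule finite_measure_mono)
      show "{\<omega> \<in> space M. K0 < \<bar>zvec n \<omega> $ i\<bar>} \<subseteq> {\<omega> \<in> space M. K i < \<bar>lvec n \<omega> $ i\<bar>} \<union> {\<omega> \<in> space M. 1 < \<bar>zvec n \<omega> $ i - lvec n \<omega> $ i\<bar>}"
      proof
        fix \<omega> assume w: "\<omega> \<in> {\<omega> \<in> space M. K0 < \<bar>zvec n \<omega> $ i\<bar>}"
        then have "K0 < \<bar>zvec n \<omega> $ i\<bar>" by simp
        then have "K i < \<bar>lvec n \<omega> $ i\<bar> \<or> 1 < \<bar>zvec n \<omega> $ i - lvec n \<omega> $ i\<bar>" using K0[of i] by linarith
        then show "\<omega> \<in> {\<omega> \<in> space M. K i < \<bar>lvec n \<omega> $ i\<bar>} \<union> {\<omega> \<in> space M. 1 < \<bar>zvec n \<omega> $ i - lvec n \<omega> $ i\<bar>}" using w by simp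
      qed
    qed measurable
    also have "\<dots> \<le> \<P>(\<omega> in M. K i < \<bar>lvec n \<omega> $ i\<bar>) + \<P>(\<omega> in M. 1 < \<bar>zvec n \<omega> $ i - lvec n \<omega> $ i\<bar>)"
      by (rule measure_Un_le) measurable
    finally show ?case using elim by linarith
  qed
  then have "\<forall>\<^sub>F n in sequentially. \<forall>i\<in>UNIV. \<P>(\<omega> in M. K0 < \<bar>zvec n \<omega> $ i\<bar>) < ?e + ?e"
    by (intro eventually_ball_finite) auto
  then have "\<forall>\<^sub>F n in sequentially. \<P>(\<omega> in M. norm (zvec n \<omega>) > real CARD('p) * K0) < \<epsilon>"
  proof eventually_elim
    case (elim n)
    have "\<P>(\<omega> in M. real CARD('p) * K0 < norm (zvec n \<omega>)) \<le> (\<Sum>i\<in>UNIV. \<P>(\<omega> in M. K0 < \<bar>zvec n \<omega> $ i\<bar>))"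
      by (rule vec_norm_prob) measurable
    also have "\<dots> < (\<Sum>i\<in>(UNIV::'p set). ?e + ?e)" using elim by (intro sum_strict_mono) auto
    also have "\<dots> = \<epsilon>" by simp
    finally show ?case .
  qed
  then show ?thesis by blast
qed

lemma inner_null: "prob_null (\<lambda>n \<omega>. t \<bullet> zvec n \<omega> - t \<bullet> lvec n \<omega>)"
  unfolding prob_null_def
proof (intro allI impI)
  fix \<epsilon> :: real assume \<epsilon>: "0 < \<epsilon>"
  define \<delta> where "\<delta> = \<epsilon> / ((norm t + 1) * real CARD('p))"
  have nt: "0 < norm t + 1" by (simp add: add_nonneg_pos)
  have \<delta>: "0 < \<delta>" using \<epsilon> nt by (simp add: \<delta>_def)
  have l: "(\<lambda>n. \<Sum>i\<in>(UNIV::'p set). \<P>(\<omega> in M. \<delta> < \<bar>(zvec n \<omega> - lvec n \<omega>) $ i\<bar>)) \<longlonglongrightarrow> 0"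
  proof -
    have "(\<lambda>n. \<Sum>i\<in>(UNIV::'p set). \<P>(\<omega> in M. \<delta> < \<bar>(zvec n \<omega> - lvec n \<omega>) $ i\<bar>)) \<longlonglongrightarrow> (\<Sum>i\<in>(UNIV::'p set). 0)"
      unfolding vector_minus_component by (intro tendsto_sum prob_nullD zvec_lvec_null \<delta>)
    then show ?thesis by simp
  qed
  have "\<P>(\<omega> in M. \<epsilon> < \<bar>t \<bullet> zvec n \<omega> - t \<bullet> lvec n \<omega>\<bar>) \<le> (\<Sum>i\<in>(UNIV::'p set). \<P>(\<omega> in M. \<delta> < \<bar>(zvec n \<omega> - lvec n \<omega>) $ i\<bar>))" for n
  proof -
    have [measurable]: "(\<lambda>\<omega>. zvec n \<omega> - lvec n \<omega>) \<in> borel_measurable M"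
      by (rule vec_borel_measurable) (simp add: borel_measurable_diff)
    have "\<P>(\<omega> in M. \<epsilon> < \<bar>t \<bullet> zvec n \<omega> - t \<bullet> lvec n \<omega>\<bar>) \<le> \<P>(\<omega> in M. real CARD('p) * \<delta> < norm (zvec n \<omega> - lvec n \<omega>))"
    proof (rule finite_measure_mono)
      show "{\<omega> \<in> space M. \<epsilon> < \<bar>t \<bullet> zvec n \<omega> - t \<bullet> lvec n \<omega>\<bar>} \<subseteq> {\<omega> \<in> space M. real CARD('p) * \<delta> < norm (zvec n \<omega> - lvec n \<omega>)}"
      proof
        fix \<omega> assume w: "\<omega> \<in> {\<omega> \<in> space M. \<epsilon> < \<bar>t \<bullet> zvec n \<omega> - t \<bullet> lvec n \<omega>\<bar>}"
        then have "\<epsilon> < \<bar>t \<bullet> (zvec n \<omega> - lvec n \<omega>)\<bar>" by (simp add: inner_diff_right)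
        also have "\<dots> \<le> norm t * norm (zvec n \<omega> - lvec n \<omega>)" by (rule Cauchy_Schwarz_ineq2)
        also have "\<dots> \<le> (norm t + 1) * norm (zvec n \<omega> - lvec n \<omega>)" by (intro mult_right_mono) auto
        finally have "\<epsilon> / (norm t + 1) < norm (zvec n \<omega> - lvec n \<omega>)" using nt by (simp add: pos_divide_less_eq mult.commute)
        moreover have "real CARD('p) * \<delta> = \<epsilon> / (norm t + 1)" by (simp add: \<delta>_def)
        ultimately show "\<omega> \<in> {\<omega> \<in> space M. real CARD('p) * \<delta> < norm (zvec n \<omega> - lvec n \<omega>)}" using w by simp
      qed
    qed measurable
    also have "\<dots> \<le> (\<Sum>i\<in>(UNIV::'p set). \<P>(\<omega> in M. \<delta> < \<bar>(zvec n \<omega> - lvec n \<omega>) $ i\<bar>))"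
      by (rule vec_norm_prob) simp
    finally show ?thesis .
  qed
  then show "(\<lambda>n. \<P>(\<omega> in M. \<epsilon> < \<bar>t \<bullet> zvec n \<omega> - t \<bullet> lvec n \<omega>\<bar>)) \<longlonglongrightarrow> 0"
    by (intro tendsto_sandwich[OF always_eventually always_eventually tendsto_const l]) auto
qed

lemma zvec_converges: "\<exists>N. mv_normal N 0 limit_cov \<and> converges_in_dist M zvec N"
proof -
  obtain N where N: "mv_normal N 0 limit_cov" using gaussian_exists[OF Pi_symmetric Pi_nonneg] by blast
  have zm[measurable]: "zvec n \<in> borel_measurable M" for n by (rule vec_borel_measurable) simp
  have lm[measurable]: "lvec n \<in> borel_measurable M" for n by (rule vec_borel_measurable) simp
  have "converges_in_dist M zvec N"
  proof (rule multivariate_levy[OF zm])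
    show "prob_space N" "sets N = sets borel" using N by (auto simp: mv_normal_def)
    fix t
    have "(CLINT x|N. iexp (t \<bullet> x)) = of_real (exp (- (t \<bullet> (limit_cov *v t)) / 2))" using N by (simp add: mv_normal_def)
    then show "(\<lambda>n. CLINT \<omega>|M. iexp (t \<bullet> zvec n \<omega>)) \<longlonglongrightarrow> (CLINT x|N. iexp (t \<bullet> x))"
      using char_diff_limit[OF _ _ inner_null lvec_char_limit, of t] by simp
  qed (rule zvec_tight)
  with N show ?thesis by blast
qed

end

theorem theorem4p2:
  fixes M :: "'w measure"
    and X :: "real^'d::finite \<Rightarrow> 'w \<Rightarrow> real"
    and a :: "nat \<Rightarrow> real"
    and \<mu> :: "(real^'d) set \<Rightarrow> (real^'d \<Rightarrow> ereal) measure"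
    and nrm :: "real^'d \<Rightarrow> real"
    and \<gamma> :: real
    and h :: "'p::finite \<Rightarrow> real^'d"
    and A B :: "ereal set"
    and m :: "nat \<Rightarrow> nat"
    and r :: "nat \<Rightarrow> real"
  assumes norm: "is_norm nrm"
    and prob: "prob_space M"
    and meas: "\<forall>s. X s \<in> borel_measurable M"
    and stat: "strictly_stationary M X"
    and regvar: "regularly_varying M X a \<mu>"
    and gamma: "\<gamma> > 0"
    and lags: "inj h" "range h \<subseteq> zball nrm 0 \<gamma>"
    and A: "continuity_set (mu0 \<mu>) A" "measure (mu0 \<mu>) A > 0"
    and B: "continuity_set (mu0 \<mu>) B"
    and M1: "alpha_mixing M X nrm"
    and m_pos: "\<forall>n\<ge>1. m n > 0"
    and m_r: "filterlim m at_top sequentially" "filterlim r at_top sequentially"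
      "(\<lambda>n. real (m n) / real n) \<longlonglongrightarrow> 0" "(\<lambda>n. r n / real (m n)) \<longlonglongrightarrow> 0"
    and M2: "(\<lambda>n. (real (m n))\<^sup>2 * (r n)\<^sup>2 / real n) \<longlonglongrightarrow> 0"
    and M3: "\<forall>\<epsilon>>0.
      (\<lambda>k::nat. limsup (\<lambda>n. ereal (\<Sum>u\<in>{u \<in> Zd. real k < nrm u \<and> nrm u \<le> r n}.
          real (m n) ^ CARD('d) *
          \<P>(\<omega> in M. Max ((\<lambda>s. \<bar>X s \<omega>\<bar>) ` zball nrm 0 \<gamma>) > \<epsilon> * a (m n) \<and>
                      Max ((\<lambda>s. \<bar>X s \<omega>\<bar>) ` zball nrm u \<gamma>) > \<epsilon> * a (m n))))) \<longlonglongrightarrow> 0"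
    and M4_i: "(\<lambda>n. real (m n) ^ CARD('d) *
        (\<Sum>\<^sub>\<infinity>u\<in>{u \<in> Zd. nrm u > r n}. alpha_Y M X nrm \<gamma> 1 1 (nrm u))) \<longlonglongrightarrow> 0"
    and M4_ii: "\<forall>k l. 2 \<le> k + l \<and> k + l \<le> 4 \<longrightarrow>
        (\<lambda>u. alpha_Y M X nrm \<gamma> k l (nrm u)) summable_on Zd"
    and M4_iii: "(\<lambda>n. real (m n) powr (real CARD('d) / 2) * real n powr (real CARD('d) / 2) *
        alpha_Y M X nrm \<gamma> 1 (n ^ CARD('d)) (r n)) \<longlonglongrightarrow> 0"
  shows "(\<forall>i j. (\<lambda>u. tau M X a nrm \<gamma> u (Dset nrm \<gamma> A B h i) (Dset nrm \<gamma> A B h j))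
              summable_on (Zd - {0})) \<and>
    (\<exists>N. mv_normal N 0 (Pi_mat M X a \<mu> nrm \<gamma> A B h) \<and>
      converges_in_dist M
        (\<lambda>n \<omega>. (real n / real (m n)) powr (real CARD('d) / 2) *\<^sub>R
           (\<chi> i. emp_extremogram X a A B m n (h i) \<omega> - pre_extremogram M X a A B m n (h i)))
        N)"
proof -
  interpret prob_space M by (rule prob)
  interpret extremogram_clt M X a \<mu> nrm \<gamma> h A B m r
    by unfold_locales (fact assms)+
  show ?thesis
    using tau_summable zvec_converges unfolding zvec_def by blast
qed

end
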